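(* Let $V$ be a differential subvariety of $\mathbb{P}^{n}$ (defined over $\mathcal{F}$), let $\mathcal{W}$ be the collection of $\delta$-subvarieties $W\subseteq\mathbb{P}^n\times\mathbb{A}^m$ ($m$ varying with $W$) associated to $V$ as described in the context, and for $W\in\mathcal{W}$ let $I$ be the differential ideal of $\mathcal{F}\{x_0,\dots,x_n,y_1,\dots,y_m\}$ generated by the defining polynomials of $W$. Then $V$ is $\delta$-complete if and only if for all $W\in\mathcal{W}$ the projective differential elimination ideal $\hat{I}_{\bar{x}}$ contains a $\delta$-polynomial in $\bar{y}$ having non-zero constant term. (Here "constant term" refers to the term in $\mathcal{F}$, an arbitrary element of $\mathcal{F}$, not necessarily one with derivative $0$.)
   Context: All differential rings are commutative with $1$ and carry a single derivation $\delta$; all differential fields ($\delta$-fields) have characteristic zero. $\mathcal{F}$ is a fixed arbitrary differentially closed field of characteristic zero (a model of $DCF_0$), contained in a large saturated model $\mathcal{U}$ of $DCF_0$. $\mathbb{P}^n$ and $\mathbb{A}^m$ mean $\mathbb{P}^n(\mathcal{U})$ and $\mathbb{A}^m(\mathcal{U})$. A $\delta$-polynomial is $\delta$-homogeneous with respect to $\bar x=(x_0,\dots,x_n)$ if there is a natural number $d$ such that replacing $\bar x$ by $\lambda\bar x$ multiplies it by $\lambda^d$, for all nonzero $\lambda$ in the ground $\delta$-field. $\delta$-subvarieties (Kolchin-closed subsets) of $\mathbb{A}^m$, resp. $\mathbb{P}^n$, are the zero loci, in $\mathcal{U}$-points, of sets of $\delta$-polynomials, resp. $\delta$-homogeneous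 $\delta$-polynomials, with coefficients in $\mathcal{F}$; Kolchin-closed subsets of a product with projective factors are defined by $\delta$-polynomials over $\mathcal{F}$ that are $\delta$-homogeneous in each group of projective coordinates. A projective $\delta$-variety $V$ is $\delta$-complete if for every projective $\delta$-variety $W$ over $\mathcal{F}$ and every Kolchin-closed $Z\subseteq V\times W$, the image $\pi_2(Z)\subseteq W$ under the second projection is Kolchin-closed (equivalently, one may take $W=\mathbb{A}^m$, $m$ arbitrary). The collection $\mathcal{W}$: call the projective coordinates $x_0,\dots,x_n$, and let $V$ be given by $\delta$-homogeneous defining $\delta$-polynomials over $\mathcal{F}$. $\mathcal{W}$ consists of all $W$ obtained as follows. Choose a non-empty subset $E\subseteq\{0,\dots,n\}$, and for each $i\in E$ choose some $j_i\neq i$ between $0$ and $n$. For each $i\in E$ choose finitely many $\delta$-monomials (in one differential variable) $t_{i_k}$, and let $t_{i_k}\left(\frac{x_{j_i}}{x_i}\right)$ be the result of replacing the variable by the fraction $\frac{x_{j_i}}{x_i}$ (derivatives computed by the quotient rule). For each $i\in E$ introduce new variables $y_{i_k}$, one for each $t_{i_k}$; there are $m$ such variables in all (over all $i\in E$), they are the affine coordinates of $\mathbb{A}^m$ and are also denoted $y_1,\dots,y_m$. Then $W\subseteq\mathbb{P}^n\times\mathbb{A}^m$ is the common zero locus of the following defining polynomials: (1) $x_j$ for all $0\le j\le n$ with $j\notin E$; (2) for each $i\in E$, the $\delta$-polynomial, $\delta$-homogeneous with respect to $x_0,\dots,x_n$, resulting from clearing denominators in $\sum_k y_{i_k}t_{i_k}\left(\frac{x_{j_i}}{x_i}\right)-1$;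 (3) the $\delta$-homogeneous $\delta$-polynomials that define $V$. If $I$ is a differential ideal of $\mathcal{F}\{\bar x,\bar y\}=\mathcal{F}\{x_0,\dots,x_n,y_1,\dots,y_m\}$ generated by $\delta$-polynomials that are $\delta$-homogeneous with respect to $x_0,\dots,x_n$, the projective differential elimination ideal of $I$ eliminating $\bar x$ is $$\hat{I}_{\bar x}=\{g\in\mathcal{F}\{\bar y\}\mid \text{for all } 0\le i\le n \text{ there is } e_i\ge 0 \text{ such that } x_i^{e_i}g\in I\}.$$ *)

theory Defs
  imports "HOL-Library.Poly_Mapping" "HOL-Library.Equipollence"
begin

section \<open>Differential rings and differential polynomials\<close>

definition derivation :: "('a::comm_ring_1 \<Rightarrow> 'a) \<Rightarrow> bool" where
  "derivation \<delta> \<longleftrightarrow>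
     (\<forall>a b. \<delta> (a + b) = \<delta> a + \<delta> b) \<and> (\<forall>a b. \<delta> (a * b) = \<delta> a * b + a * \<delta> b)"

definition delta_subfield :: "('a::field \<Rightarrow> 'a) \<Rightarrow> 'a set \<Rightarrow> bool" where
  "delta_subfield \<delta> K \<longleftrightarrow>
     1 \<in> K \<and> (\<forall>a\<in>K. \<forall>b\<in>K. a - b \<in> K \<and> a * b \<in> K) \<and> (\<forall>a\<in>K. inverse a \<in> K \<and> \<delta> a \<in> K)"

text \<open>
  A \<open>\<delta>\<close>-polynomial in the differential indeterminates \<open>v :: 'v\<close> is an ordinary polynomial in the
  algebraic indeterminates \<open>(v, k)\<close>, where \<open>(v, k)\<close> stands for the \<open>k\<close>-th derivative of \<open>v\<close>.
\<close>

type_synonym 'v dmonom = "('v \<times> nat) \<Rightarrow>\<^sub>0 nat"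
type_synonym ('v, 'a) dpoly = "'v dmonom \<Rightarrow>\<^sub>0 'a"

definition dconst :: "'a::comm_ring_1 \<Rightarrow> ('v, 'a) dpoly" where
  "dconst c = Poly_Mapping.single 0 c"

definition dvar :: "'v \<Rightarrow> nat \<Rightarrow> ('v, 'a::comm_ring_1) dpoly" where
  "dvar v k = Poly_Mapping.single (Poly_Mapping.single (v, k) 1) 1"

text \<open>The set \<open>K{v | v \<in> vs}\<close>, for \<open>K\<close> a subset of the coefficient ring.\<close>

definition dpolys :: "'a::comm_ring_1 set \<Rightarrow> 'v set \<Rightarrow> ('v, 'a) dpoly set" where
  "dpolys K vs =
     {p. \<forall>\<mu>\<in>Poly_Mapping.keys p.
           Poly_Mapping.lookup p \<mu> \<in> K \<and> fst ` Poly_Mapping.keys \<mu> \<subseteq> vs}"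

text \<open>
  The derivation of the ring of \<open>\<delta>\<close>-polynomials: it extends \<open>\<delta>\<close> on the coefficients and sends
  \<open>(v, k)\<close> to \<open>(v, Suc k)\<close>; see \<open>dderiv_dconst\<close>, \<open>dderiv_dvar\<close> and \<open>derivation_dderiv\<close>.
\<close>

definition dderiv :: "('a::comm_ring_1 \<Rightarrow> 'a) \<Rightarrow> ('v, 'a) dpoly \<Rightarrow> ('v, 'a) dpoly" where
  "dderiv \<delta> p =
     (\<Sum>\<mu>\<in>Poly_Mapping.keys p.
        Poly_Mapping.single \<mu> (\<delta> (Poly_Mapping.lookup p \<mu>)) +
        (\<Sum>(v, k)\<in>Poly_Mapping.keys \<mu>.
           Poly_Mapping.single
             (\<mu> - Poly_Mapping.single (v, k) 1 + Poly_Mapping.single (v, Suc k) 1)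
             (of_nat (Poly_Mapping.lookup \<mu> (v, k)) * Poly_Mapping.lookup p \<mu>)))"

text \<open>
  Substitution of \<open>\<sigma> v\<close> for \<open>v\<close>, with values in a differential ring with derivation \<open>D\<close>, where
  \<open>c\<close> embeds the coefficients.
\<close>

definition dsubst ::
  "('a \<Rightarrow> 'b) \<Rightarrow> ('b \<Rightarrow> 'b) \<Rightarrow> ('v \<Rightarrow> 'b) \<Rightarrow> ('v, 'a::comm_ring_1) dpoly \<Rightarrow> 'b::comm_ring_1" where
  "dsubst c D \<sigma> p =
     (\<Sum>\<mu>\<in>Poly_Mapping.keys p. c (Poly_Mapping.lookup p \<mu>) *
        (\<Prod>(v, k)\<in>Poly_Mapping.keys \<mu>. ((D ^^ k) (\<sigma> v)) ^ Poly_Mapping.lookup \<mu> (v, k)))"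

abbreviation deval :: "('a \<Rightarrow> 'a) \<Rightarrow> ('v \<Rightarrow> 'a) \<Rightarrow> ('v, 'a::comm_ring_1) dpoly \<Rightarrow> 'a" where
  "deval \<delta> \<equiv> dsubst (\<lambda>c. c) \<delta>"

lemma poly_mapping_sum_singles:
  "(p :: 'k \<Rightarrow>\<^sub>0 'a::comm_monoid_add)
     = (\<Sum>k\<in>Poly_Mapping.keys p. Poly_Mapping.single k (Poly_Mapping.lookup p k))"
  by (rule poly_mapping_eqI)
    (auto simp: lookup_sum lookup_single when_def sum.delta' in_keys_iff
      intro!: sum.neutral)

lemma single_sum_exponents:
  "finite A \<Longrightarrow> Poly_Mapping.single (sum f A) (1::'a::comm_ring_1)
     = (\<Prod>x\<in>A. Poly_Mapping.single (f x :: 'k \<Rightarrow>\<^sub>0 nat) 1)"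
proof (induction A rule: finite_induct)
  case (insert x A)
  then show ?case by (simp add: mult_single flip: insert.IH)
qed simp

lemma dvar_power: "dvar v k ^ e = Poly_Mapping.single (Poly_Mapping.single (v, k) e) 1"
  by (induction e) (simp_all add: dvar_def mult_single flip: single_add)

lemma dmonom_eq:
  "Poly_Mapping.single \<mu> (c::'a::comm_ring_1) =
     dconst c * (\<Prod>(v, k)\<in>Poly_Mapping.keys \<mu>. dvar v k ^ Poly_Mapping.lookup \<mu> (v, k))"
proof -
  have "Poly_Mapping.single \<mu> c = dconst c * Poly_Mapping.single \<mu> 1"
    by (simp add: dconst_def mult_single)
  also have "Poly_Mapping.single \<mu> (1::'a) = Poly_Mapping.single
    (\<Sum>w\<in>Poly_Mapping.keys \<mu>. Poly_Mapping.single w (Poly_Mapping.lookup \<mu> w)) 1"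
    using poly_mapping_sum_singles[of \<mu>] by simp
  also have "\<dots> = (\<Prod>(v, k)\<in>Poly_Mapping.keys \<mu>. dvar v k ^ Poly_Mapping.lookup \<mu> (v, k))"
    by (simp add: single_sum_exponents dvar_power case_prod_unfold)
  finally show ?thesis .
qed

lemma dpoly_induct [case_names const var add mult]:
  assumes "\<And>c. Q (dconst c)" "\<And>v k. Q (dvar v k)"
    and "\<And>p q. Q p \<Longrightarrow> Q q \<Longrightarrow> Q (p + q)" "\<And>p q. Q p \<Longrightarrow> Q q \<Longrightarrow> Q (p * q)"
  shows "Q (p :: ('v, 'a::comm_ring_1) dpoly)"
proof -
  have 0: "Q 0" "Q 1" using assms(1)[of 0] assms(1)[of 1] by (simp_all add: dconst_def)
  have pw: "Q q \<Longrightarrow> Q (q ^ e)" for q e by (induction e) (auto simp: 0 assms)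
  have pr: "finite A \<Longrightarrow> (\<And>x. Q (f x)) \<Longrightarrow> Q (prod f A)" for A and f :: "_ \<Rightarrow> ('v, 'a) dpoly"
    by (induction A rule: finite_induct) (auto simp: 0 assms)
  have sm: "finite A \<Longrightarrow> (\<And>x. Q (f x)) \<Longrightarrow> Q (sum f A)" for A and f :: "_ \<Rightarrow> ('v, 'a) dpoly"
    by (induction A rule: finite_induct) (auto simp: 0 assms)
  have "Q (Poly_Mapping.single \<mu> c)" for \<mu> c
    unfolding dmonom_eq by (intro assms(4) assms(1) pr) (auto intro: pw assms)
  then show ?thesis
    by (subst poly_mapping_sum_singles) (intro sm finite_keys)
qed

lemma derivation_add: "derivation \<delta> \<Longrightarrow> \<delta> (a + b) = \<delta> a + \<delta> b"
  and derivation_mult: "derivation \<delta> \<Longrightarrow> \<delta> (a * b) = \<delta> a * b + a * \<delta> b"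
  by (auto simp: derivation_def)

lemma derivation_0: "derivation \<delta> \<Longrightarrow> \<delta> 0 = 0"
  using derivation_add[of \<delta> 0 0] by simp

lemma derivation_1: "derivation \<delta> \<Longrightarrow> \<delta> 1 = 0"
  using derivation_mult[of \<delta> 1 1] by simp

lemma dderiv_dvar:
  assumes "derivation \<delta>" shows "dderiv \<delta> (dvar v k) = dvar v (Suc k)"
  using derivation_1[OF assms] by (simp add: dderiv_def dvar_def)

lemma dderiv_dconst:
  assumes "derivation \<delta>" shows "dderiv \<delta> (dconst c) = dconst (\<delta> c)"
  using derivation_0[OF assms] by (simp add: dderiv_def dconst_def)

definition dmonom_deriv :: "'v dmonom \<Rightarrow> ('v, 'a::comm_ring_1) dpoly" where
 "dmonom_deriv \<mu> = (\<Sum>(v, k)\<in>Poly_Mapping.keys \<mu>. Poly_Mapping.single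
     (\<mu> - Poly_Mapping.single (v, k) 1 + Poly_Mapping.single (v, Suc k) 1)
     (of_nat (Poly_Mapping.lookup \<mu> (v, k))))"

lemma dderiv_alt:
  "dderiv \<delta> p = (\<Sum>\<mu>\<in>Poly_Mapping.keys p.
      Poly_Mapping.single \<mu> (\<delta> (Poly_Mapping.lookup p \<mu>)) + dconst (Poly_Mapping.lookup p \<mu>) * dmonom_deriv \<mu>)"
  unfolding dderiv_def dmonom_deriv_def
  by (intro sum.cong refl arg_cong2[where f="(+)"])
     (auto simp: sum_distrib_left dconst_def mult_single case_prod_unfold mult.commute)

lemma dmonom_deriv_add:
  "dmonom_deriv (\<mu> + \<nu>) = dmonom_deriv \<mu> * Poly_Mapping.single \<nu> 1 + Poly_Mapping.single \<mu> 1 * dmonom_deriv \<nu>"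
proof -
  let ?k = "Poly_Mapping.keys \<mu> \<union> Poly_Mapping.keys \<nu>"
  let ?s = "\<lambda>\<mu>. (\<lambda>(v, k). Poly_Mapping.single
     (\<mu> - Poly_Mapping.single (v, k) 1 + Poly_Mapping.single (v, Suc k) 1)
     (of_nat (Poly_Mapping.lookup \<mu> (v, k))) :: ('a, 'b) dpoly)"
  have e: "dmonom_deriv \<rho> = sum (?s \<rho>) ?k" if "Poly_Mapping.keys \<rho> \<subseteq> ?k" for \<rho>
    unfolding dmonom_deriv_def using that
    by (intro sum.mono_neutral_left) (auto simp: in_keys_iff)
  have ex: "\<mu> + \<nu> - Poly_Mapping.single w 1 = (\<mu> - Poly_Mapping.single w 1) + \<nu>"
    if "Poly_Mapping.lookup \<mu> w \<noteq> 0" for \<mu> \<nu> :: "'a dmonom" and w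
    using that by (intro poly_mapping_eqI) (auto simp: lookup_add lookup_minus lookup_single when_def)
  have s: "?s (\<mu> + \<nu>) w = ?s \<mu> w * Poly_Mapping.single \<nu> 1 + Poly_Mapping.single \<mu> 1 * ?s \<nu> w" for w
  proof -
    obtain v k where w: "w = (v, k)" by force
    let ?u = "\<mu> + \<nu> - Poly_Mapping.single w 1 + Poly_Mapping.single (v, Suc k) (1::nat)"
    have "?s (\<mu> + \<nu>) w = Poly_Mapping.single ?u (of_nat (Poly_Mapping.lookup \<mu> w))
       + Poly_Mapping.single ?u (of_nat (Poly_Mapping.lookup \<nu> w))"
      by (simp add: w lookup_add single_add)
    also have "Poly_Mapping.single ?u (of_nat (Poly_Mapping.lookup \<mu> w)) = ?s \<mu> w * Poly_Mapping.single \<nu> 1"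
      using ex[of \<mu> w \<nu>] by (cases "Poly_Mapping.lookup \<mu> w = 0") (auto simp: w mult_single ac_simps)
    also have "Poly_Mapping.single ?u (of_nat (Poly_Mapping.lookup \<nu> w)) = Poly_Mapping.single \<mu> 1 * ?s \<nu> w"
      using ex[of \<nu> w \<mu>] by (cases "Poly_Mapping.lookup \<nu> w = 0") (auto simp: w mult_single ac_simps)
    finally show ?thesis .
  qed
  have "dmonom_deriv (\<mu> + \<nu>) = sum (?s (\<mu> + \<nu>)) ?k" by (intro e) (rule keys_add)
  also have "\<dots> = sum (?s \<mu>) ?k * Poly_Mapping.single \<nu> 1 + Poly_Mapping.single \<mu> 1 * sum (?s \<nu>) ?k"
    unfolding sum_distrib_left sum_distrib_right sum.distrib[symmetric]
    by (rule sum.cong[OF refl]) (rule s)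
  also have "sum (?s \<mu>) ?k = dmonom_deriv \<mu>" by (rule e[symmetric]) auto
  also have "sum (?s \<nu>) ?k = dmonom_deriv \<nu>" by (rule e[symmetric]) auto
  finally show ?thesis .
qed

lemma dderiv_add:
  assumes d: "derivation \<delta>" shows "dderiv \<delta> (p + q) = dderiv \<delta> p + dderiv \<delta> q"
  unfolding dderiv_alt
  by (rule setsum_keys_plus_distrib)
     (simp_all add: dconst_def derivation_0[OF d] derivation_add[OF d] single_add algebra_simps)

lemma dderiv_sum:
  assumes d: "derivation \<delta>" shows "dderiv \<delta> (sum f A) = (\<Sum>x\<in>A. dderiv \<delta> (f x))"
proof (induction A rule: infinite_finite_induct)
  case (insert x A)
  then show ?case by (simp add: dderiv_add[OF d])
qed (simp_all add: dderiv_def)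

lemma dderiv_single:
  assumes d: "derivation \<delta>"
  shows "dderiv \<delta> (Poly_Mapping.single \<mu> c) = Poly_Mapping.single \<mu> (\<delta> c) + dconst c * dmonom_deriv \<mu>"
  by (cases "c = 0") (simp_all add: dderiv_alt dconst_def derivation_0[OF d])

lemma dderiv_mult_single:
  assumes d: "derivation \<delta>"
  shows "dderiv \<delta> (Poly_Mapping.single \<mu> c * Poly_Mapping.single \<nu> e) =
    dderiv \<delta> (Poly_Mapping.single \<mu> c) * Poly_Mapping.single \<nu> e
     + Poly_Mapping.single \<mu> c * dderiv \<delta> (Poly_Mapping.single \<nu> e)"
proof -
  have s: "Poly_Mapping.single \<mu> c = dconst c * Poly_Mapping.single \<mu> 1" for \<mu> :: "'b dmonom" and c :: 'a
    by (simp add: dconst_def mult_single)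
  have c: "dconst (a * b) = (dconst a * dconst b :: ('b,'a) dpoly)" for a b by (simp add: dconst_def mult_single)
  have "dderiv \<delta> (Poly_Mapping.single \<mu> c * Poly_Mapping.single \<nu> e)
    = Poly_Mapping.single (\<mu> + \<nu>) (\<delta> c * e) + Poly_Mapping.single (\<mu> + \<nu>) (c * \<delta> e)
      + dconst (c * e) * dmonom_deriv (\<mu> + \<nu>)"
    by (simp add: mult_single dderiv_single[OF d] derivation_mult[OF d] single_add)
  also have "Poly_Mapping.single (\<mu> + \<nu>) (\<delta> c * e) = Poly_Mapping.single \<mu> (\<delta> c) * Poly_Mapping.single \<nu> e"
    by (simp add: mult_single)
  also have "Poly_Mapping.single (\<mu> + \<nu>) (c * \<delta> e) = Poly_Mapping.single \<mu> c * Poly_Mapping.single \<nu> (\<delta> e)"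
    by (simp add: mult_single)
  finally have e: "dderiv \<delta> (Poly_Mapping.single \<mu> c * Poly_Mapping.single \<nu> e) =
      Poly_Mapping.single \<mu> (\<delta> c) * Poly_Mapping.single \<nu> e
      + Poly_Mapping.single \<mu> c * Poly_Mapping.single \<nu> (\<delta> e)
      + dconst (c * e) * dmonom_deriv (\<mu> + \<nu>)" .
  show ?thesis
    unfolding e dderiv_single[OF d] dmonom_deriv_add c unfolding s[of \<mu> c] s[of \<nu> e] by (simp add: algebra_simps)
qed

lemma dderiv_mult:
  assumes d: "derivation \<delta>" shows "dderiv \<delta> (p * q) = dderiv \<delta> p * q + p * dderiv \<delta> q"
proof -
  let ?P = "\<lambda>k. Poly_Mapping.single k (Poly_Mapping.lookup p k)"
  let ?Q = "\<lambda>k. Poly_Mapping.single k (Poly_Mapping.lookup q k)"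
  have p: "p = sum ?P (Poly_Mapping.keys p)" and q: "q = sum ?Q (Poly_Mapping.keys q)"
    by (rule poly_mapping_sum_singles)+
  have m: "dderiv \<delta> (sum ?P A * sum ?Q B) = dderiv \<delta> (sum ?P A) * sum ?Q B + sum ?P A * dderiv \<delta> (sum ?Q B)" for A B
    by (simp only: sum_product dderiv_sum[OF d] dderiv_mult_single[OF d] sum.distrib)
  from m[of "Poly_Mapping.keys p" "Poly_Mapping.keys q"] show ?thesis
    by (simp only: p[symmetric] q[symmetric])
qed

lemma derivation_dderiv: "derivation \<delta> \<Longrightarrow> derivation (dderiv \<delta>)"
  by (simp add: derivation_def[of "dderiv \<delta>"] dderiv_add dderiv_mult)

lemma deval_dconst: "deval \<delta> a (dconst c) = c"
  by (simp add: dsubst_def dconst_def)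

lemma deval_dvar: "deval \<delta> a (dvar v k) = (\<delta> ^^ k) (a v)"
  by (simp add: dsubst_def dvar_def)

lemma deval_add: "deval \<delta> a (p + q) = deval \<delta> a p + deval \<delta> a q"
  unfolding dsubst_def by (rule setsum_keys_plus_distrib) (simp_all add: algebra_simps)

lemma deval_single: "deval \<delta> a (Poly_Mapping.single \<mu> c) =
    c * (\<Prod>(v, k)\<in>Poly_Mapping.keys \<mu>. ((\<delta> ^^ k) (a v)) ^ Poly_Mapping.lookup \<mu> (v, k))"
  by (cases "c = 0") (simp_all add: dsubst_def)

lemma deval_mult_single:
  "deval \<delta> a (Poly_Mapping.single \<mu> c * Poly_Mapping.single \<nu> e) =
     deval \<delta> a (Poly_Mapping.single \<mu> c) * deval \<delta> a (Poly_Mapping.single \<nu> e)"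
proof -
  let ?k = "Poly_Mapping.keys \<mu> \<union> Poly_Mapping.keys \<nu>"
  let ?f = "\<lambda>\<mu>. \<lambda>(v, k). ((\<delta> ^^ k) (a v)) ^ Poly_Mapping.lookup \<mu> (v, k)"
  have e: "prod (?f \<rho>) (Poly_Mapping.keys \<rho>) = prod (?f \<rho>) ?k" if "Poly_Mapping.keys \<rho> \<subseteq> ?k" for \<rho>
    using that by (intro prod.mono_neutral_left) (auto simp: in_keys_iff)
  have "prod (?f (\<mu> + \<nu>)) ?k = prod (?f \<mu>) ?k * prod (?f \<nu>) ?k"
    by (simp add: lookup_add power_add case_prod_unfold prod.distrib)
  moreover have "Poly_Mapping.keys (\<mu> + \<nu>) \<subseteq> ?k" by (rule keys_add)
  ultimately show ?thesis
    by (simp add: mult_single deval_single e[of \<mu>] e[of \<nu>] e[of "\<mu> + \<nu>"] ac_simps)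
qed

lemma deval_sum: "deval \<delta> a (sum f A) = (\<Sum>x\<in>A. deval \<delta> a (f x))"
proof (induction A rule: infinite_finite_induct)
  case (insert x A)
  then show ?case by (simp add: deval_add)
qed (simp_all add: dsubst_def)

lemma deval_mult: "deval \<delta> a (p * q) = deval \<delta> a p * deval \<delta> a q"
proof -
  let ?P = "\<lambda>k. Poly_Mapping.single k (Poly_Mapping.lookup p k)"
  let ?Q = "\<lambda>k. Poly_Mapping.single k (Poly_Mapping.lookup q k)"
  have p: "p = sum ?P (Poly_Mapping.keys p)" and q: "q = sum ?Q (Poly_Mapping.keys q)"
    by (rule poly_mapping_sum_singles)+
  have m: "deval \<delta> a (sum ?P A * sum ?Q B) = deval \<delta> a (sum ?P A) * deval \<delta> a (sum ?Q B)" for A B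
    by (simp only: sum_product deval_sum deval_mult_single)
  from m[of "Poly_Mapping.keys p" "Poly_Mapping.keys q"] show ?thesis
    by (simp only: p[symmetric] q[symmetric])
qed

lemma deval_dderiv:
  assumes d: "derivation \<delta>" shows "deval \<delta> a (dderiv \<delta> p) = \<delta> (deval \<delta> a p)"
  by (induction p rule: dpoly_induct)
     (simp_all add: d dderiv_dconst dderiv_dvar deval_dconst deval_dvar dderiv_add dderiv_mult
        deval_add deval_mult derivation_add derivation_mult)

lemma deval_diff: "deval \<delta> a (p - q) = deval \<delta> a p - deval \<delta> a q"
  using deval_add[of \<delta> a "p - q" q] by (simp add: algebra_simps)

lemma deval_of_nat: "deval \<delta> a (of_nat k) = of_nat k"
  using deval_dconst[of \<delta> a "of_nat k"] by (simp add: dconst_def)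

lemma derivation_power_Suc:
  "derivation \<delta> \<Longrightarrow> \<delta> (a ^ Suc k) = of_nat (Suc k) * a ^ k * \<delta> a"
  by (induction k) (simp_all add: derivation_mult algebra_simps)

lemma deval_power: "deval \<delta> a (p ^ k) = deval \<delta> a p ^ k"
  by (induction k) (simp_all add: deval_mult deval_dconst[of \<delta> a 1, unfolded dconst_def single_one])

lemma deval_prod: "deval \<delta> a (prod f A) = (\<Prod>x\<in>A. deval \<delta> a (f x))"
proof (induction A rule: infinite_finite_induct)
  case (insert x A)
  then show ?case by (simp add: deval_mult)
qed (simp_all add: deval_dconst[of \<delta> a 1, unfolded dconst_def single_one])

text \<open>\<open>\<delta>\<close>-homogeneity over the ground field \<open>F\<close> with respect to the group of variables \<open>xs\<close>.\<close>

definition delta_homogeneous ::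
  "('a::field \<Rightarrow> 'a) \<Rightarrow> 'a set \<Rightarrow> 'v set \<Rightarrow> ('v, 'a) dpoly \<Rightarrow> bool" where
  "delta_homogeneous \<delta> F xs p \<longleftrightarrow>
     (\<exists>d::nat. \<forall>c\<in>F - {0}.
        dsubst dconst (dderiv \<delta>) (\<lambda>v. if v \<in> xs then dconst c * dvar v 0 else dvar v 0) p
          = dconst (c ^ d) * p)"

text \<open>\<open>diff_ideal \<delta> R S\<close> is the differential ideal of the subring \<open>R\<close> generated by \<open>S\<close>.\<close>

definition is_diff_ideal ::
  "('a::comm_ring_1 \<Rightarrow> 'a) \<Rightarrow> ('v, 'a) dpoly set \<Rightarrow> ('v, 'a) dpoly set \<Rightarrow> bool" where
  "is_diff_ideal \<delta> R I \<longleftrightarrow>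
     I \<subseteq> R \<and> 0 \<in> I \<and> (\<forall>p\<in>I. \<forall>q\<in>I. p + q \<in> I) \<and> (\<forall>r\<in>R. \<forall>p\<in>I. r * p \<in> I) \<and>
     (\<forall>p\<in>I. dderiv \<delta> p \<in> I)"

definition diff_ideal ::
  "('a::comm_ring_1 \<Rightarrow> 'a) \<Rightarrow> ('v, 'a) dpoly set \<Rightarrow> ('v, 'a) dpoly set \<Rightarrow> ('v, 'a) dpoly set" where
  "diff_ideal \<delta> R S = \<Inter>{I. is_diff_ideal \<delta> R I \<and> S \<subseteq> I}"


section \<open>Differentially closed fields and saturation\<close>

text \<open>The \<open>k\<close> such that the \<open>k\<close>-th derivative of the single indeterminate occurs in \<open>p\<close>.\<close>

definition occurring_orders :: "(unit, 'a::comm_ring_1) dpoly \<Rightarrow> nat set" where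
  "occurring_orders p = {k. \<exists>\<mu>\<in>Poly_Mapping.keys p. ((), k) \<in> Poly_Mapping.keys \<mu>}"

text \<open>
  Blum's axioms for differentially closed fields (characteristic zero is part of the type):
  if \<open>g \<noteq> 0\<close> has smaller order than \<open>f\<close>, then \<open>f(a) = 0 \<noteq> g(a)\<close> for some \<open>a\<close> in \<open>K\<close>.  Elements of
  \<open>K\<close> have order \<open>-1\<close>, so that the case of \<open>f\<close> of order \<open>0\<close> says that \<open>K\<close> is algebraically closed.
\<close>

definition model_DCF0 :: "('a::field_char_0 \<Rightarrow> 'a) \<Rightarrow> 'a set \<Rightarrow> bool" where
  "model_DCF0 \<delta> K \<longleftrightarrow>
     delta_subfield \<delta> K \<and>
     (\<forall>f\<in>dpolys K UNIV. \<forall>g\<in>dpolys K UNIV.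
        g \<noteq> 0 \<and> (\<exists>r\<in>occurring_orders f. \<forall>k\<in>occurring_orders g. k < r) \<longrightarrow>
        (\<exists>a\<in>K. deval \<delta> (\<lambda>_. a) f = 0 \<and> deval \<delta> (\<lambda>_. a) g \<noteq> 0))"

text \<open>First-order formulas, with parameters in \<open>'a\<close>, of the language of differential rings.\<close>

datatype 'a dterm =
    TVar nat | TParam 'a | TZero | TOne | TNeg "'a dterm"
  | TAdd "'a dterm" "'a dterm" | TMul "'a dterm" "'a dterm" | TDer "'a dterm"

datatype 'a dform =
    FEq "'a dterm" "'a dterm" | FNot "'a dform" | FAnd "'a dform" "'a dform" | FEx nat "'a dform"

primrec tval :: "('a::comm_ring_1 \<Rightarrow> 'a) \<Rightarrow> (nat \<Rightarrow> 'a) \<Rightarrow> 'a dterm \<Rightarrow> 'a" where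
  "tval \<delta> s (TVar i) = s i"
| "tval \<delta> s (TParam c) = c"
| "tval \<delta> s TZero = 0"
| "tval \<delta> s TOne = 1"
| "tval \<delta> s (TNeg t) = - tval \<delta> s t"
| "tval \<delta> s (TAdd t u) = tval \<delta> s t + tval \<delta> s u"
| "tval \<delta> s (TMul t u) = tval \<delta> s t * tval \<delta> s u"
| "tval \<delta> s (TDer t) = \<delta> (tval \<delta> s t)"

primrec sat :: "('a::comm_ring_1 \<Rightarrow> 'a) \<Rightarrow> (nat \<Rightarrow> 'a) \<Rightarrow> 'a dform \<Rightarrow> bool" where
  "sat \<delta> s (FEq t u) \<longleftrightarrow> tval \<delta> s t = tval \<delta> s u"
| "sat \<delta> s (FNot \<phi>) \<longleftrightarrow> \<not> sat \<delta> s \<phi>"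
| "sat \<delta> s (FAnd \<phi> \<psi>) \<longleftrightarrow> sat \<delta> s \<phi> \<and> sat \<delta> s \<psi>"
| "sat \<delta> s (FEx i \<phi>) \<longleftrightarrow> (\<exists>a. sat \<delta> (s(i := a)) \<phi>)"

primrec tvars :: "'a dterm \<Rightarrow> nat set" where
  "tvars (TVar i) = {i}"
| "tvars (TParam c) = {}"
| "tvars TZero = {}"
| "tvars TOne = {}"
| "tvars (TNeg t) = tvars t"
| "tvars (TAdd t u) = tvars t \<union> tvars u"
| "tvars (TMul t u) = tvars t \<union> tvars u"
| "tvars (TDer t) = tvars t"

primrec fvars :: "'a dform \<Rightarrow> nat set" where
  "fvars (FEq t u) = tvars t \<union> tvars u"
| "fvars (FNot \<phi>) = fvars \<phi>"
| "fvars (FAnd \<phi> \<psi>) = fvars \<phi> \<union> fvars \<psi>"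
| "fvars (FEx i \<phi>) = fvars \<phi> - {i}"

text \<open>
  The differential ring \<open>(UNIV, \<delta>)\<close> is saturated: every finitely satisfiable set of formulas in
  finitely many free variables, over a parameter set of smaller cardinality than the structure, is
  realised.  Here \<open>set_dform \<phi>\<close> is the set of parameters of \<open>\<phi>\<close>.
\<close>

definition saturated :: "('a::comm_ring_1 \<Rightarrow> 'a) \<Rightarrow> bool" where
  "saturated \<delta> \<longleftrightarrow>
     (\<forall>(A :: 'a set) k \<Phi>.
        A \<prec> (UNIV :: 'a set) \<longrightarrow>
        (\<forall>\<phi>\<in>\<Phi>. fvars \<phi> \<subseteq> {..<k} \<and> set_dform \<phi> \<subseteq> A) \<longrightarrow>
        (\<forall>\<Phi>\<^sub>0\<subseteq>\<Phi>. finite \<Phi>\<^sub>0 \<longrightarrow> (\<exists>s. \<forall>\<phi>\<in>\<Phi>\<^sub>0. sat \<delta> s \<phi>)) \<longrightarrow>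
        (\<exists>s. \<forall>\<phi>\<in>\<Phi>. sat \<delta> s \<phi>))"


section \<open>Kolchin-closed sets\<close>

text \<open>
  Points of affine and projective space over the universal field (the whole type \<open>'u\<close>).
  Homogeneous coordinates are indexed by \<open>{0..n}\<close> and affine coordinates by \<open>{1..m}\<close>; coordinate
  functions are zero outside the index set.  A projective point is a class of proportional nonzero
  coordinate vectors.
\<close>

definition aff_space :: "nat \<Rightarrow> (nat \<Rightarrow> 'u::field) set" where
  "aff_space m = {b. \<forall>i. i \<notin> {1..m} \<longrightarrow> b i = 0}"

definition hom_coords :: "nat \<Rightarrow> (nat \<Rightarrow> 'u::field) set" where
  "hom_coords n = {a. (\<forall>i>n. a i = 0) \<and> (\<exists>i\<le>n. a i \<noteq> 0)}"

definition proportional :: "nat \<Rightarrow> ((nat \<Rightarrow> 'u::field) \<times> (nat \<Rightarrow> 'u)) set" where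
  "proportional n =
     {(a, b). a \<in> hom_coords n \<and> b \<in> hom_coords n \<and> (\<exists>c. c \<noteq> 0 \<and> b = (\<lambda>i. c * a i))}"

definition proj_space :: "nat \<Rightarrow> (nat \<Rightarrow> 'u::field) set set" where
  "proj_space n = hom_coords n // proportional n"

text \<open>
  \<open>XV i\<close> is the variable \<open>x\<^sub>i\<close> and \<open>YV i\<close> the variable \<open>y\<^sub>i\<close>, so that \<open>case_coord a b\<close> is the point with
  \<open>x\<close>-coordinates \<open>a\<close> and \<open>y\<close>-coordinates \<open>b\<close>.  The first projective factor has coordinates
  \<open>x\<^sub>0, \<dots>, x\<^sub>n\<close>; a second factor has coordinates \<open>y\<^sub>0, \<dots>, y\<^sub>l\<close> if projective and \<open>y\<^sub>1, \<dots>, y\<^sub>m\<close> if affine.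
\<close>

datatype coord = XV nat | YV nat

definition proj_zeros :: "('u::field \<Rightarrow> 'u) \<Rightarrow> nat \<Rightarrow> (coord, 'u) dpoly set \<Rightarrow> (nat \<Rightarrow> 'u) set set" where
  "proj_zeros \<delta> n S =
     {A \<in> proj_space n. \<forall>a\<in>A. \<forall>p\<in>S. deval \<delta> (case_coord a (\<lambda>_. 0)) p = 0}"

definition proj_proj_zeros ::
  "('u::field \<Rightarrow> 'u) \<Rightarrow> nat \<Rightarrow> nat \<Rightarrow> (coord, 'u) dpoly set \<Rightarrow> ((nat \<Rightarrow> 'u) set \<times> (nat \<Rightarrow> 'u) set) set" where
  "proj_proj_zeros \<delta> n l S =
     {(A, B) \<in> proj_space n \<times> proj_space l.
        \<forall>a\<in>A. \<forall>b\<in>B. \<forall>p\<in>S. deval \<delta> (case_coord a b) p = 0}"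

definition proj_aff_zeros ::
  "('u::field \<Rightarrow> 'u) \<Rightarrow> nat \<Rightarrow> nat \<Rightarrow> (coord, 'u) dpoly set \<Rightarrow> ((nat \<Rightarrow> 'u) set \<times> (nat \<Rightarrow> 'u)) set" where
  "proj_aff_zeros \<delta> n m S =
     {(A, b) \<in> proj_space n \<times> aff_space m. \<forall>a\<in>A. \<forall>p\<in>S. deval \<delta> (case_coord a b) p = 0}"

definition proj_equations :: "('u::field \<Rightarrow> 'u) \<Rightarrow> 'u set \<Rightarrow> nat \<Rightarrow> (coord, 'u) dpoly set" where
  "proj_equations \<delta> F n = {p \<in> dpolys F (XV ` {0..n}). delta_homogeneous \<delta> F (XV ` {0..n}) p}"

definition proj_proj_equations :: "('u::field \<Rightarrow> 'u) \<Rightarrow> 'u set \<Rightarrow> nat \<Rightarrow> nat \<Rightarrow> (coord, 'u) dpoly set" where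
  "proj_proj_equations \<delta> F n l =
     {p \<in> dpolys F (XV ` {0..n} \<union> YV ` {0..l}).
        delta_homogeneous \<delta> F (XV ` {0..n}) p \<and> delta_homogeneous \<delta> F (YV ` {0..l}) p}"

definition proj_closed :: "('u::field \<Rightarrow> 'u) \<Rightarrow> 'u set \<Rightarrow> nat \<Rightarrow> (nat \<Rightarrow> 'u) set set \<Rightarrow> bool" where
  "proj_closed \<delta> F n V \<longleftrightarrow> (\<exists>S\<subseteq>proj_equations \<delta> F n. V = proj_zeros \<delta> n S)"

definition proj_proj_closed ::
  "('u::field \<Rightarrow> 'u) \<Rightarrow> 'u set \<Rightarrow> nat \<Rightarrow> nat \<Rightarrow> ((nat \<Rightarrow> 'u) set \<times> (nat \<Rightarrow> 'u) set) set \<Rightarrow> bool" where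
  "proj_proj_closed \<delta> F n l Z \<longleftrightarrow>
     (\<exists>S\<subseteq>proj_proj_equations \<delta> F n l. Z = proj_proj_zeros \<delta> n l S)"

text \<open>
  Since \<open>V\<close> and \<open>W\<close> are closed, the Kolchin-closed subsets of \<open>V \<times> W\<close> (of \<open>W\<close>) are the
  Kolchin-closed subsets of the ambient space contained in it.
\<close>

definition delta_complete :: "('u::field \<Rightarrow> 'u) \<Rightarrow> 'u set \<Rightarrow> nat \<Rightarrow> (nat \<Rightarrow> 'u) set set \<Rightarrow> bool" where
  "delta_complete \<delta> F n V \<longleftrightarrow>
     proj_closed \<delta> F n V \<and>
     (\<forall>l W Z. proj_closed \<delta> F l W \<and> proj_proj_closed \<delta> F n l Z \<and> Z \<subseteq> V \<times> W \<longrightarrow>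
        proj_closed \<delta> F l (snd ` Z))"


section \<open>The collection of test varieties and the elimination ideal\<close>

text \<open>
  By the quotient rule, the \<open>k\<close>-th derivative of \<open>x\<^sub>j / x\<^sub>i\<close> is \<open>quot_num \<delta> i j k / x\<^sub>i ^ (k + 1)\<close>, in
  lowest terms; see \<open>deval_quot_num\<close>.
\<close>

primrec quot_num :: "('a::comm_ring_1 \<Rightarrow> 'a) \<Rightarrow> nat \<Rightarrow> nat \<Rightarrow> nat \<Rightarrow> (coord, 'a) dpoly" where
  "quot_num \<delta> i j 0 = dvar (XV j) 0"
| "quot_num \<delta> i j (Suc k) =
     dvar (XV i) 0 * dderiv \<delta> (quot_num \<delta> i j k)
       - of_nat (Suc k) * dvar (XV i) 1 * quot_num \<delta> i j k"

text \<open>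
  A \<open>\<delta>\<close>-monomial \<open>t\<close> in one differential variable is given by its exponents \<open>nat \<Rightarrow>\<^sub>0 nat\<close>, indexed by
  the order of the derivative.  Then \<open>t(x\<^sub>j / x\<^sub>i) = monom_num \<delta> i j t / x\<^sub>i ^ monom_den t\<close>.
\<close>

definition monom_num ::
  "('a::comm_ring_1 \<Rightarrow> 'a) \<Rightarrow> nat \<Rightarrow> nat \<Rightarrow> (nat \<Rightarrow>\<^sub>0 nat) \<Rightarrow> (coord, 'a) dpoly" where
  "monom_num \<delta> i j t =
     (\<Prod>k\<in>Poly_Mapping.keys t. quot_num \<delta> i j k ^ Poly_Mapping.lookup t k)"

definition monom_den :: "(nat \<Rightarrow>\<^sub>0 nat) \<Rightarrow> nat" where
  "monom_den t = (\<Sum>k\<in>Poly_Mapping.keys t. Suc k * Poly_Mapping.lookup t k)"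

text \<open>
  The \<open>\<delta>\<close>-polynomial obtained from \<open>(\<Sum>t\<in>T. y\<^bsub>lab t\<^esub> * t(x\<^sub>j / x\<^sub>i)) - 1\<close> by multiplication with the least
  common denominator \<open>x\<^sub>i ^ N\<close>; see \<open>deval_cleared\<close>.
\<close>

definition cleared ::
  "('a::comm_ring_1 \<Rightarrow> 'a) \<Rightarrow> nat \<Rightarrow> nat \<Rightarrow> (nat \<Rightarrow>\<^sub>0 nat) set \<Rightarrow> ((nat \<Rightarrow>\<^sub>0 nat) \<Rightarrow> nat)
     \<Rightarrow> (coord, 'a) dpoly" where
  "cleared \<delta> i j T lab =
     (let N = Max (insert 0 (monom_den ` T)) in
        (\<Sum>t\<in>T. dvar (YV (lab t)) 0 * dvar (XV i) 0 ^ (N - monom_den t) * monom_num \<delta> i j t)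
          - dvar (XV i) 0 ^ N)"

lemma deval_quot_num:
  fixes \<delta> :: "'a::field \<Rightarrow> 'a"
  assumes d: "derivation \<delta>" and nz: "a (XV i) \<noteq> 0"
  shows "(\<delta> ^^ k) (a (XV j) / a (XV i)) = deval \<delta> a (quot_num \<delta> i j k) / a (XV i) ^ Suc k"
proof (induction k)
  case 0
  then show ?case by (simp add: deval_dvar)
next
  case (Suc k)
  let ?x = "a (XV i)" and ?N = "deval \<delta> a (quot_num \<delta> i j k)"
  let ?z = "(\<delta> ^^ k) (a (XV j) / ?x)"
  have "?N = ?z * ?x ^ Suc k" using Suc nz by (simp del: power_Suc)
  then have "\<delta> ?N = \<delta> ?z * ?x ^ Suc k + ?z * (of_nat (Suc k) * ?x ^ k * \<delta> ?x)"
    by (simp only: derivation_mult[OF d] derivation_power_Suc[OF d])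
  then have "?x * \<delta> ?N - of_nat (Suc k) * \<delta> ?x * ?N = \<delta> ?z * ?x ^ Suc (Suc k)"
    using \<open>?N = _\<close> by (simp add: algebra_simps)
  moreover have "deval \<delta> a (quot_num \<delta> i j (Suc k)) = ?x * \<delta> ?N - of_nat (Suc k) * \<delta> ?x * ?N"
    by (simp add: deval_diff deval_mult deval_of_nat deval_dvar deval_dderiv[OF d] deval_add
        flip: of_nat_Suc del: of_nat_Suc)
  ultimately show ?case using nz by (simp del: power_Suc quot_num.simps)
qed

lemma deval_monom_num:
  fixes \<delta> :: "'a::field \<Rightarrow> 'a"
  assumes "derivation \<delta>" and "a (XV i) \<noteq> 0"
  shows "(\<Prod>k\<in>Poly_Mapping.keys t. (\<delta> ^^ k) (a (XV j) / a (XV i)) ^ Poly_Mapping.lookup t k)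
     = deval \<delta> a (monom_num \<delta> i j t) / a (XV i) ^ monom_den t"
  by (simp add: deval_quot_num[where a = a and i = i, OF assms] monom_num_def monom_den_def deval_prod deval_power
      power_divide prod_dividef power_sum power_mult del: power_Suc mult_Suc)

lemma deval_cleared:
  fixes \<delta> :: "'a::field \<Rightarrow> 'a"
  assumes "derivation \<delta>" and nz: "a (XV i) \<noteq> 0" and fin: "finite T"
  shows "deval \<delta> a (cleared \<delta> i j T lab) = a (XV i) ^ Max (insert 0 (monom_den ` T)) *
     ((\<Sum>t\<in>T. a (YV (lab t)) *
         (\<Prod>k\<in>Poly_Mapping.keys t. (\<delta> ^^ k) (a (XV j) / a (XV i)) ^ Poly_Mapping.lookup t k)) - 1)"
proof -
  define N where "N = Max (insert 0 (monom_den ` T))"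
  define x where "x = a (XV i)"
  have "deval \<delta> a (cleared \<delta> i j T lab) =
      (\<Sum>t\<in>T. a (YV (lab t)) * x ^ (N - monom_den t) * deval \<delta> a (monom_num \<delta> i j t)) - x ^ N"
    by (simp add: cleared_def Let_def deval_diff deval_sum deval_mult deval_power deval_dvar x_def
        flip: N_def)
  also have "(\<Sum>t\<in>T. a (YV (lab t)) * x ^ (N - monom_den t) * deval \<delta> a (monom_num \<delta> i j t)) =
      (\<Sum>t\<in>T. x ^ N * (a (YV (lab t)) * (deval \<delta> a (monom_num \<delta> i j t) / x ^ monom_den t)))"
  proof (rule sum.cong[OF refl])
    fix t assume "t \<in> T"
    then have "monom_den t \<le> N" using fin by (auto simp: N_def)
    then show "a (YV (lab t)) * x ^ (N - monom_den t) * deval \<delta> a (monom_num \<delta> i j t) =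
        x ^ N * (a (YV (lab t)) * (deval \<delta> a (monom_num \<delta> i j t) / x ^ monom_den t))"
      using nz by (simp add: power_diff x_def)
  qed
  also have "\<dots> - x ^ N =
      x ^ N * ((\<Sum>t\<in>T. a (YV (lab t)) * (deval \<delta> a (monom_num \<delta> i j t) / x ^ monom_den t)) - 1)"
    by (simp only: sum_distrib_left[symmetric] right_diff_distrib mult_1_right)
  finally show ?thesis
    unfolding deval_monom_num[where a = a and i = i, OF assms(1,2)] x_def N_def .
qed

text \<open>
  Elements are triples \<open>(m, W, D)\<close>: a \<open>\<delta>\<close>-subvariety \<open>W\<close> of \<open>\<P>\<^sup>n \<times> \<A>\<^sup>m\<close> with its set \<open>D\<close> of defining
  polynomials.  \<open>P\<close> is the chosen set of defining \<open>\<delta>\<close>-polynomials of \<open>V\<close>, \<open>T i\<close> the finite set of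
  \<open>\<delta>\<close>-monomials chosen for \<open>i\<close>, and \<open>lab\<close> numbers the new variables \<open>y\<^sub>1, \<dots>, y\<^sub>m\<close>, one for each \<open>i \<in> E\<close>
  and \<open>t \<in> T i\<close>.
\<close>

definition W_collection ::
  "('u::field \<Rightarrow> 'u) \<Rightarrow> nat \<Rightarrow> (coord, 'u) dpoly set
     \<Rightarrow> (nat \<times> ((nat \<Rightarrow> 'u) set \<times> (nat \<Rightarrow> 'u)) set \<times> (coord, 'u) dpoly set) set" where
  "W_collection \<delta> n P =
     {(m, W, D) | m W D. \<exists>E j T lab.
        E \<noteq> {} \<and> E \<subseteq> {0..n} \<and>
        (\<forall>i\<in>E. j i \<le> n \<and> j i \<noteq> i) \<and>
        (\<forall>i\<in>E. finite (T i)) \<and>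
        bij_betw lab (SIGMA i:E. T i) {1..m} \<and>
        D = {dvar (XV i) 0 | i. i \<in> {0..n} - E} \<union>
            {cleared \<delta> i (j i) (T i) (\<lambda>t. lab (i, t)) | i. i \<in> E} \<union> P \<and>
        W = proj_aff_zeros \<delta> n m D}"

text \<open>The projective differential elimination ideal of \<open>I\<close>, eliminating \<open>x\<^sub>0, \<dots>, x\<^sub>n\<close>.\<close>

definition elim_ideal ::
  "'u::field set \<Rightarrow> nat \<Rightarrow> nat \<Rightarrow> (coord, 'u) dpoly set \<Rightarrow> (coord, 'u) dpoly set" where
  "elim_ideal F n m I =
     {g \<in> dpolys F (YV ` {1..m}). \<forall>i\<in>{0..n}. \<exists>e. dvar (XV i) 0 ^ e * g \<in> I}"

definition constant_term :: "('v, 'a::comm_ring_1) dpoly \<Rightarrow> 'a" where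
  "constant_term g = Poly_Mapping.lookup g 0"

end

theory Submission
  imports Defs
begin

text \<open>
  Only the origin needs to be separated.  No member \<open>W\<close> of the collection has a point over
  \<open>y = 0\<close>: there the defining polynomials reduce to \<open>x\<^sub>j\<close> for \<open>j \<notin> E\<close> and \<open>- x\<^sub>i ^ N\<close> for \<open>i \<in> E\<close>.
  If \<open>V\<close> is complete, the projection of \<open>W\<close> to \<open>\<A>\<^sup>m\<close> is closed, so some \<open>g\<close> with \<open>g(0) \<noteq> 0\<close> vanishes on it
  (\<open>complete_separates_origin\<close>).  Every \<open>x\<^sub>i g\<close> vanishes at all common zeros of the defining
  polynomials, and \<open>differential_Nullstellensatz\<close> puts a power of it into the differential ideal
  that they generate; a common power of \<open>g\<close> is in the elimination ideal.

  The converse is a valuative argument.  Let \<open>b\<close> lie in the closure of the projection of a closed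
  set \<open>Z \<subseteq> V \<times> \<P>\<^sup>l\<close>.  There is a point \<open>(a', b')\<close> of \<open>Z\<close> such that \<open>b'\<close> specializes to \<open>b\<close> over \<open>F\<close>
  (\<open>specialization_exists\<close>).  By Zorn's lemma this specialization extends to one on a maximal
  differential ring \<open>R\<close> inside the universal field, with kernel \<open>M\<close>.  For \<open>x \<notin> R\<close> the ideal \<open>M\<close>
  generates the unit ideal of \<open>R{x}\<close> (\<open>not_mem_maximal_relation\<close>), that is, \<open>1\<close> is a combination of
  differential monomials in \<open>x\<close> with coefficients in \<open>M\<close>.  If \<open>a'\<close> had unbounded coordinates in every
  affine chart, these coefficients would give a point of a member of the collection over \<open>a'\<close> whose
  \<open>y\<close>-coordinates specialize to \<open>0\<close>.  An element of its elimination ideal with non-zero constant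
  term excludes this (\<open>bounded_chart_exists\<close>).  So \<open>a'\<close> lies in \<open>R\<close> in some chart, and the
  specialization sends it to a point \<open>a\<close> with \<open>(a, b) \<in> Z\<close> (\<open>specialize_bounded_point\<close>).

  Both directions rest on the existence of generic points in the universal field: if \<open>I\<close> is a prime
  differential ideal in finitely many variables over \<open>F\<close>, a generic point of its part in some of the
  variables extends to a generic point of \<open>I\<close> (\<open>generic_extension\<close>).  Adding one variable \<open>v\<close>, one
  looks for the first derivative of \<open>v\<close> that is algebraic modulo \<open>I\<close> over the preceding ones and for a
  polynomial of least degree for it.  Such a polynomial, together with the part of \<open>I\<close> of smaller
  order, determines \<open>I\<close> (\<open>prime_dideal_determined\<close>), and Blum's axioms together with saturation
  provide the value of \<open>v\<close>.
\<close>

section \<open>Rings of differential polynomials\<close>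

text \<open>
  Polynomials over \<open>K\<close> in an arbitrary set of algebraic indeterminates \<open>(v, k)\<close>.  The rings
  \<open>dpolys K vs\<close> are the case of a set closed under \<open>(v, k) \<mapsto> (v, Suc k)\<close>; the finer rings
  are needed to treat one derivative of one variable at a time.
\<close>

definition apolys :: "'a::comm_ring_1 set \<Rightarrow> ('v \<times> nat) set \<Rightarrow> ('v, 'a) dpoly set" where
  "apolys K X = {p. \<forall>\<mu>\<in>Poly_Mapping.keys p. Poly_Mapping.lookup p \<mu> \<in> K \<and> Poly_Mapping.keys \<mu> \<subseteq> X}"

definition is_subring :: "'a::comm_ring_1 set \<Rightarrow> bool" where
  "is_subring R \<longleftrightarrow> 1 \<in> R \<and> (\<forall>a\<in>R. \<forall>b\<in>R. a - b \<in> R \<and> a * b \<in> R)"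

lemma is_subring_UNIV: "is_subring UNIV"
  by (simp add: is_subring_def)

lemma delta_subfield_is_subring: "delta_subfield \<delta> K \<Longrightarrow> is_subring K"
  by (simp add: delta_subfield_def is_subring_def)

context
  fixes R :: "'a::comm_ring_1 set"
  assumes R: "is_subring R"
begin

lemma subring_1: "1 \<in> R" and subring_diff: "a \<in> R \<Longrightarrow> b \<in> R \<Longrightarrow> a - b \<in> R"
  and subring_mult: "a \<in> R \<Longrightarrow> b \<in> R \<Longrightarrow> a * b \<in> R"
  using R by (auto simp: is_subring_def)

lemma subring_0: "0 \<in> R"
  using subring_diff[OF subring_1 subring_1] by simp

lemma subring_uminus: "a \<in> R \<Longrightarrow> - a \<in> R"
  using subring_diff[OF subring_0] by force

lemma subring_add: "a \<in> R \<Longrightarrow> b \<in> R \<Longrightarrow> a + b \<in> R"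
  using subring_diff[of a "- b"] subring_uminus[of b] by simp

lemma subring_sum: "(\<And>x. x \<in> A \<Longrightarrow> f x \<in> R) \<Longrightarrow> sum f A \<in> R"
  by (induction A rule: infinite_finite_induct) (auto intro: subring_0 subring_add)

lemma subring_prod: "(\<And>x. x \<in> A \<Longrightarrow> f x \<in> R) \<Longrightarrow> prod f A \<in> R"
  by (induction A rule: infinite_finite_induct) (auto intro: subring_1 subring_mult)

lemma subring_power: "a \<in> R \<Longrightarrow> a ^ k \<in> R"
  by (induction k) (auto intro: subring_1 subring_mult)

lemma subring_of_nat: "of_nat k \<in> R"
  by (induction k) (auto intro: subring_0 subring_1 subring_add)

end

lemma dpolys_eq_apolys: "dpolys K vs = apolys K (vs \<times> UNIV)"
  unfolding dpolys_def apolys_def by fastforce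

lemma apolys_mono: "X \<subseteq> Y \<Longrightarrow> apolys K X \<subseteq> apolys K Y"
  unfolding apolys_def by blast

lemma dpolys_mono: "vs \<subseteq> ws \<Longrightarrow> dpolys K vs \<subseteq> dpolys K ws"
  unfolding dpolys_def by blast

lemma apolys_single: "c \<in> K \<Longrightarrow> Poly_Mapping.keys \<mu> \<subseteq> X \<Longrightarrow> Poly_Mapping.single \<mu> c \<in> apolys K X"
  by (auto simp: apolys_def)

lemma apolys_dconst: "c \<in> K \<Longrightarrow> dconst c \<in> apolys K X"
  unfolding dconst_def by (rule apolys_single) simp_all

lemma apolys_dvar: "is_subring K \<Longrightarrow> (v, k) \<in> X \<Longrightarrow> dvar v k \<in> apolys K X"
  unfolding dvar_def by (rule apolys_single) (simp_all add: subring_1)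

lemma apolys_lookup: "is_subring K \<Longrightarrow> p \<in> apolys K X \<Longrightarrow> Poly_Mapping.lookup p \<mu> \<in> K"
  by (cases "\<mu> \<in> Poly_Mapping.keys p") (auto simp: apolys_def in_keys_iff subring_0)

lemma apolys_add:
  assumes K: "is_subring K" and "p \<in> apolys K X" "q \<in> apolys K X"
  shows "p + q \<in> apolys K X"
proof -
  have "Poly_Mapping.keys \<mu> \<subseteq> X" if "\<mu> \<in> Poly_Mapping.keys (p + q)" for \<mu>
    using that keys_add[of p q] assms(2,3) by (auto simp: apolys_def)
  then show ?thesis
    by (auto simp: apolys_def[of K X] lookup_add subring_add[OF K] apolys_lookup[OF K assms(2)]
      apolys_lookup[OF K assms(3)])
qed

lemma apolys_sum:
  assumes K: "is_subring K" and "\<And>x. x \<in> A \<Longrightarrow> f x \<in> apolys K X"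
  shows "sum f A \<in> apolys K X"
  using assms(2) by (induction A rule: infinite_finite_induct)
    (auto intro: apolys_add[OF K], auto simp: apolys_def)

lemma is_subring_apolys:
  assumes K: "is_subring K"
  shows "is_subring (apolys K X)"
proof -
  have m: "p * q \<in> apolys K X" if "p \<in> apolys K X" "q \<in> apolys K X" for p q :: "('b, 'a) dpoly"
  proof -
    let ?P = "\<lambda>k. Poly_Mapping.single k (Poly_Mapping.lookup p k)"
    let ?Q = "\<lambda>k. Poly_Mapping.single k (Poly_Mapping.lookup q k)"
    have "sum ?P (Poly_Mapping.keys p) * sum ?Q (Poly_Mapping.keys q) \<in> apolys K X"
      unfolding sum_product mult_single
    proof (intro apolys_sum[OF K] apolys_single)
      fix \<mu> \<nu> assume h: "\<mu> \<in> Poly_Mapping.keys p" "\<nu> \<in> Poly_Mapping.keys q"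
      show "Poly_Mapping.lookup p \<mu> * Poly_Mapping.lookup q \<nu> \<in> K"
        using apolys_lookup[OF K] that by (blast intro: subring_mult[OF K])
      show "Poly_Mapping.keys (\<mu> + \<nu>) \<subseteq> X"
        using keys_add[of \<mu> \<nu>] h that unfolding apolys_def by blast
    qed
    then show ?thesis by (simp flip: poly_mapping_sum_singles)
  qed
  have 1: "1 \<in> apolys K X"
    using apolys_dconst[OF subring_1[OF K]] by (simp add: dconst_def)
  have "dconst (- 1) * q = - q" for q :: "('b, 'a) dpoly"
    by (simp add: dconst_def single_uminus)
  then have "- q \<in> apolys K X" if "q \<in> apolys K X" for q :: "('b, 'a) dpoly"
    using m[OF apolys_dconst[OF subring_uminus[OF K subring_1[OF K]]] that] by simp
  then show ?thesis
    using apolys_add[OF K] m 1 unfolding is_subring_def by (metis diff_conv_add_uminus)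
qed

lemmas is_subring_dpolys = is_subring_apolys[of _ "_ \<times> UNIV", folded dpolys_eq_apolys]

lemma dpolys_dconst: "c \<in> K \<Longrightarrow> dconst c \<in> dpolys K vs"
  by (simp add: dpolys_eq_apolys apolys_dconst)

lemma dpolys_dvar: "is_subring K \<Longrightarrow> v \<in> vs \<Longrightarrow> dvar v k \<in> dpolys K vs"
  by (simp add: dpolys_eq_apolys apolys_dvar)

lemma apolys_induct [consumes 1, case_names const var add mult]:
  fixes p :: "('v, 'a::comm_ring_1) dpoly"
  assumes p: "p \<in> apolys K X"
    and "\<And>c. c \<in> K \<Longrightarrow> Q (dconst c)" "\<And>v k. (v, k) \<in> X \<Longrightarrow> Q (dvar v k)"
    and "\<And>p q. Q p \<Longrightarrow> Q q \<Longrightarrow> Q (p + q)" "\<And>p q. Q p \<Longrightarrow> Q q \<Longrightarrow> Q (p * q)"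
    and K: "is_subring K"
  shows "Q p"
proof -
  have 0: "Q 0" "Q 1"
    using assms(2)[of 0] assms(2)[of 1] subring_0[OF K] subring_1[OF K] by (simp_all add: dconst_def)
  have pw: "Q q \<Longrightarrow> Q (q ^ e)" for q e by (induction e) (auto simp: 0 assms)
  have pr: "finite A \<Longrightarrow> (\<And>x. x \<in> A \<Longrightarrow> Q (f x)) \<Longrightarrow> Q (prod f A)" for A and f :: "_ \<Rightarrow> ('v, 'a) dpoly"
    by (induction A rule: finite_induct) (auto simp: 0 assms)
  have sm: "finite A \<Longrightarrow> (\<And>x. x \<in> A \<Longrightarrow> Q (f x)) \<Longrightarrow> Q (sum f A)" for A and f :: "_ \<Rightarrow> ('v, 'a) dpoly"
    by (induction A rule: finite_induct) (auto simp: 0 assms)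
  have "Q (Poly_Mapping.single \<mu> (Poly_Mapping.lookup p \<mu>))" if "\<mu> \<in> Poly_Mapping.keys p" for \<mu>
  proof -
    from p that have *: "Poly_Mapping.lookup p \<mu> \<in> K" "Poly_Mapping.keys \<mu> \<subseteq> X"
      by (auto simp: apolys_def)
    show ?thesis
      unfolding dmonom_eq using * by (intro assms(5) assms(2) pr) (auto intro!: pw assms)
  qed
  then show ?thesis
    by (subst poly_mapping_sum_singles) (intro sm finite_keys)
qed

lemma dpolys_induct [consumes 1, case_names const var add mult]:
  assumes "p \<in> dpolys K vs"
    and "\<And>c. c \<in> K \<Longrightarrow> Q (dconst c)" "\<And>v k. v \<in> vs \<Longrightarrow> Q (dvar v k)"
    and "\<And>p q. Q p \<Longrightarrow> Q q \<Longrightarrow> Q (p + q)" "\<And>p q. Q p \<Longrightarrow> Q q \<Longrightarrow> Q (p * q)"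
    and "is_subring K"
  shows "Q p"
  using assms(1) unfolding dpolys_eq_apolys by (induction rule: apolys_induct) (use assms in auto)

definition diff_subring :: "('a::comm_ring_1 \<Rightarrow> 'a) \<Rightarrow> 'a set \<Rightarrow> bool" where
  "diff_subring D R \<longleftrightarrow> is_subring R \<and> (\<forall>a\<in>R. D a \<in> R)"

lemma delta_subfield_diff_subring: "delta_subfield \<delta> K \<Longrightarrow> diff_subring \<delta> K"
  by (simp add: delta_subfield_def diff_subring_def is_subring_def)

lemma diff_subring_funpow: "diff_subring D R \<Longrightarrow> a \<in> R \<Longrightarrow> (D ^^ k) a \<in> R"
  by (induction k) (auto simp: diff_subring_def)

lemma dderiv_apolys:
  assumes d: "derivation \<delta>" and K: "diff_subring \<delta> K"
    and p: "p \<in> apolys K X" and Y: "X \<subseteq> Y" "\<And>v k. (v, k) \<in> X \<Longrightarrow> (v, Suc k) \<in> Y"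
  shows "dderiv \<delta> p \<in> apolys K Y"
proof -
  have sK: "is_subring K" and sY: "is_subring (apolys K Y :: ('b, 'a) dpoly set)"
    using K by (auto simp: diff_subring_def is_subring_apolys)
  from p have "p \<in> apolys K Y \<and> dderiv \<delta> p \<in> apolys K Y"
  proof (induction rule: apolys_induct)
    case (const c)
    then show ?case using K by (auto simp: dderiv_dconst[OF d] apolys_dconst diff_subring_def)
  next
    case (var v k)
    then show ?case using Y sK by (auto simp: dderiv_dvar[OF d] apolys_dvar)
  qed (use sK sY in \<open>auto simp: dderiv_add[OF d] dderiv_mult[OF d] intro: subring_add subring_mult\<close>)
  then show ?thesis ..
qed

lemma diff_subring_dpolys:
  assumes d: "derivation \<delta>" and K: "diff_subring \<delta> K"
  shows "diff_subring (dderiv \<delta>) (dpolys K vs)"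
  using K dderiv_apolys[OF d K, of _ "vs \<times> UNIV" "vs \<times> UNIV"]
  by (auto simp: diff_subring_def is_subring_apolys dpolys_eq_apolys)

section \<open>Substitution\<close>

definition ring_hom :: "('a::comm_ring_1 \<Rightarrow> 'b::comm_ring_1) \<Rightarrow> bool" where
  "ring_hom c \<longleftrightarrow> c 1 = 1 \<and> (\<forall>a b. c (a + b) = c a + c b \<and> c (a * b) = c a * c b)"

lemma ring_hom_dconst: "ring_hom dconst"
  by (simp add: ring_hom_def dconst_def single_add mult_single)

context
  fixes c :: "'a::comm_ring_1 \<Rightarrow> 'b::comm_ring_1" and D :: "'b \<Rightarrow> 'b" and \<sigma> :: "'v \<Rightarrow> 'b"
  assumes c: "ring_hom c"
begin

lemma ring_hom_0: "c 0 = 0"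
  using c unfolding ring_hom_def by (metis add_cancel_right_right)

lemma dsubst_single: "dsubst c D \<sigma> (Poly_Mapping.single \<mu> a) =
    c a * (\<Prod>(v, k)\<in>Poly_Mapping.keys \<mu>. ((D ^^ k) (\<sigma> v)) ^ Poly_Mapping.lookup \<mu> (v, k))"
  by (cases "a = 0") (simp_all add: dsubst_def ring_hom_0)

lemma dsubst_dconst: "dsubst c D \<sigma> (dconst a) = c a"
  by (simp add: dconst_def dsubst_single)

lemma dsubst_dvar: "dsubst c D \<sigma> (dvar v k) = (D ^^ k) (\<sigma> v)"
  using c by (simp add: dvar_def dsubst_single ring_hom_def)

lemma dsubst_add: "dsubst c D \<sigma> (p + q) = dsubst c D \<sigma> p + dsubst c D \<sigma> q"
  unfolding dsubst_def using c
  by (intro setsum_keys_plus_distrib) (simp_all add: ring_hom_0 ring_hom_def algebra_simps)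

lemma dsubst_sum: "dsubst c D \<sigma> (sum f A) = (\<Sum>x\<in>A. dsubst c D \<sigma> (f x))"
  by (induction A rule: infinite_finite_induct) (simp_all add: dsubst_add, simp_all add: dsubst_def)

lemma dsubst_mult_single:
  "dsubst c D \<sigma> (Poly_Mapping.single \<mu> a * Poly_Mapping.single \<nu> e) =
     dsubst c D \<sigma> (Poly_Mapping.single \<mu> a) * dsubst c D \<sigma> (Poly_Mapping.single \<nu> e)"
proof -
  let ?k = "Poly_Mapping.keys \<mu> \<union> Poly_Mapping.keys \<nu>"
  let ?f = "\<lambda>\<mu>. \<lambda>(v, k). ((D ^^ k) (\<sigma> v)) ^ Poly_Mapping.lookup \<mu> (v, k)"
  have e: "prod (?f \<rho>) (Poly_Mapping.keys \<rho>) = prod (?f \<rho>) ?k" if "Poly_Mapping.keys \<rho> \<subseteq> ?k" for \<rho>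
    using that by (intro prod.mono_neutral_left) (auto simp: in_keys_iff)
  have "prod (?f (\<mu> + \<nu>)) ?k = prod (?f \<mu>) ?k * prod (?f \<nu>) ?k"
    by (simp add: lookup_add power_add case_prod_unfold prod.distrib)
  moreover have "Poly_Mapping.keys (\<mu> + \<nu>) \<subseteq> ?k" by (rule keys_add)
  moreover have "c (a * e) = c a * c e" using c by (simp add: ring_hom_def)
  ultimately show ?thesis
    by (simp add: mult_single dsubst_single e[of \<mu>] e[of \<nu>] e[of "\<mu> + \<nu>"] ac_simps)
qed

lemma dsubst_mult: "dsubst c D \<sigma> (p * q) = dsubst c D \<sigma> p * dsubst c D \<sigma> q"
proof -
  let ?P = "\<lambda>k. Poly_Mapping.single k (Poly_Mapping.lookup p k)"
  let ?Q = "\<lambda>k. Poly_Mapping.single k (Poly_Mapping.lookup q k)"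
  have p: "p = sum ?P (Poly_Mapping.keys p)" and q: "q = sum ?Q (Poly_Mapping.keys q)"
    by (rule poly_mapping_sum_singles)+
  have m: "dsubst c D \<sigma> (sum ?P A * sum ?Q B) = dsubst c D \<sigma> (sum ?P A) * dsubst c D \<sigma> (sum ?Q B)" for A B
    by (simp only: sum_product dsubst_sum dsubst_mult_single)
  from m[of "Poly_Mapping.keys p" "Poly_Mapping.keys q"] show ?thesis
    by (simp only: p[symmetric] q[symmetric])
qed

lemma dsubst_power: "dsubst c D \<sigma> (p ^ k) = dsubst c D \<sigma> p ^ k"
  using c dsubst_dconst[of 1] by (induction k) (simp_all add: dsubst_mult dconst_def ring_hom_def)

end

abbreviation dcomp :: "('a \<Rightarrow> 'a) \<Rightarrow> ('v \<Rightarrow> ('w, 'a) dpoly) \<Rightarrow> ('v, 'a::comm_ring_1) dpoly \<Rightarrow> ('w, 'a) dpoly" where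
  "dcomp \<delta> \<equiv> dsubst dconst (dderiv \<delta>)"

lemmas dcomp_simps = dsubst_dconst[OF ring_hom_dconst] dsubst_dvar[OF ring_hom_dconst]
  dsubst_add[OF ring_hom_dconst] dsubst_mult[OF ring_hom_dconst]
  dsubst_power[OF ring_hom_dconst] dsubst_sum[OF ring_hom_dconst]

lemma deval_dderiv_funpow: "derivation \<delta> \<Longrightarrow> deval \<delta> a ((dderiv \<delta> ^^ k) p) = (\<delta> ^^ k) (deval \<delta> a p)"
  by (induction k) (simp_all add: deval_dderiv)

lemma deval_dcomp:
  assumes d: "derivation \<delta>"
  shows "deval \<delta> a (dcomp \<delta> \<sigma> p) = deval \<delta> (\<lambda>v. deval \<delta> a (\<sigma> v)) p"
  by (induction p rule: dpoly_induct)
    (simp_all add: dcomp_simps deval_dconst deval_dvar deval_add deval_mult deval_dderiv_funpow[OF d])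

lemma dcomp_dpolys:
  assumes d: "derivation \<delta>" and K: "diff_subring \<delta> K"
    and p: "p \<in> dpolys K vs" and \<sigma>: "\<And>v. v \<in> vs \<Longrightarrow> \<sigma> v \<in> dpolys K ws"
  shows "dcomp \<delta> \<sigma> p \<in> dpolys K ws"
proof -
  have sK: "is_subring K" using K by (simp add: diff_subring_def)
  show ?thesis
    using p
  proof (induction rule: dpolys_induct)
    case (var v k)
    then show ?case
      using diff_subring_funpow[OF diff_subring_dpolys[OF d K] \<sigma>] by (simp add: dcomp_simps)
  qed (auto simp: dcomp_simps sK dpolys_dconst intro: subring_add[OF is_subring_dpolys] subring_mult[OF is_subring_dpolys])
qed

lemma deval_cong:
  assumes "p \<in> dpolys K vs" and "\<And>v. v \<in> vs \<Longrightarrow> a v = b v"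
  shows "deval \<delta> a p = deval \<delta> b p"
proof -
  have "fst ` Poly_Mapping.keys \<mu> \<subseteq> vs" if "\<mu> \<in> Poly_Mapping.keys p" for \<mu>
    using assms(1) that by (auto simp: dpolys_def)
  then show ?thesis
    unfolding dsubst_def using assms(2)
    by (intro sum.cong prod.cong refl arg_cong2[where f = "(*)"]) fastforce
qed

lemma deval_in:
  assumes K: "diff_subring \<delta> K" and p: "p \<in> dpolys K vs" and a: "\<And>v. v \<in> vs \<Longrightarrow> a v \<in> K"
  shows "deval \<delta> a p \<in> K"
proof -
  have sK: "is_subring K" using K by (simp add: diff_subring_def)
  show ?thesis
    using p
    by (induction rule: dpolys_induct)
      (auto simp: deval_dconst deval_dvar deval_add deval_mult sK a diff_subring_funpow[OF K]
        intro: subring_add[OF sK] subring_mult[OF sK])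
qed

lemma deval_zero_point:
  assumes d: "derivation \<delta>"
  shows "deval \<delta> (\<lambda>_. 0) p = constant_term p"
proof -
  have z: "(\<delta> ^^ k) 0 = 0" for k by (induction k) (auto simp: derivation_0[OF d])
  have e: "(\<Prod>(v, k)\<in>Poly_Mapping.keys \<mu>. ((\<delta> ^^ k) 0) ^ Poly_Mapping.lookup \<mu> (v, k)) = (if \<mu> = 0 then 1 else 0)"
    for \<mu> :: "'b dmonom"
  proof (cases "\<mu> = 0")
    case False
    then obtain v k where "(v, k) \<in> Poly_Mapping.keys \<mu>"
      by (metis all_not_in_conv keys_eq_empty surj_pair)
    then have "(\<Prod>(v, k)\<in>Poly_Mapping.keys \<mu>. ((\<delta> ^^ k) 0) ^ Poly_Mapping.lookup \<mu> (v, k)) = 0"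
      by (intro prod_zero bexI[of _ "(v, k)"]) (simp_all add: z in_keys_iff power_0_left)
    with False show ?thesis by simp
  qed simp
  have "deval \<delta> (\<lambda>_. 0) p = (\<Sum>\<mu>\<in>Poly_Mapping.keys p. if \<mu> = 0 then Poly_Mapping.lookup p \<mu> else 0)"
    unfolding dsubst_def by (intro sum.cong refl) (simp only: e, simp)
  then show ?thesis
    by (simp add: constant_term_def in_keys_iff)
qed

section \<open>Prime differential ideals\<close>

definition dideal :: "('a::comm_ring_1 \<Rightarrow> 'a) \<Rightarrow> 'a set \<Rightarrow> 'a set \<Rightarrow> bool" where
  "dideal D R I \<longleftrightarrow> I \<subseteq> R \<and> 0 \<in> I \<and> (\<forall>p\<in>I. \<forall>q\<in>I. p + q \<in> I) \<and> (\<forall>r\<in>R. \<forall>p\<in>I. r * p \<in> I) \<and>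
     (\<forall>p\<in>I. D p \<in> I)"

definition prime_dideal :: "('a::comm_ring_1 \<Rightarrow> 'a) \<Rightarrow> 'a set \<Rightarrow> 'a set \<Rightarrow> bool" where
  "prime_dideal D R I \<longleftrightarrow>
     dideal D R I \<and> 1 \<notin> I \<and> (\<forall>a\<in>R. \<forall>b\<in>R. a * b \<in> I \<longrightarrow> a \<in> I \<or> b \<in> I)"

definition has_rationals :: "'a::comm_ring_1 set \<Rightarrow> bool" where
  "has_rationals R \<longleftrightarrow> (\<forall>n. \<exists>q\<in>R. of_nat (Suc n) * q = 1)"

lemma is_diff_ideal_eq: "is_diff_ideal \<delta> R I \<longleftrightarrow> dideal (dderiv \<delta>) R I"
  unfolding is_diff_ideal_def dideal_def by blast

lemma dideal_subset: "dideal D R I \<Longrightarrow> a \<in> I \<Longrightarrow> a \<in> R"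
  and dideal_0: "dideal D R I \<Longrightarrow> 0 \<in> I"
  and dideal_add: "dideal D R I \<Longrightarrow> a \<in> I \<Longrightarrow> b \<in> I \<Longrightarrow> a + b \<in> I"
  and dideal_mult: "dideal D R I \<Longrightarrow> r \<in> R \<Longrightarrow> a \<in> I \<Longrightarrow> r * a \<in> I"
  and dideal_mult': "dideal D R I \<Longrightarrow> r \<in> R \<Longrightarrow> a \<in> I \<Longrightarrow> a * r \<in> I"
  and dideal_D: "dideal D R I \<Longrightarrow> a \<in> I \<Longrightarrow> D a \<in> I"
  unfolding dideal_def by (auto simp: mult.commute)

lemma dideal_uminus: "is_subring R \<Longrightarrow> dideal D R I \<Longrightarrow> a \<in> I \<Longrightarrow> - a \<in> I"
  using dideal_mult[of D R I "- 1" a] subring_uminus[of R 1] subring_1[of R] by simp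

lemma dideal_diff: "is_subring R \<Longrightarrow> dideal D R I \<Longrightarrow> a \<in> I \<Longrightarrow> b \<in> I \<Longrightarrow> a - b \<in> I"
  using dideal_add[of D R I a "- b"] dideal_uminus[of R D I b] by simp

lemma dideal_sum: "dideal D R I \<Longrightarrow> (\<And>x. x \<in> A \<Longrightarrow> f x \<in> I) \<Longrightarrow> sum f A \<in> I"
  by (induction A rule: infinite_finite_induct) (auto intro: dideal_0 dideal_add)

lemma prime_dideal_dideal: "prime_dideal D R I \<Longrightarrow> dideal D R I"
  and prime_dideal_mult: "prime_dideal D R I \<Longrightarrow> a \<in> R \<Longrightarrow> b \<in> R \<Longrightarrow> a * b \<in> I \<Longrightarrow> a \<in> I \<or> b \<in> I"
  and prime_dideal_1: "prime_dideal D R I \<Longrightarrow> 1 \<notin> I"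
  unfolding prime_dideal_def by auto

lemma prime_dideal_power:
  "is_subring R \<Longrightarrow> prime_dideal D R I \<Longrightarrow> a \<in> R \<Longrightarrow> a ^ k \<in> I \<Longrightarrow> a \<in> I"
proof (induction k)
  case (Suc k)
  then show ?case using prime_dideal_mult[of D R I a "a ^ k"] subring_power[of R a k] by auto
qed (simp add: prime_dideal_1)

lemma prime_dideal_prod:
  assumes "is_subring R" "prime_dideal D R I" "finite A" "\<And>x. x \<in> A \<Longrightarrow> f x \<in> R" "prod f A \<in> I"
  shows "\<exists>x\<in>A. f x \<in> I"
  using assms(3-)
proof (induction A rule: finite_induct)
  case empty
  then show ?case using prime_dideal_1[OF assms(2)] by simp
next
  case (insert x A)
  then show ?case
    using prime_dideal_mult[OF assms(2), of "f x" "prod f A"] subring_prod[OF assms(1), of A f] by auto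
qed

definition radical :: "'a::comm_ring_1 set \<Rightarrow> 'a set \<Rightarrow> 'a set" where
  "radical R I = {a \<in> R. \<exists>n. a ^ n \<in> I}"

text \<open>
  Ritt's argument that the radical of a differential ideal is differential: differentiating
  \<open>a ^ Suc m * D a ^ (2 * k)\<close> and multiplying by \<open>D a\<close> trades one factor \<open>a\<close> for two factors \<open>D a\<close>,
  up to the integer factor \<open>Suc m\<close>, which is invertible, and up to a multiple of the element one
  started from.  With \<open>m = 0\<close> all factors \<open>a\<close> are gone.
\<close>

lemma radical_derivation_step:
  assumes D: "derivation D" and R: "diff_subring D R" "has_rationals R"
    and I: "dideal D R I" and a: "a \<in> R" and h: "a ^ (m + k) \<in> I"
  shows "a ^ m * D a ^ (2 * k) \<in> I"
  using h
proof (induction k arbitrary: m)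
  case (Suc k)
  have sR: "is_subring R" using R by (simp add: diff_subring_def)
  have Da: "D a \<in> R" "D (D a) \<in> R" using R a by (auto simp: diff_subring_def)
  have P: "a ^ Suc m * D a ^ (2 * k) \<in> I" using Suc.IH[of "Suc m"] Suc.prems by simp
  from R(2) obtain q where q: "q \<in> R" "of_nat (Suc m) * q = 1" by (auto simp: has_rationals_def)
  have E: "D (a ^ Suc m * D a ^ (2 * k)) * D a = of_nat (Suc m) * (a ^ m * D a ^ (2 * Suc k))
      + (of_nat (2 * k) * D (D a)) * (a ^ Suc m * D a ^ (2 * k))"
  proof (cases k)
    case 0
    then show ?thesis by (simp del: power_Suc of_nat_Suc add: derivation_power_Suc[OF D] power2_eq_square)
  next
    case (Suc j)
    then have k: "2 * k = Suc (2 * j + 1)" by simp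
    show ?thesis
      unfolding k derivation_mult[OF D] derivation_power_Suc[OF D]
      by (simp add: Suc algebra_simps power2_eq_square)
  qed
  have "D (a ^ Suc m * D a ^ (2 * k)) * D a \<in> I"
    by (intro dideal_mult'[OF I] dideal_D[OF I] P Da)
  moreover have "(of_nat (2 * k) * D (D a)) * (a ^ Suc m * D a ^ (2 * k)) \<in> I"
    by (intro dideal_mult[OF I] P subring_mult[OF sR] subring_of_nat[OF sR] Da)
  ultimately have "of_nat (Suc m) * (a ^ m * D a ^ (2 * Suc k)) \<in> I"
    using dideal_diff[OF sR I] unfolding E by (metis add_diff_cancel_right')
  then have "q * (of_nat (Suc m) * (a ^ m * D a ^ (2 * Suc k))) \<in> I"
    by (rule dideal_mult[OF I q(1)])
  moreover have "q * (of_nat (Suc m) * (a ^ m * D a ^ (2 * Suc k))) =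
      (of_nat (Suc m) * q) * (a ^ m * D a ^ (2 * Suc k))" by (simp only: ac_simps)
  ultimately show ?case using q(2) by (simp only: mult_1_left)
qed simp

lemma dideal_power_mono: 
  assumes "is_subring R" "dideal D R I" "a \<in> R" "a ^ m \<in> I" "m \<le> n"
  shows "a ^ n \<in> I"
  using dideal_mult[OF assms(2) subring_power[OF assms(1,3), of "n - m"] assms(4)] assms(5)
  by (simp flip: power_add)

lemma dideal_radical:
  assumes D: "derivation D" and R: "diff_subring D R" "has_rationals R" and I: "dideal D R I"
  shows "dideal D R (radical R I)"
proof -
  have sR: "is_subring R" using R by (simp add: diff_subring_def)
  have "a + b \<in> radical R I" if "a \<in> radical R I" "b \<in> radical R I" for a b
  proof -
    from that obtain m n where ab: "a \<in> R" "a ^ m \<in> I" "b \<in> R" "b ^ n \<in> I" by (auto simp: radical_def)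
    have "(a + b) ^ (m + n) \<in> I"
      unfolding binomial_ring
    proof (rule dideal_sum[OF I])
      fix k assume k: "k \<in> {..m + n}"
      show "of_nat (m + n choose k) * a ^ k * b ^ (m + n - k) \<in> I"
      proof (cases "m \<le> k")
        case True
        then have "a ^ k \<in> I" using dideal_power_mono[OF sR I] ab by blast
        then show ?thesis using ab sR
          by (intro dideal_mult'[OF I] dideal_mult[OF I] subring_power[OF sR] subring_of_nat[OF sR])
      next
        case False
        then have "b ^ (m + n - k) \<in> I" using dideal_power_mono[OF sR I ab(3,4)] by simp
        then show ?thesis using ab sR
          by (intro dideal_mult[OF I] subring_mult[OF sR] subring_power[OF sR] subring_of_nat[OF sR])
      qed
    qed
    then show ?thesis using ab subring_add[OF sR] by (auto simp: radical_def)
  qed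
  moreover have "r * a \<in> radical R I" if "a \<in> radical R I" "r \<in> R" for r a
    using that subring_mult[OF sR] subring_power[OF sR] dideal_mult[OF I]
    by (fastforce simp: radical_def power_mult_distrib)
  moreover have "D a \<in> radical R I" if "a \<in> radical R I" for a
  proof -
    from that obtain n where "a \<in> R" "a ^ n \<in> I" by (auto simp: radical_def)
    then have "D a ^ (2 * n) \<in> I" "D a \<in> R"
      using radical_derivation_step[OF D R I, of a 0 n] R by (auto simp: diff_subring_def)
    then show ?thesis by (auto simp: radical_def)
  qed
  moreover have "0 \<in> radical R I"
    using subring_0[OF sR] dideal_0[OF I] by (auto simp: radical_def intro!: exI[of _ 1])
  ultimately show ?thesis by (auto simp: dideal_def radical_def)
qed

lemma dideal_Union_chain:
  assumes "C \<noteq> {}" "\<And>I. I \<in> C \<Longrightarrow> dideal D R I" "\<And>I J. I \<in> C \<Longrightarrow> J \<in> C \<Longrightarrow> I \<subseteq> J \<or> J \<subseteq> I"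
  shows "dideal D R (\<Union>C)"
proof -
  have "p + q \<in> \<Union>C" if "p \<in> \<Union>C" "q \<in> \<Union>C" for p q
  proof -
    from that assms(3) obtain K where "K \<in> C" "p \<in> K" "q \<in> K" by blast
    then show ?thesis using dideal_add[OF assms(2)] by blast
  qed
  moreover have "\<Union>C \<subseteq> R" using dideal_subset[OF assms(2)] by blast
  moreover have "0 \<in> \<Union>C" using assms(1) dideal_0[OF assms(2)] by blast
  moreover have "\<forall>r\<in>R. \<forall>p\<in>\<Union>C. r * p \<in> \<Union>C" using dideal_mult[OF assms(2)] by blast
  moreover have "\<forall>p\<in>\<Union>C. D p \<in> \<Union>C" using dideal_D[OF assms(2)] by blast
  ultimately show ?thesis unfolding dideal_def by blast
qed

text \<open>
  A differential ideal that is maximal among those disjoint from the multiplicative set \<open>M\<close> is prime.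
  By maximality it is radical, since its radical is again a differential ideal disjoint from \<open>M\<close>.  For
  a radical differential ideal \<open>P\<close> the quotients \<open>{x. a * x \<in> P}\<close> are differential ideals as well:
  from \<open>a * x \<in> P\<close> one gets \<open>(a * D x)\<^sup>2 \<in> P\<close>.  If \<open>a * b \<in> P\<close> with
  \<open>a, b \<notin> P\<close>, the quotient by \<open>a\<close> is strictly larger than \<open>P\<close>, hence contains some \<open>s \<in> M\<close>;
  then the quotient by \<open>s\<close> contains \<open>a\<close>, hence contains some \<open>t \<in> M\<close>, and \<open>s * t \<in> P\<close>
  contradicts the disjointness.
\<close>

theorem prime_dideal_exists:
  assumes D: "derivation D" and R: "diff_subring D R" "has_rationals R" and J: "dideal D R J"
    and M: "M \<subseteq> R" "1 \<in> M" "\<And>a b. a \<in> M \<Longrightarrow> b \<in> M \<Longrightarrow> a * b \<in> M" and JM: "J \<inter> M = {}"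
  obtains P where "prime_dideal D R P" "J \<subseteq> P" "P \<inter> M = {}"
proof -
  have sR: "is_subring R" using R by (simp add: diff_subring_def)
  let ?\<A> = "{I. dideal D R I \<and> J \<subseteq> I \<and> I \<inter> M = {}}"
  have "\<exists>P\<in>?\<A>. \<forall>X\<in>?\<A>. P \<subseteq> X \<longrightarrow> X = P"
  proof (rule subset_Zorn_nonempty)
    show "?\<A> \<noteq> {}" using J JM by blast
  next
    fix C assume C: "C \<noteq> {}" "subset.chain ?\<A> C"
    then have "dideal D R (\<Union>C)"
      by (intro dideal_Union_chain) (auto simp: subset_chain_def)
    moreover have "J \<subseteq> \<Union>C" "\<Union>C \<inter> M = {}" using C unfolding subset_chain_def by blast+
    ultimately show "\<Union>C \<in> ?\<A>" by simp
  qed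
  then obtain P where P0: "P \<in> ?\<A>" and max0: "\<forall>X\<in>?\<A>. P \<subseteq> X \<longrightarrow> X = P" ..
  then have P: "dideal D R P" "J \<subseteq> P" "P \<inter> M = {}" by simp_all
  have max: "X = P" if "dideal D R X" "P \<subseteq> X" "X \<inter> M = {}" for X
    using max0 that P(2) by simp
  have powM: "a ^ n \<in> M" if "a \<in> M" for a n
    using that by (induction n) (simp_all add: M(2,3))
  have rad: "a \<in> P" if "a \<in> R" "a ^ n \<in> P" for a n
  proof -
    have "P \<subseteq> radical R P" using dideal_subset[OF P(1)] by (auto simp: radical_def intro!: exI[of _ 1])
    moreover have "radical R P \<inter> M = {}" using powM P(3) by (auto simp: radical_def)
    ultimately have "radical R P = P" using max dideal_radical[OF D R P(1)] by blast
    then show ?thesis using that by (auto simp: radical_def)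
  qed
  have colon: "dideal D R {x \<in> R. a * x \<in> P}" if a: "a \<in> R" for a
  proof -
    have "a * D x \<in> P" if x: "x \<in> R" "a * x \<in> P" for x
    proof -
      have Dx: "D x \<in> R" "D a \<in> R" using R x a by (auto simp: diff_subring_def)
      have "D (a * x) * (a * D x) \<in> P"
        using dideal_mult'[OF P(1) _ dideal_D[OF P(1) x(2)]] subring_mult[OF sR a Dx(1)] by blast
      moreover have "(D a * D x) * (a * x) \<in> P"
        using dideal_mult[OF P(1) _ x(2)] subring_mult[OF sR Dx(2) Dx(1)] by blast
      ultimately have "D (a * x) * (a * D x) - (D a * D x) * (a * x) \<in> P"
        by (rule dideal_diff[OF sR P(1)])
      then have "(a * D x) ^ 2 \<in> P"
        by (simp add: derivation_mult[OF D] algebra_simps power2_eq_square)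
      then show ?thesis using rad subring_mult[OF sR a Dx(1)] by blast
    qed
    moreover have "a * (r * x) \<in> P" if "r \<in> R" "a * x \<in> P" for r x
      using dideal_mult[OF P(1) that] by (simp add: ac_simps)
    ultimately show ?thesis
      using R subring_0[OF sR] subring_add[OF sR] subring_mult[OF sR] dideal_0[OF P(1)] dideal_add[OF P(1)]
      by (auto simp: dideal_def diff_subring_def distrib_left)
  qed
  have sub: "P \<subseteq> {x \<in> R. a * x \<in> P}" if "a \<in> R" for a
    using dideal_mult[OF P(1) that] dideal_subset[OF P(1)] by blast
  have "a \<in> P \<or> b \<in> P" if ab: "a \<in> R" "b \<in> R" "a * b \<in> P" for a b
  proof (rule ccontr)
    assume n: "\<not> (a \<in> P \<or> b \<in> P)"
    then have "{x \<in> R. a * x \<in> P} \<inter> M \<noteq> {}"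
      using max[OF colon[OF ab(1)] sub[OF ab(1)]] ab by auto
    then obtain s where s: "s \<in> M" "s \<in> R" "s * a \<in> P" by (auto simp: mult.commute)
    then have "{x \<in> R. s * x \<in> P} \<inter> M \<noteq> {}"
      using max[OF colon[OF s(2)] sub[OF s(2)]] ab n by auto
    then show False using s M(3) P(3) by auto
  qed
  moreover have "1 \<notin> P" using P(3) M(2) by auto
  ultimately have "prime_dideal D R P" using P(1) by (auto simp: prime_dideal_def)
  then show thesis using that P by blast
qed

lemma dideal_diff_ideal:
  assumes d: "derivation \<delta>" and R: "diff_subring (dderiv \<delta>) R" and S: "S \<subseteq> R"
  shows "dideal (dderiv \<delta>) R (diff_ideal \<delta> R S)" "S \<subseteq> diff_ideal \<delta> R S"
proof -
  have "dideal (dderiv \<delta>) R R"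
    using R subring_0[of R] subring_add[of R] subring_mult[of R] by (auto simp: dideal_def diff_subring_def)
  then show "dideal (dderiv \<delta>) R (diff_ideal \<delta> R S)"
    using S unfolding diff_ideal_def is_diff_ideal_eq
    by (auto simp: dideal_def[of _ R "\<Inter>_"] intro: dideal_0 dideal_add dideal_mult dideal_D)
  show "S \<subseteq> diff_ideal \<delta> R S" by (auto simp: diff_ideal_def)
qed

lemma diff_ideal_minimal: "dideal (dderiv \<delta>) R I \<Longrightarrow> S \<subseteq> I \<Longrightarrow> diff_ideal \<delta> R S \<subseteq> I"
  by (auto simp: diff_ideal_def is_diff_ideal_eq)

section \<open>Algebraic relations modulo a prime ideal\<close>

text \<open>
  \<open>pol_lt A w e\<close> consists of the values at \<open>w\<close> of the polynomials of degree less than \<open>e\<close> over \<open>A\<close>.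
  Since \<open>w\<close> may be algebraic over \<open>A\<close>, a degree is attached to a representation and not to an
  element.
\<close>

definition pol_lt :: "'a::comm_ring_1 set \<Rightarrow> 'a \<Rightarrow> nat \<Rightarrow> 'a set" where
  "pol_lt A w e = {p. \<exists>b. (\<forall>i. b i \<in> A) \<and> p = (\<Sum>i<e. b i * w ^ i)}"

definition pol :: "'a::comm_ring_1 set \<Rightarrow> 'a \<Rightarrow> 'a set" where
  "pol A w = (\<Union>e. pol_lt A w e)"

context
  fixes A :: "'a::comm_ring_1 set" and w :: 'a
  assumes A: "is_subring A"
begin

lemma pol_lt_0: "pol_lt A w 0 = {0}"
  using subring_0[OF A] by (auto simp: pol_lt_def intro: exI[of _ "\<lambda>_. 0"])

lemma pol_lt_Suc: "p \<in> pol_lt A w (Suc e) \<longleftrightarrow> (\<exists>c\<in>A. p - c * w ^ e \<in> pol_lt A w e)"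
proof
  assume "p \<in> pol_lt A w (Suc e)"
  then obtain b where b: "\<forall>i. b i \<in> A" "p = (\<Sum>i<Suc e. b i * w ^ i)" by (auto simp: pol_lt_def)
  then have "p - b e * w ^ e \<in> pol_lt A w e" by (auto simp: pol_lt_def)
  then show "\<exists>c\<in>A. p - c * w ^ e \<in> pol_lt A w e" using b by blast
next
  assume "\<exists>c\<in>A. p - c * w ^ e \<in> pol_lt A w e"
  then obtain c b where "c \<in> A" "\<forall>i. b i \<in> A" "p - c * w ^ e = (\<Sum>i<e. b i * w ^ i)"
    by (auto simp: pol_lt_def)
  then show "p \<in> pol_lt A w (Suc e)"
    unfolding pol_lt_def by (auto simp: algebra_simps intro!: exI[of _ "b(e := c)"])
qed

lemma pol_lt_zero: "0 \<in> pol_lt A w e"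
  using subring_0[OF A] by (auto simp: pol_lt_def intro!: exI[of _ "\<lambda>_. 0"])

lemma pol_lt_add: "p \<in> pol_lt A w e \<Longrightarrow> q \<in> pol_lt A w e \<Longrightarrow> p + q \<in> pol_lt A w e"
  unfolding pol_lt_def
proof clarify
  fix b c :: "nat \<Rightarrow> 'a" assume "\<forall>i. b i \<in> A" "\<forall>i. c i \<in> A"
  then show "\<exists>ba. (\<forall>i. ba i \<in> A) \<and> (\<Sum>i<e. b i * w ^ i) + (\<Sum>i<e. c i * w ^ i) = (\<Sum>i<e. ba i * w ^ i)"
    by (intro exI[of _ "\<lambda>i. b i + c i"]) (auto simp: subring_add[OF A] sum.distrib distrib_right)
qed

lemma pol_lt_smult: "a \<in> A \<Longrightarrow> p \<in> pol_lt A w e \<Longrightarrow> a * p \<in> pol_lt A w e"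
  unfolding pol_lt_def
proof clarify
  fix b :: "nat \<Rightarrow> 'a" assume "a \<in> A" "\<forall>i. b i \<in> A"
  then show "\<exists>ba. (\<forall>i. ba i \<in> A) \<and> a * (\<Sum>i<e. b i * w ^ i) = (\<Sum>i<e. ba i * w ^ i)"
    by (intro exI[of _ "\<lambda>i. a * b i"]) (auto simp: subring_mult[OF A] sum_distrib_left mult.assoc)
qed

lemma pol_lt_diff: "p \<in> pol_lt A w e \<Longrightarrow> q \<in> pol_lt A w e \<Longrightarrow> p - q \<in> pol_lt A w e"
  using pol_lt_add[of p e "- 1 * q"] pol_lt_smult[of "- 1" q e] subring_uminus[OF A subring_1[OF A]] by simp

lemma pol_lt_mono: "e \<le> e' \<Longrightarrow> pol_lt A w e \<subseteq> pol_lt A w e'"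
proof (induction e' rule: dec_induct)
  case (step n)
  have "pol_lt A w n \<subseteq> pol_lt A w (Suc n)"
    using subring_0[OF A] by (auto simp: pol_lt_Suc intro!: bexI[of _ 0])
  with step show ?case by blast
qed simp

lemma pol_lt_shift: "p \<in> pol_lt A w e \<Longrightarrow> w ^ k * p \<in> pol_lt A w (e + k)"
proof (induction e arbitrary: p)
  case 0
  then show ?case using pol_lt_zero[of k] by (simp add: pol_lt_0)
next
  case (Suc e)
  then obtain c where c: "c \<in> A" "p - c * w ^ e \<in> pol_lt A w e" by (auto simp: pol_lt_Suc)
  have "w ^ k * (p - c * w ^ e) = w ^ k * p - c * w ^ (e + k)" by (simp add: algebra_simps power_add)
  then show ?case using Suc.IH[OF c(2)] c(1) by (auto simp: pol_lt_Suc)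
qed

lemma pol_lt_1: "pol_lt A w (Suc 0) = A"
  by (auto simp: pol_lt_Suc pol_lt_0)

lemma pol_lt_monom: "c \<in> A \<Longrightarrow> c * w ^ e \<in> pol_lt A w (Suc e)"
  by (auto simp: pol_lt_Suc pol_lt_zero intro!: bexI[of _ c])

lemma pol_lt_pol: "p \<in> pol_lt A w e \<Longrightarrow> p \<in> pol A w"
  by (auto simp: pol_def)

lemma pol_base: "A \<subseteq> pol A w"
  using pol_lt_1 by (auto simp: pol_def)

lemma pol_gen: "w \<in> pol A w"
  using pol_lt_pol[OF pol_lt_monom[OF subring_1[OF A], of 1]] by simp

lemma pol_diff: "p \<in> pol A w \<Longrightarrow> q \<in> pol A w \<Longrightarrow> p - q \<in> pol A w"
proof -
  assume "p \<in> pol A w" "q \<in> pol A w"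
  then obtain e e' where "p \<in> pol_lt A w e" "q \<in> pol_lt A w e'" by (auto simp: pol_def)
  then have "p \<in> pol_lt A w (e + e')" "q \<in> pol_lt A w (e + e')"
    using pol_lt_mono[of e "e + e'"] pol_lt_mono[of e' "e + e'"] by auto
  then show ?thesis by (blast intro: pol_lt_pol pol_lt_diff)
qed

lemma pol_mult_lt: "p \<in> pol_lt A w e \<Longrightarrow> q \<in> pol_lt A w e' \<Longrightarrow> p * q \<in> pol_lt A w (e + e')"
proof (induction e arbitrary: p)
  case 0
  then show ?case by (simp add: pol_lt_0 pol_lt_zero)
next
  case (Suc e)
  then obtain c where c: "c \<in> A" "p - c * w ^ e \<in> pol_lt A w e" by (auto simp: pol_lt_Suc)
  have "p * q = (p - c * w ^ e) * q + c * (w ^ e * q)" by (simp add: algebra_simps)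
  moreover have "(p - c * w ^ e) * q \<in> pol_lt A w (Suc e + e')"
    using Suc.IH[OF c(2) Suc.prems(2)] pol_lt_mono[of "e + e'" "Suc e + e'"] by auto
  moreover have "c * (w ^ e * q) \<in> pol_lt A w (Suc e + e')"
    using pol_lt_smult[OF c(1) pol_lt_shift[OF Suc.prems(2), of e]] pol_lt_mono[of "e' + e" "Suc e + e'"]
    by (auto simp: add.commute)
  ultimately show ?case by (simp only: pol_lt_add)
qed

lemma is_subring_pol: "is_subring (pol A w)"
proof -
  have "p * q \<in> pol A w" if "p \<in> pol A w" "q \<in> pol A w" for p q
    using that pol_mult_lt unfolding pol_def by blast
  then show ?thesis
    using pol_base subring_1[OF A] pol_diff by (auto simp: is_subring_def)
qed

lemma pol_subset:
  assumes "is_subring R" "A \<subseteq> R" "w \<in> R"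
  shows "pol A w \<subseteq> R"
proof -
  have "b i * w ^ i \<in> R" if "\<forall>i. b i \<in> A" for b :: "nat \<Rightarrow> 'a" and i
    using that assms by (auto intro: subring_mult subring_power)
  then show ?thesis
    by (auto simp: pol_def pol_lt_def intro!: subring_sum[OF assms(1)])
qed

text \<open>
  Pseudo-division by \<open>f = J * w ^ d + \<dots>\<close>.  The leading coefficient of the quotient is recorded:
  in the absence of unique representations this is what shows later that the quotient is not
  in a given prime ideal.
\<close>

lemma pseudo_division_lead:
  assumes J: "J \<in> A" and f: "f - J * w ^ d \<in> pol_lt A w d"
    and "b \<in> A" "g - b * w ^ e \<in> pol_lt A w e" "d \<le> e"
  shows "\<exists>k q r. J ^ Suc k * g = q * f + r \<and> q - J ^ k * b * w ^ (e - d) \<in> pol_lt A w (e - d)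
    \<and> r \<in> pol_lt A w d"
  using assms(3-)
proof (induction e arbitrary: g b rule: less_induct)
  case (less e)
  define h where "h = J * (g - b * w ^ e) - b * (w ^ (e - d) * (f - J * w ^ d))"
  have "w ^ (e - d) * (f - J * w ^ d) \<in> pol_lt A w e"
    using pol_lt_shift[OF f, of "e - d"] less.prems(3) by simp
  then have h: "h \<in> pol_lt A w e"
    unfolding h_def using pol_lt_diff[OF pol_lt_smult[OF J less.prems(2)] pol_lt_smult[OF less.prems(1)]] by blast
  have "w ^ e = w ^ (e - d) * w ^ d" using less.prems(3) by (simp flip: power_add)
  then have g: "J * g = b * w ^ (e - d) * f + h" by (simp add: h_def algebra_simps)
  show ?case
  proof (cases "e = d")
    case True
    then show ?thesis using g h by (intro exI[of _ 0] exI[of _ b] exI[of _ h]) (simp add: pol_lt_0)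
  next
    case False
    then obtain e' where e': "e = Suc e'" "d \<le> e'" using less.prems(3) by (cases e) auto
    with h obtain b' where b': "b' \<in> A" "h - b' * w ^ e' \<in> pol_lt A w e'" by (auto simp: pol_lt_Suc)
    obtain k q r where *: "J ^ Suc k * h = q * f + r"
      "q - J ^ k * b' * w ^ (e' - d) \<in> pol_lt A w (e' - d)" "r \<in> pol_lt A w d"
      using less.IH[OF _ b' e'(2)] e'(1) by blast
    have "q \<in> pol_lt A w (Suc (e' - d))"
      using *(2) subring_mult[OF A subring_power[OF A J] b'(1)] by (auto simp: pol_lt_Suc)
    then have q: "q \<in> pol_lt A w (e - d)" using e' by (simp add: Suc_diff_le)
    have "J ^ Suc (Suc k) * g = J ^ Suc k * (J * g)" by (simp add: ac_simps)
    also have "\<dots> = (J ^ Suc k * b * w ^ (e - d) + q) * f + r"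
      using *(1) by (simp add: g algebra_simps)
    finally show ?thesis using q *(3)
      by (intro exI[of _ "Suc k"] exI[of _ "J ^ Suc k * b * w ^ (e - d) + q"] exI[of _ r]) simp
  qed
qed

lemma pseudo_division:
  assumes J: "J \<in> A" and f: "f - J * w ^ d \<in> pol_lt A w d" and g: "g \<in> pol A w"
  shows "\<exists>k q r. J ^ k * g = q * f + r \<and> q \<in> pol A w \<and> r \<in> pol_lt A w d"
proof -
  from g obtain e where e: "g \<in> pol_lt A w e" by (auto simp: pol_def)
  show ?thesis
  proof (cases "e \<le> d")
    case True
    then have "g \<in> pol_lt A w d" using e pol_lt_mono by blast
    then show ?thesis
      by (intro exI[of _ 0] exI[of _ 0] exI[of _ g]) (auto simp: pol_lt_pol[OF pol_lt_zero])
  next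
    case False
    then obtain e' where e': "e = Suc e'" "d \<le> e'" by (cases e) auto
    with e obtain b where b: "b \<in> A" "g - b * w ^ e' \<in> pol_lt A w e'" by (auto simp: pol_lt_Suc)
    obtain k q r where *: "J ^ Suc k * g = q * f + r"
      "q - J ^ k * b * w ^ (e' - d) \<in> pol_lt A w (e' - d)" "r \<in> pol_lt A w d"
      using pseudo_division_lead[OF J f b e'(2)] by blast
    have "q \<in> pol_lt A w (Suc (e' - d))"
      using *(2) subring_mult[OF A subring_power[OF A J] b(1)] by (auto simp: pol_lt_Suc)
    then show ?thesis using *(1,3) pol_lt_pol by blast
  qed
qed

end

text \<open>
  \<open>f\<close> witnesses that \<open>w\<close> is algebraic of degree at most \<open>d\<close> over \<open>A\<close> modulo \<open>I\<close>: it is an element of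
  \<open>I\<close>, of degree \<open>d\<close> in \<open>w\<close>, whose leading coefficient \<open>J\<close> does not vanish modulo \<open>I\<close>.
\<close>

definition leads :: "'a::comm_ring_1 set \<Rightarrow> 'a \<Rightarrow> 'a set \<Rightarrow> 'a \<Rightarrow> 'a \<Rightarrow> nat \<Rightarrow> bool" where
  "leads A w I f J d \<longleftrightarrow> f \<in> I \<and> J \<in> A \<and> J \<notin> I \<and> f - J * w ^ d \<in> pol_lt A w d"

text \<open>
  If no element of \<open>I\<close> of degree less than \<open>e\<close> has a leading coefficient outside \<open>I\<close>, then the
  elements of \<open>I\<close> of degree less than \<open>e\<close> have all their coefficients in \<open>I \<inter> A\<close>; they
  therefore belong to every ideal that contains \<open>I \<inter> A\<close>.
\<close>

lemma reduced_transfer: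
  assumes A: "is_subring A" "A \<subseteq> R" and w: "w \<in> R" and R: "is_subring R"
    and I: "dideal D R I" and N: "dideal D R N" and IN: "I \<inter> A \<subseteq> N"
    and no: "\<And>f J e'. e' < e \<Longrightarrow> \<not> leads A w I f J e'"
    and g: "g \<in> I" "g \<in> pol_lt A w e"
  shows "g \<in> N"
  using no g
proof (induction e arbitrary: g)
  case 0
  then show ?case using dideal_0[OF N] by (simp add: pol_lt_0[OF A(1)])
next
  case (Suc e)
  then obtain c where c: "c \<in> A" "g - c * w ^ e \<in> pol_lt A w e" by (auto simp: pol_lt_Suc[OF A(1)])
  with Suc.prems have "c \<in> I" by (auto simp: leads_def)
  moreover from this c IN have "c \<in> N" by blast
  moreover have "w ^ e \<in> R" using subring_power[OF R w] .
  ultimately have cw: "c * w ^ e \<in> I" "c * w ^ e \<in> N" by (auto intro: dideal_mult'[OF I] dideal_mult'[OF N])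
  have "g - c * w ^ e \<in> N"
    using Suc.IH[OF _ dideal_diff[OF R I Suc.prems(2) cw(1)] c(2)] Suc.prems(1) by auto
  from dideal_add[OF N this cw(2)] show ?case by simp
qed

text \<open>
  Over the fraction field of \<open>A / (I \<inter> A)\<close> the polynomial \<open>f\<close> of least degree in \<open>I\<close> is
  irreducible, so it generates the only prime ideal of the polynomial ring that contains it and meets
  \<open>A\<close> in \<open>I \<inter> A\<close>.  Without fraction fields: pseudo-division by \<open>f\<close> puts \<open>I\<close> into \<open>N\<close>.  Dividing
  \<open>f\<close> by a polynomial \<open>h\<close> of least degree for \<open>N\<close> leaves a remainder in both ideals, so the product of
  quotient and \<open>h\<close> lies in \<open>I\<close>; the quotient has degree less than \<open>d\<close> and a leading coefficient
  outside \<open>I\<close>, so it is \<open>h\<close> that lies in \<open>I\<close>, and pseudo-division by \<open>h\<close> puts \<open>N\<close> into \<open>I\<close>.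
\<close>

lemma prime_agree_step:
  assumes A: "is_subring A" "A \<subseteq> R" and w: "w \<in> R" and R: "is_subring R"
    and I: "prime_dideal D R I" and N: "prime_dideal D R N" and IN: "I \<inter> A = N \<inter> A"
    and f: "leads A w I f J d" and min: "\<And>f J e. e < d \<Longrightarrow> \<not> leads A w I f J e"
    and fN: "f \<in> N"
  shows "I \<inter> pol A w = N \<inter> pol A w"
proof -
  note iI = prime_dideal_dideal[OF I] and iN = prime_dideal_dideal[OF N]
  have polR: "pol A w \<subseteq> R" by (rule pol_subset[OF A(1) R A(2) w])
  have transfer: "g \<in> X"
    if X: "prime_dideal D R X" and Y: "prime_dideal D R Y" and XY: "Y \<inter> A = X \<inter> A"
      and h: "leads A w Y h K e" and mn: "\<And>f J e'. e' < e \<Longrightarrow> \<not> leads A w Y f J e'"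
      and hX: "h \<in> X" and g: "g \<in> Y" "g \<in> pol A w" for X Y h K e g
  proof -
    note iX = prime_dideal_dideal[OF X] and iY = prime_dideal_dideal[OF Y]
    have K: "K \<in> A" "K \<notin> X" using h XY by (auto simp: leads_def)
    then have KR: "K ^ k \<in> R" for k using A R by (auto intro: subring_power)
    have hK: "h - K * w ^ e \<in> pol_lt A w e" using h by (simp add: leads_def)
    obtain k q r where *: "K ^ k * g = q * h + r" "q \<in> pol A w" "r \<in> pol_lt A w e"
      using pseudo_division[OF A(1) K(1) hK g(2)] by blast
    have qh: "q * h \<in> Y" "q * h \<in> X"
      using *(2) polR h hX by (auto simp: leads_def intro: dideal_mult[OF iY] dideal_mult[OF iX])
    have "r = K ^ k * g - q * h" using *(1) by simp
    then have "r \<in> Y" using dideal_diff[OF R iY] dideal_mult[OF iY KR g(1)] qh by blast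
    then have "r \<in> X"
      using reduced_transfer[OF A w R iY iX _ mn _ *(3)] XY by blast
    then have "K ^ k * g \<in> X" unfolding *(1) using dideal_add[OF iX qh(2)] by blast
    then show "g \<in> X"
      using prime_dideal_mult[OF X KR] prime_dideal_power[OF R X] K A(2) polR g(2) by blast
  qed
  have IsubN: "g \<in> N" if "g \<in> I" "g \<in> pol A w" for g
    using transfer[OF N I IN f min fN that] .
  have fd: "f \<in> I" "J \<in> A" "J \<notin> I" "J \<notin> N" "f - J * w ^ d \<in> pol_lt A w d"
    using f IN by (auto simp: leads_def)
  then have ex: "\<exists>d f J. leads A w N f J d" using fN by (auto simp: leads_def)
  define dN where "dN = (LEAST d. \<exists>f J. leads A w N f J d)"
  have "\<exists>f J. leads A w N f J dN" unfolding dN_def by (rule LeastI_ex[OF ex])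
  then obtain h K where h: "leads A w N h K dN" by blast
  have minN: "\<not> leads A w N f J e" if "e < dN" for f J e
    using not_less_Least[OF that[unfolded dN_def]] by blast
  have dN: "dN \<le> d" unfolding dN_def using fd fN by (intro Least_le) (auto simp: leads_def)
  have hd: "h \<in> N" "K \<in> A" "K \<notin> N" "K \<notin> I" "h - K * w ^ dN \<in> pol_lt A w dN"
    using h IN by (auto simp: leads_def)
  have dN0: "dN \<noteq> 0"
  proof
    assume "dN = 0"
    then have "h = K" using hd(5) by (simp add: pol_lt_0[OF A(1)])
    then show False using hd by simp
  qed
  have hpol: "h \<in> pol A w"
    using hd pol_lt_pol[OF A(1), of h w "Suc dN"] pol_lt_Suc[OF A(1)] by blast
  obtain k q r where *: "K ^ Suc k * f = q * h + r"
      "q - K ^ k * J * w ^ (d - dN) \<in> pol_lt A w (d - dN)" "r \<in> pol_lt A w dN"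
    using pseudo_division_lead[OF A(1) hd(2,5) fd(2,5) dN] by blast
  have KA: "K ^ k \<in> A" "K ^ Suc k \<in> A" using hd A by (auto intro: subring_power subring_mult)
  have KJ: "K ^ k * J \<in> A" using subring_mult[OF A(1) KA(1) fd(2)] .
  have "q \<in> pol_lt A w (Suc (d - dN))" using *(2) KJ pol_lt_Suc[OF A(1)] by blast
  then have qR: "q \<in> R" using pol_lt_pol[OF A(1)] polR by blast
  have r: "r = K ^ Suc k * f - q * h" using *(1) by simp
  have "r \<in> N" unfolding r using KA A(2) fN hd(1) qR
    by (intro dideal_diff[OF R iN] dideal_mult[OF iN]) auto
  then have "r \<in> I"
    using reduced_transfer[OF A w R iN iI _ minN _ *(3)] IN by blast
  then have "K ^ Suc k * f - r \<in> I"
    using KA(2) A(2) by (intro dideal_diff[OF R iI] dideal_mult[OF iI] fd(1)) auto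
  moreover have "K ^ Suc k * f - r = q * h" using *(1) by simp
  ultimately have "q * h \<in> I" by simp
  moreover have "h \<in> R" using hpol polR by blast
  ultimately have "q \<in> I \<or> h \<in> I"
    using prime_dideal_mult[OF I qR] by blast
  moreover have "q \<notin> I"
  proof
    assume "q \<in> I"
    then have "K ^ k * J \<in> I" using min[of "d - dN" q "K ^ k * J"] *(2) KJ dN dN0 by (auto simp: leads_def)
    then show False
      using prime_dideal_mult[OF I] prime_dideal_power[OF R I] KA fd(2,3) hd(2,4) A(2) by blast
  qed
  ultimately have hI: "h \<in> I" by blast
  have "g \<in> I" if "g \<in> N" "g \<in> pol A w" for g
    using transfer[OF I N IN[symmetric] h minN hI that] .
  with IsubN show ?thesis by blast
qed

text \<open>
  \<open>S\<close> is the formal derivative of \<open>f\<close> with respect to \<open>w\<close>, and \<open>D f = S * D w + \<dots>\<close> is the chain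
  rule.
\<close>

lemma separant_exists:
  assumes D: "derivation D" and A: "is_subring A" and DA: "\<And>a. a \<in> A \<Longrightarrow> D a \<in> pol A w"
    and f: "f \<in> pol_lt A w e"
  shows "\<exists>S\<in>pol_lt A w (e - 1). D f - S * D w \<in> pol A w"
  using f
proof (induction e arbitrary: f)
  case 0
  then show ?case
    using pol_lt_zero[OF A] pol_lt_pol[OF A pol_lt_zero[OF A]]
    by (auto simp: pol_lt_0[OF A] derivation_0[OF D])
next
  case (Suc e)
  note sP = is_subring_pol[OF A, of w]
  from Suc.prems obtain c where c: "c \<in> A" "f - c * w ^ e \<in> pol_lt A w e" by (auto simp: pol_lt_Suc[OF A])
  from Suc.IH[OF this(2)] obtain S where S: "S \<in> pol_lt A w (e - 1)" "D (f - c * w ^ e) - S * D w \<in> pol A w" by blast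
  define S' where "S' = S + of_nat e * c * w ^ (e - 1)"
  have ec: "of_nat e * c \<in> A" by (intro subring_mult[OF A] subring_of_nat[OF A] c)
  have S': "S' \<in> pol_lt A w e"
  proof (cases e)
    case 0
    then show ?thesis using S(1) by (simp add: S'_def)
  next
    case (Suc e')
    then show ?thesis
      unfolding S'_def using S(1) ec pol_lt_monom[OF A ec, of w e'] pol_lt_mono[OF A, of e' e w]
      by (intro pol_lt_add[OF A]) auto
  qed
  have Dw: "D (w ^ e) = of_nat e * w ^ (e - 1) * D w"
    by (cases e) (simp_all add: derivation_1[OF D] derivation_power_Suc[OF D] del: power_Suc of_nat_Suc)
  have "D f = D (f - c * w ^ e) + D (c * w ^ e)" using derivation_add[OF D, of "f - c * w ^ e" "c * w ^ e"] by simp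
  then have "D f - S' * D w = (D (f - c * w ^ e) - S * D w) + D c * w ^ e"
    by (simp add: S'_def derivation_mult[OF D] Dw algebra_simps)
  moreover have "D c * w ^ e \<in> pol A w"
    using DA[OF c(1)] by (intro subring_mult[OF sP] subring_power[OF sP] pol_gen[OF A])
  ultimately have "D f - S' * D w \<in> pol A w" using subring_add[OF sP S(2)] by simp
  with S' show ?case by auto
qed

context
  fixes D :: "'a::comm_ring_1 \<Rightarrow> 'a" and R :: "'a set" and A :: "nat \<Rightarrow> 'a set" and w :: "nat \<Rightarrow> 'a"
  assumes D: "derivation D" and R: "diff_subring D R" "has_rationals R"
    and A: "\<And>r. is_subring (A r)" and Aw: "\<And>r. A (Suc r) = pol (A r) (w r)"
    and DA: "\<And>r a. a \<in> A r \<Longrightarrow> D a \<in> A (Suc r)" and Dw: "\<And>r. D (w r) = w (Suc r)"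
    and RA: "R = (\<Union>r. A r)"
begin

text \<open>
  A prime differential ideal of a tower \<open>A 0 \<subseteq> A 1 \<subseteq> \<dots>\<close>, where \<open>A (Suc r)\<close> adjoins
  \<open>w r\<close> to \<open>A r\<close> and differentiation moves \<open>w r\<close> to \<open>w (Suc r)\<close>, is determined by its trace on \<open>A r\<close>
  together with a polynomial \<open>f\<close> of least degree for \<open>w r\<close>.  On \<open>A (Suc r)\<close> this is the preceding
  lemma.  Beyond that, the higher derivatives of \<open>f\<close> are linear in the next generator, with the
  separant \<open>S\<close> as leading coefficient; \<open>S\<close> has smaller degree than \<open>f\<close>, with leading coefficient
  \<open>of_nat d * J\<close> outside \<open>I\<close>, and so lies in neither ideal.
  Up to powers of \<open>S\<close>, every element can thus be reduced to \<open>A (Suc r)\<close> modulo derivatives of \<open>f\<close>.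
\<close>

lemma prime_dideal_determined:
  assumes I: "prime_dideal D R I" and N: "prime_dideal D R N" and IN: "I \<inter> A r = N \<inter> A r"
    and f: "leads (A r) (w r) I f J d" and min: "\<And>f J e. e < d \<Longrightarrow> \<not> leads (A r) (w r) I f J e"
    and fN: "f \<in> N"
  shows "I = N"
proof -
  note iI = prime_dideal_dideal[OF I] and iN = prime_dideal_dideal[OF N]
  have sR: "is_subring R" using R by (simp add: diff_subring_def)
  have AR: "A s \<subseteq> R" for s using RA by blast
  have wA: "w s \<in> A (Suc s)" for s unfolding Aw by (rule pol_gen[OF A])
  then have wR: "w s \<in> R" for s using AR by blast
  have Amono: "A s \<subseteq> A (s + k)" for s k
    by (induction k) (use pol_base[OF A] in \<open>auto simp: Aw\<close>)
  have base: "I \<inter> A (Suc r) = N \<inter> A (Suc r)"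
    unfolding Aw by (rule prime_agree_step[OF A AR wR sR I N IN f min fN])
  have fd: "f \<in> I" "J \<in> A r" "J \<notin> I" "f - J * w r ^ d \<in> pol_lt (A r) (w r) d"
    using f by (auto simp: leads_def)
  have "d \<noteq> 0" 
  proof
    assume "d = 0"
    then have "f = J" using fd(4) by (simp add: pol_lt_0[OF A])
    then show False using fd by simp
  qed
  then obtain d' where d': "d = Suc d'" by (cases d) auto
  obtain S' where S': "S' \<in> pol_lt (A r) (w r) d'" "D (f - J * w r ^ d) - S' * D (w r) \<in> A (Suc r)"
    using separant_exists[OF D A _ fd(4)] DA d' unfolding Aw by auto
  define S where "S = of_nat d * J * w r ^ d' + S'"
  have dJ: "of_nat d * J \<in> A r" by (intro subring_mult[OF A] subring_of_nat[OF A] fd)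
  have SA: "S \<in> A (Suc r)"
    unfolding S_def Aw
    by (intro subring_add[OF is_subring_pol[OF A]] pol_lt_pol[OF A pol_lt_monom[OF A dJ]] pol_lt_pol[OF A S'(1)])
  have SI: "S \<notin> I"
  proof
    assume "S \<in> I"
    moreover have "of_nat d * J \<notin> I"
    proof
      assume h: "of_nat d * J \<in> I"
      from R(2) obtain q where q: "q \<in> R" "of_nat d * q = 1" unfolding d' has_rationals_def by blast
      have "q * (of_nat d * J) \<in> I" by (rule dideal_mult[OF iI q(1) h])
      moreover have "q * (of_nat d * J) = (of_nat d * q) * J" by (simp only: ac_simps)
      ultimately show False using q fd by simp
    qed
    ultimately have "leads (A r) (w r) I S (of_nat d * J) d'"
      using dJ S'(1) by (simp add: leads_def S_def)
    then show False using min d' by blast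
  qed
  then have SN: "S \<notin> N" using base SA by blast
  have SR: "S ^ k \<in> R" for k using SA AR by (blast intro: subring_power[OF sR])
  have F: "(D ^^ Suc j) f - S * w (Suc r + j) \<in> A (Suc r + j)" for j
  proof (induction j)
    case 0
    have "D f = D (f - J * w r ^ d) + D (J * w r ^ d)"
      using derivation_add[OF D, of "f - J * w r ^ d" "J * w r ^ d"] by simp
    then have "D f - S * w (Suc r) = (D (f - J * w r ^ d) - S' * D (w r)) + D J * w r ^ d"
      by (simp add: S_def d' derivation_mult[OF D] derivation_power_Suc[OF D] Dw algebra_simps del: power_Suc)
    moreover have "D J * w r ^ d \<in> A (Suc r)"
      by (intro subring_mult[OF A] DA fd subring_power[OF A] wA)
    ultimately show ?case using subring_add[OF A S'(2)] by simp
  next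
    case (Suc j)
    let ?s = "Suc r + j"
    have "D ((D ^^ Suc j) f) = D ((D ^^ Suc j) f - S * w ?s) + D (S * w ?s)"
      using derivation_add[OF D, of "(D ^^ Suc j) f - S * w ?s" "S * w ?s"] by simp
    then have "(D ^^ Suc (Suc j)) f - S * w (Suc ?s) = D ((D ^^ Suc j) f - S * w ?s) + D S * w ?s"
      by (simp add: derivation_mult[OF D] Dw algebra_simps)
    moreover have "D S \<in> A (Suc ?s)" using DA[OF SA] Amono[of "Suc (Suc r)" j] by auto
    ultimately show ?case
      using subring_add[OF A DA[OF Suc.IH] subring_mult[OF A _ wA]] by simp
  qed
  have FI: "(D ^^ k) f \<in> I" "(D ^^ k) f \<in> N" for k
    by (induction k) (use fd fN in \<open>auto intro: dideal_D[OF iI] dideal_D[OF iN]\<close>)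
  have cancel: "g \<in> Y" if X: "prime_dideal D R X" and Y: "prime_dideal D R Y" "S \<notin> Y"
      and XY: "X \<inter> A s \<subseteq> Y" and h: "h \<in> X" "h \<in> Y" "h - S * w s \<in> A s" and SA: "S \<in> A s"
      and g: "g \<in> X" "g \<in> A (Suc s)"
    for X Y s h g
  proof -
    note iX = prime_dideal_dideal[OF X] and iY = prime_dideal_dideal[OF Y(1)]
    have "h - S * w s ^ 1 \<in> pol_lt (A s) (w s) 1" using h(3) by (simp add: pol_lt_1[OF A])
    from pseudo_division[OF A SA this g(2)[unfolded Aw]]
    obtain k q t where *: "S ^ k * g = q * h + t" "q \<in> A (Suc s)" "t \<in> A s"
      unfolding Aw by (auto simp: pol_lt_1[OF A])
    have q: "q \<in> R" using *(2) AR by blast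
    have "t = S ^ k * g - q * h" using *(1) by simp
    then have "t \<in> X" using dideal_diff[OF sR iX dideal_mult[OF iX SR g(1)] dideal_mult[OF iX q h(1)]] by simp
    then have "t \<in> Y" using XY *(3) by blast
    then have "S ^ k * g \<in> Y" unfolding *(1) by (intro dideal_add[OF iY] dideal_mult[OF iY q h(2)])
    moreover have "g \<in> R" using g(2) AR by blast
    ultimately have "S ^ k \<in> Y \<or> g \<in> Y" using prime_dideal_mult[OF Y(1) SR] by blast
    then show "g \<in> Y"
      using prime_dideal_power[OF sR Y(1), of S] Y(2) SR[of 1] by auto
  qed
  have agree: "I \<inter> A (Suc r + j) = N \<inter> A (Suc r + j)" for j
  proof (induction j)
    case 0
    then show ?case using base by simp
  next
    case (Suc j)
    have SA': "S \<in> A (Suc r + j)" using SA Amono by blast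
    have "g \<in> N" if "g \<in> I" "g \<in> A (Suc (Suc r + j))" for g
      using cancel[OF I N SN _ FI F SA' that] Suc by blast
    moreover have "g \<in> I" if "g \<in> N" "g \<in> A (Suc (Suc r + j))" for g
      using cancel[OF N I SI _ FI(2,1) F SA' that] Suc by blast
    ultimately show ?case by auto
  qed
  have Amono2: "g \<in> A (Suc r + s)" if "g \<in> A s" for g s
    using Amono[of s "Suc r"] that by (auto simp: add.commute)
  have "I \<subseteq> R" "N \<subseteq> R" using iI iN by (auto dest: dideal_subset)
  then show ?thesis
  proof (intro equalityI subsetI)
    fix g assume "g \<in> I"
    then obtain s where "g \<in> A s" using \<open>I \<subseteq> R\<close> RA by blast
    then have "g \<in> I \<inter> A (Suc r + s)" using \<open>g \<in> I\<close> Amono2 by blast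
    then show "g \<in> N" unfolding agree by blast
  next
    fix g assume "g \<in> N"
    then obtain s where "g \<in> A s" using \<open>N \<subseteq> R\<close> RA by blast
    then have "g \<in> N \<inter> A (Suc r + s)" using \<open>g \<in> N\<close> Amono2 by blast
    then show "g \<in> I" unfolding agree[symmetric] by blast
  qed
qed

end

section \<open>Partial evaluation and Kolchin-dense points\<close>

lemma lookup_mult_monom:
  "Poly_Mapping.lookup (p * Poly_Mapping.single \<mu> 1) (\<nu> + \<mu>) = Poly_Mapping.lookup (p :: ('v, 'a::comm_ring_1) dpoly) \<nu>"
proof -
  have "p * Poly_Mapping.single \<mu> 1 =
      (\<Sum>\<kappa>\<in>Poly_Mapping.keys p. Poly_Mapping.single (\<kappa> + \<mu>) (Poly_Mapping.lookup p \<kappa>))"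
    by (subst poly_mapping_sum_singles[of p]) (simp add: sum_distrib_right mult_single)
  then show ?thesis
    by (simp add: lookup_sum lookup_single when_def in_keys_iff)
qed

text \<open>
  Representations over a ring of polynomials not involving \<open>(v, r)\<close> do have a degree: the exponent
  of \<open>(v, r)\<close>.
\<close>

lemma pol_lt_degree:
  assumes K: "is_subring K" and x: "(v, r) \<notin> X"
    and p: "p \<in> pol_lt (apolys K X) (dvar v r) d" and \<mu>: "\<mu> \<in> Poly_Mapping.keys p"
  shows "Poly_Mapping.lookup \<mu> (v, r) < d"
  using p \<mu>
proof (induction d arbitrary: p \<mu>)
  case 0
  then show ?case by (simp add: pol_lt_0[OF is_subring_apolys[OF K]])
next
  case (Suc d)
  then obtain c where c: "c \<in> apolys K X" "p - c * dvar v r ^ d \<in> pol_lt (apolys K X) (dvar v r) d"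
    by (auto simp: pol_lt_Suc[OF is_subring_apolys[OF K]])
  have "\<mu> \<in> Poly_Mapping.keys (p - c * dvar v r ^ d) \<union> Poly_Mapping.keys (c * dvar v r ^ d)"
    using Suc.prems(2) keys_add[of "p - c * dvar v r ^ d" "c * dvar v r ^ d"] by auto
  then show ?case
  proof
    assume "\<mu> \<in> Poly_Mapping.keys (p - c * dvar v r ^ d)"
    from Suc.IH[OF c(2) this] show ?thesis by simp
  next
    assume "\<mu> \<in> Poly_Mapping.keys (c * dvar v r ^ d)"
    then obtain \<kappa> where \<kappa>: "\<kappa> \<in> Poly_Mapping.keys c" "\<mu> = \<kappa> + Poly_Mapping.single (v, r) d"
      unfolding dvar_power using keys_mult[of c "Poly_Mapping.single (Poly_Mapping.single (v, r) d) 1"] by auto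
    have "Poly_Mapping.keys \<kappa> \<subseteq> X" using c(1) \<kappa>(1) by (simp add: apolys_def)
    then have "Poly_Mapping.lookup \<kappa> (v, r) = 0"
      using x by (meson in_keys_iff subsetD)
    then show ?thesis by (simp add: \<kappa> lookup_add)
  qed
qed

lemma lead_key:
  assumes K: "is_subring K" and x: "(v, r) \<notin> X"
    and p: "p - J * dvar v r ^ d \<in> pol_lt (apolys K X) (dvar v r) d"
    and J: "J \<in> apolys K X" "\<nu> \<in> Poly_Mapping.keys J"
  shows "\<nu> + Poly_Mapping.single (v, r) d \<in> Poly_Mapping.keys p"
proof -
  let ?\<mu> = "\<nu> + Poly_Mapping.single (v, r) d"
  have "Poly_Mapping.lookup (J * dvar v r ^ d) ?\<mu> = Poly_Mapping.lookup J \<nu>"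
    unfolding dvar_power by (rule lookup_mult_monom)
  moreover have "Poly_Mapping.lookup (p - J * dvar v r ^ d) ?\<mu> = 0"
    using pol_lt_degree[OF K x p, of ?\<mu>] by (auto simp: in_keys_iff lookup_add)
  ultimately show ?thesis using J(2) by (simp add: in_keys_iff lookup_minus)
qed

lemma apolys_insert:
  assumes K: "is_subring K"
  shows "apolys K (insert (v, r) X) = pol (apolys K X) (dvar v r)"
proof -
  note sX = is_subring_apolys[OF K]
  note sP = is_subring_pol[OF sX]
  show ?thesis
  proof
    show "pol (apolys K X) (dvar v r) \<subseteq> apolys K (insert (v, r) X)"
      using apolys_mono[of X "insert (v, r) X" K] apolys_dvar[OF K, of v r "insert (v, r) X"]
      by (intro pol_subset[OF sX sX]) auto
  next
    have "p \<in> pol (apolys K X) (dvar v r)" if "p \<in> apolys K (insert (v, r) X)" for p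
      using that
    proof (induction rule: apolys_induct)
      case (const c)
      then show ?case using pol_base[OF sX] apolys_dconst by blast
    next
      case (var u k)
      then show ?case
        using pol_gen[OF sX, of "dvar v r"] subsetD[OF pol_base[OF sX] apolys_dvar[OF K, of u k X]]
        by (cases "(u, k) = (v, r)") auto
    qed (simp_all add: K subring_add[OF sP] subring_mult[OF sP])
    then show "apolys K (insert (v, r) X) \<subseteq> pol (apolys K X) (dvar v r)" by blast
  qed
qed

text \<open>
  The indeterminates of \<open>K{vs}\<close> and the derivatives of \<open>v\<close> of order less than \<open>r\<close>.
\<close>

definition below :: "'v set \<Rightarrow> 'v \<Rightarrow> nat \<Rightarrow> ('v \<times> nat) set" where
  "below vs v r = vs \<times> UNIV \<union> {v} \<times> {..<r}"

lemma below_0: "below vs v 0 = vs \<times> UNIV" and below_Suc: "below vs v (Suc r) = insert (v, r) (below vs v r)"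
  by (auto simp: below_def)

lemma apolys_below_mono: "r \<le> s \<Longrightarrow> apolys K (below vs v r) \<subseteq> apolys K (below vs v s)"
  by (rule apolys_mono) (auto simp: below_def)

lemma apolys_below_Suc:
  "is_subring K \<Longrightarrow> apolys K (below vs v (Suc r)) = pol (apolys K (below vs v r)) (dvar v r)"
  by (simp add: below_Suc apolys_insert)

lemma dpolys_insert_below:
  assumes K: "is_subring K"
  shows "dpolys K (insert v vs) = (\<Union>r. apolys K (below vs v r))"
proof
  show "(\<Union>r. apolys K (below vs v r)) \<subseteq> dpolys K (insert v vs)"
    unfolding dpolys_eq_apolys by (intro UN_least apolys_mono) (auto simp: below_def)
  have "\<exists>r. p \<in> apolys K (below vs v r)" if "p \<in> dpolys K (insert v vs)" for p
    using that
  proof (induction rule: dpolys_induct)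
    case (var u k)
    then have "(u, k) \<in> below vs v (Suc k)" by (auto simp: below_def)
    then show ?case by (intro exI apolys_dvar[OF K])
  next
    case (add p q)
    then obtain r s where "p \<in> apolys K (below vs v r)" "q \<in> apolys K (below vs v s)" by blast
    then have "p \<in> apolys K (below vs v (r + s))" "q \<in> apolys K (below vs v (r + s))"
      using apolys_below_mono[of r "r + s" K vs v] apolys_below_mono[of s "r + s" K vs v] by auto
    then show ?case by (intro exI subring_add[OF is_subring_apolys[OF K]])
  next
    case (mult p q)
    then obtain r s where "p \<in> apolys K (below vs v r)" "q \<in> apolys K (below vs v s)" by blast
    then have "p \<in> apolys K (below vs v (r + s))" "q \<in> apolys K (below vs v (r + s))"
      using apolys_below_mono[of r "r + s" K vs v] apolys_below_mono[of s "r + s" K vs v] by auto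
    then show ?case by (intro exI subring_mult[OF is_subring_apolys[OF K]])
  next
    case (const c)
    then show ?case by (intro exI apolys_dconst)
  qed (rule K)
  then show "dpolys K (insert v vs) \<subseteq> (\<Union>r. apolys K (below vs v r))" by blast
qed

lemma dderiv_below:
  "derivation \<delta> \<Longrightarrow> diff_subring \<delta> K \<Longrightarrow> p \<in> apolys K (below vs v r) \<Longrightarrow>
    dderiv \<delta> p \<in> apolys K (below vs v (Suc r))"
  by (erule (2) dderiv_apolys) (auto simp: below_def)

text \<open>
  Evaluation of all variables except \<open>v\<close>, which becomes the indeterminate of a differential
  polynomial in one variable, as needed for the axioms of differentially closed fields.
\<close>

definition partial_eval :: "('a::comm_ring_1 \<Rightarrow> 'a) \<Rightarrow> ('v \<Rightarrow> 'a) \<Rightarrow> 'v \<Rightarrow> ('v, 'a) dpoly \<Rightarrow> (unit, 'a) dpoly" where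
  "partial_eval \<delta> a v = dcomp \<delta> (\<lambda>u. if u = v then dvar () 0 else dconst (a u))"

lemma deval_partial_eval:
  "derivation \<delta> \<Longrightarrow> deval \<delta> (\<lambda>_. b) (partial_eval \<delta> a v p) = deval \<delta> (a(v := b)) p"
  unfolding partial_eval_def
  by (simp add: deval_dcomp deval_dvar deval_dconst fun_upd_def if_distrib cong: if_cong)

lemma dderiv_funpow_dvar: "derivation \<delta> \<Longrightarrow> (dderiv \<delta> ^^ k) (dvar v r) = dvar v (r + k)"
  by (induction k) (simp_all add: dderiv_dvar)

lemma dderiv_funpow_dconst: "derivation \<delta> \<Longrightarrow> (dderiv \<delta> ^^ k) (dconst c) = dconst ((\<delta> ^^ k) c)"
  by (induction k) (simp_all add: dderiv_dconst)

lemma partial_eval_simps: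
  assumes "derivation \<delta>"
  shows "partial_eval \<delta> a v (dconst c) = dconst c"
    "partial_eval \<delta> a v (dvar v k) = dvar () k"
    "u \<noteq> v \<Longrightarrow> partial_eval \<delta> a v (dvar u k) = dconst ((\<delta> ^^ k) (a u))"
    "partial_eval \<delta> a v (p + q) = partial_eval \<delta> a v p + partial_eval \<delta> a v q"
    "partial_eval \<delta> a v (p * q) = partial_eval \<delta> a v p * partial_eval \<delta> a v q"
    "partial_eval \<delta> a v (p ^ k) = partial_eval \<delta> a v p ^ k"
  by (simp_all add: partial_eval_def dcomp_simps dderiv_funpow_dvar dderiv_funpow_dconst assms)

lemma partial_eval_diff:
  assumes "derivation \<delta>"
  shows "partial_eval \<delta> a v (p - q) = partial_eval \<delta> a v p - partial_eval \<delta> a v q"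
  using partial_eval_simps(4)[OF assms, of a v "p - q" q] by simp

lemma partial_eval_below:
  assumes d: "derivation \<delta>" and K: "diff_subring \<delta> K" and v: "v \<notin> vs"
    and a: "\<And>u. u \<in> vs \<Longrightarrow> a u \<in> K" and p: "p \<in> apolys K (below vs v r)"
  shows "partial_eval \<delta> a v p \<in> apolys K ({()} \<times> {..<r})"
proof -
  have sK: "is_subring K" using K by (simp add: diff_subring_def)
  note s = is_subring_apolys[OF sK, of "{()} \<times> {..<r}"]
  show ?thesis
    using p
  proof (induction rule: apolys_induct)
    case (var u k)
    then show ?case
      using v a diff_subring_funpow[OF K] sK
      by (cases "u = v") (auto simp: partial_eval_simps[OF d] below_def intro: apolys_dconst apolys_dvar)
  qed (auto simp: partial_eval_simps[OF d] sK intro: apolys_dconst subring_add[OF s] subring_mult[OF s])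
qed

lemma partial_eval_lead:
  assumes d: "derivation \<delta>" and K: "is_subring K" and v: "v \<notin> vs"
    and p: "p - J * dvar v r ^ e \<in> pol_lt (apolys K (below vs v r)) (dvar v r) e"
    and J: "J \<in> apolys K (below vs v r)" "partial_eval \<delta> a v J \<noteq> 0"
  shows "partial_eval \<delta> a v p \<noteq> 0" "e \<noteq> 0 \<Longrightarrow> r \<in> occurring_orders (partial_eval \<delta> a v p)"
proof -
  let ?A = "apolys UNIV ({()} \<times> {..<r}) :: (unit, 'a) dpoly set"
  note U = is_subring_UNIV[where 'a = 'a]
  have U': "diff_subring \<delta> UNIV" by (simp add: diff_subring_def is_subring_UNIV)
  have A: "partial_eval \<delta> a v q \<in> ?A" if "q \<in> apolys K (below vs v r)" for q
    using partial_eval_below[OF d U' v, of a q r] that by (auto simp: apolys_def)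
  have "partial_eval \<delta> a v q \<in> pol_lt ?A (dvar () r) i"
    if "q \<in> pol_lt (apolys K (below vs v r)) (dvar v r) i" for q i
    using that
  proof (induction i arbitrary: q)
    case 0
    then show ?case using partial_eval_simps(1)[OF d, of a v 0]
      by (simp add: pol_lt_0 is_subring_apolys K U dconst_def)
  next
    case (Suc i)
    then obtain c where c: "c \<in> apolys K (below vs v r)"
      "q - c * dvar v r ^ i \<in> pol_lt (apolys K (below vs v r)) (dvar v r) i"
      by (auto simp: pol_lt_Suc is_subring_apolys K)
    from Suc.IH[OF c(2)] A[OF c(1)] show ?case
      by (auto simp: pol_lt_Suc is_subring_apolys U partial_eval_diff[OF d] partial_eval_simps[OF d])
  qed
  from this[OF p] have p': "partial_eval \<delta> a v p - partial_eval \<delta> a v J * dvar () r ^ e \<in> pol_lt ?A (dvar () r) e"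
    by (simp add: partial_eval_diff[OF d] partial_eval_simps[OF d])
  obtain \<nu> where "\<nu> \<in> Poly_Mapping.keys (partial_eval \<delta> a v J)"
    using J(2) by (metis all_not_in_conv keys_eq_empty)
  then have *: "\<nu> + Poly_Mapping.single ((), r) e \<in> Poly_Mapping.keys (partial_eval \<delta> a v p)"
    using lead_key[OF U _ p' A[OF J(1)]] by simp
  then show "partial_eval \<delta> a v p \<noteq> 0" by auto
  show "r \<in> occurring_orders (partial_eval \<delta> a v p)" if "e \<noteq> 0"
    unfolding occurring_orders_def using * that
    by (auto intro!: bexI[of _ "\<nu> + Poly_Mapping.single ((), r) e"] simp: in_keys_iff lookup_add)
qed

lemma occurring_orders_apolys: "p \<in> apolys K ({()} \<times> {..<r}) \<Longrightarrow> k \<in> occurring_orders p \<Longrightarrow> k < r"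
  by (auto simp: occurring_orders_def apolys_def)

lemma occurring_orders_dvar: "r \<in> occurring_orders (dvar () r :: (unit, 'a::comm_ring_1) dpoly)"
  by (simp add: occurring_orders_def dvar_def)

lemma model_DCF0_D:
  assumes "model_DCF0 \<delta> K" "f \<in> dpolys K UNIV" "g \<in> dpolys K UNIV" "g \<noteq> 0"
    "\<exists>r\<in>occurring_orders f. \<forall>k\<in>occurring_orders g. k < r"
  shows "\<exists>a\<in>K. deval \<delta> (\<lambda>_. a) f = 0 \<and> deval \<delta> (\<lambda>_. a) g \<noteq> 0"
proof -
  from assms(1) have "\<forall>f\<in>dpolys K UNIV. \<forall>g\<in>dpolys K UNIV.
        g \<noteq> 0 \<and> (\<exists>r\<in>occurring_orders f. \<forall>k\<in>occurring_orders g. k < r) \<longrightarrow>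
        (\<exists>a\<in>K. deval \<delta> (\<lambda>_. a) f = 0 \<and> deval \<delta> (\<lambda>_. a) g \<noteq> 0)"
    unfolding model_DCF0_def by (rule conjunct2)
  from this[rule_format, OF assms(2,3)] assms(4,5) show ?thesis by simp
qed

lemma blum_nonzero:
  fixes g :: "(unit, 'a::field_char_0) dpoly"
  assumes m: "model_DCF0 \<delta> K" and g: "g \<in> dpolys K UNIV" "g \<noteq> 0"
  shows "\<exists>a\<in>K. deval \<delta> (\<lambda>_. a) g \<noteq> 0"
proof -
  have K: "is_subring K" using m delta_subfield_is_subring by (auto simp: model_DCF0_def)
  have "g \<in> (\<Union>r. apolys K (below {} () r))"
    using g(1) dpolys_insert_below[OF K, of "()" "{}"] by (simp add: UNIV_unit)
  then obtain r where "g \<in> apolys K ({()} \<times> {..<r})" by (auto simp: below_def)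
  then have "\<exists>s\<in>occurring_orders (dvar () r :: (unit, 'a) dpoly). \<forall>k\<in>occurring_orders g. k < s"
    using occurring_orders_apolys occurring_orders_dvar by blast
  then show ?thesis
    using model_DCF0_D[OF m dpolys_dvar[OF K UNIV_I] g] by blast
qed

lemma dpolys_empty:
  assumes K: "is_subring K" and p: "p \<in> dpolys K {}"
  obtains c where "c \<in> K" "p = dconst c"
proof -
  have "\<exists>c\<in>K. p = dconst c" using p
    by (induction rule: dpolys_induct)
      (auto simp: K dconst_def mult_single simp flip: single_add intro: subring_add[OF K] subring_mult[OF K])
  then show thesis using that by blast
qed

text \<open>
  \<open>c\<close> is a coefficient of \<open>g\<close>, viewed as a polynomial in \<open>v\<close> and its derivatives.  If all
  coefficients were in \<open>I\<close>, so would be \<open>g\<close>.  The induction peels off one derivative at a time, and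
  for each of them one power at a time.
\<close>

lemma nonzero_coefficient:
  assumes d: "derivation \<delta>" and K: "is_subring K" and v: "v \<notin> vs"
    and I: "dideal (dderiv \<delta>) (dpolys K (insert v vs)) I"
    and g: "g \<in> apolys K (below vs v r)" "g \<notin> I"
  shows "\<exists>c\<in>dpolys K vs. c \<notin> I \<and> (\<forall>a. deval \<delta> a c \<noteq> 0 \<longrightarrow> partial_eval \<delta> a v g \<noteq> 0)"
  using g
proof (induction r arbitrary: g)
  case 0
  have "partial_eval \<delta> a v g \<noteq> 0" if "deval \<delta> a g \<noteq> 0" for a
    using that deval_partial_eval[OF d, of "a v" a v g] by (auto simp: dsubst_def)
  with 0 show ?case by (auto simp: below_0 dpolys_eq_apolys)
next
  case (Suc r)
  note Suc_IH = Suc.IH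
  from Suc.prems obtain e where "g \<in> pol_lt (apolys K (below vs v r)) (dvar v r) e"
    by (auto simp: apolys_below_Suc[OF K] pol_def)
  then show ?case using Suc.prems(2)
  proof (induction e arbitrary: g)
    case 0
    then show ?case using dideal_0[OF I] by (simp add: pol_lt_0 is_subring_apolys K)
  next
    case (Suc e)
    then obtain c where c: "c \<in> apolys K (below vs v r)"
      "g - c * dvar v r ^ e \<in> pol_lt (apolys K (below vs v r)) (dvar v r) e"
      by (auto simp: pol_lt_Suc is_subring_apolys K)
    have lead: "partial_eval \<delta> a v g \<noteq> 0" if "partial_eval \<delta> a v c \<noteq> 0" for a
      by (rule partial_eval_lead(1)[OF d K v c(2,1) that])
    show ?case
    proof (cases "c \<in> I")
      case False
      then show ?thesis using Suc_IH[OF c(1)] lead by blast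
    next
      case True
      have "dvar v r ^ e \<in> dpolys K (insert v vs)"
        by (intro subring_power[OF is_subring_dpolys[OF K]] dpolys_dvar[OF K]) simp
      then have "c * dvar v r ^ e \<in> I" using dideal_mult'[OF I] True by blast
      then have "g - c * dvar v r ^ e \<notin> I"
        using dideal_add[OF I, of "g - c * dvar v r ^ e" "c * dvar v r ^ e"] Suc.prems(2)
        by (metis diff_add_cancel)
      from Suc.IH[OF c(2) this] obtain c' where c': "c' \<in> dpolys K vs" "c' \<notin> I"
        "\<forall>a. deval \<delta> a c' \<noteq> 0 \<longrightarrow> partial_eval \<delta> a v (g - c * dvar v r ^ e) \<noteq> 0" by blast
      have "partial_eval \<delta> a v g \<noteq> 0" if "deval \<delta> a c' \<noteq> 0" for a
      proof (cases "partial_eval \<delta> a v c = 0")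
        case True
        then show ?thesis
          using c'(3)[rule_format, OF that] by (simp add: partial_eval_diff[OF d] partial_eval_simps(5)[OF d])
      qed (rule lead)
      with c' show ?thesis by blast
    qed
  qed
qed

text \<open>
  Points over a differentially closed field \<open>K\<close> are Kolchin-dense: choose the coordinates one after
  the other, keeping a coefficient of the remaining polynomial different from \<open>0\<close>.
\<close>

theorem dpoly_nonzero_point:
  fixes q :: "('v, 'a::field_char_0) dpoly"
  assumes d: "derivation \<delta>" and m: "model_DCF0 \<delta> K" and fin: "finite vs"
    and q: "q \<in> dpolys K vs" "q \<noteq> 0"
  shows "\<exists>a. (\<forall>v. a v \<in> K) \<and> deval \<delta> a q \<noteq> 0"
  using fin q
proof (induction vs arbitrary: q rule: finite_induct)
  case empty
  have K: "is_subring K" using m delta_subfield_is_subring by (auto simp: model_DCF0_def)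
  from empty(1) obtain c where "q = dconst c" by (rule dpolys_empty[OF K])
  moreover then have "c \<noteq> 0" using empty(2) by (auto simp: dconst_def)
  ultimately show ?case using subring_0[OF K] by (auto simp: deval_dconst intro!: exI[of _ "\<lambda>_. 0"])
next
  case (insert v vs)
  have K: "diff_subring \<delta> K" "is_subring K" using m delta_subfield_diff_subring
    by (auto simp: model_DCF0_def diff_subring_def)
  have zero: "dideal (dderiv \<delta>) (dpolys K (insert v vs)) {0}"
    using subring_0[OF is_subring_dpolys[OF K(2)]] by (simp add: dideal_def dderiv_def)
  from insert.prems(1) obtain r where r: "q \<in> apolys K (below vs v r)"
    unfolding dpolys_insert_below[OF K(2)] by (elim UN_E)
  obtain c where c: "c \<in> dpolys K vs" "c \<noteq> 0"
    "\<And>a. deval \<delta> a c \<noteq> 0 \<Longrightarrow> partial_eval \<delta> a v q \<noteq> 0"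
    using nonzero_coefficient[OF d K(2) insert.hyps(2) zero r] insert.prems(2) by auto
  from insert.IH[OF c(1,2)] c(3) obtain a where a: "\<forall>v. a v \<in> K" "partial_eval \<delta> a v q \<noteq> 0" by blast
  have "partial_eval \<delta> a v q \<in> apolys K ({()} \<times> {..<r})"
    using partial_eval_below[OF d K(1) insert.hyps(2) _ r] a(1) by blast
  then have "partial_eval \<delta> a v q \<in> dpolys K UNIV"
    using apolys_mono[of "{()} \<times> {..<r}" UNIV K] by (auto simp: dpolys_eq_apolys)
  from blum_nonzero[OF m this a(2)] obtain b where "b \<in> K" "deval \<delta> (a(v := b)) q \<noteq> 0"
    by (auto simp: deval_partial_eval[OF d])
  moreover have "\<forall>u. (a(v := b)) u \<in> K" using a(1) \<open>b \<in> K\<close> by simp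
  ultimately show ?case by blast
qed

section \<open>Generic points and the Nullstellensatz\<close>

lemma dpoly_term_exists:
  assumes K: "is_subring K" and p: "p \<in> dpolys K vs"
  shows "\<exists>t. (\<forall>s. tval \<delta> s t = deval \<delta> (\<lambda>u. tval \<delta> s (\<sigma> u)) p) \<and>
    tvars t \<subseteq> (\<Union>u\<in>vs. tvars (\<sigma> u)) \<and> set_dterm t \<subseteq> K \<union> (\<Union>u\<in>vs. set_dterm (\<sigma> u))"
  using p
proof (induction rule: dpolys_induct)
  case (const c)
  then show ?case by (intro exI[of _ "TParam c"]) (auto simp: deval_dconst)
next
  case (var v k)
  have "tval \<delta> s ((TDer ^^ k) (\<sigma> v)) = (\<delta> ^^ k) (tval \<delta> s (\<sigma> v))"
    "tvars ((TDer ^^ k) (\<sigma> v)) = tvars (\<sigma> v)" "set_dterm ((TDer ^^ k) (\<sigma> v)) = set_dterm (\<sigma> v)" for s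
    by (induction k) auto
  with var show ?case by (intro exI[of _ "(TDer ^^ k) (\<sigma> v)"]) (auto simp: deval_dvar)
next
  case (add p q)
  then obtain t t' where
    "\<forall>s. tval \<delta> s t = deval \<delta> (\<lambda>u. tval \<delta> s (\<sigma> u)) p" "tvars t \<subseteq> (\<Union>u\<in>vs. tvars (\<sigma> u))"
    "set_dterm t \<subseteq> K \<union> (\<Union>u\<in>vs. set_dterm (\<sigma> u))"
    "\<forall>s. tval \<delta> s t' = deval \<delta> (\<lambda>u. tval \<delta> s (\<sigma> u)) q" "tvars t' \<subseteq> (\<Union>u\<in>vs. tvars (\<sigma> u))"
    "set_dterm t' \<subseteq> K \<union> (\<Union>u\<in>vs. set_dterm (\<sigma> u))" by (elim exE conjE)
  then show ?case by (intro exI[of _ "TAdd t t'"]) (simp add: deval_add)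
next
  case (mult p q)
  then obtain t t' where
    "\<forall>s. tval \<delta> s t = deval \<delta> (\<lambda>u. tval \<delta> s (\<sigma> u)) p" "tvars t \<subseteq> (\<Union>u\<in>vs. tvars (\<sigma> u))"
    "set_dterm t \<subseteq> K \<union> (\<Union>u\<in>vs. set_dterm (\<sigma> u))"
    "\<forall>s. tval \<delta> s t' = deval \<delta> (\<lambda>u. tval \<delta> s (\<sigma> u)) q" "tvars t' \<subseteq> (\<Union>u\<in>vs. tvars (\<sigma> u))"
    "set_dterm t' \<subseteq> K \<union> (\<Union>u\<in>vs. set_dterm (\<sigma> u))" by (elim exE conjE)
  then show ?case by (intro exI[of _ "TMul t t'"]) (simp add: deval_mult)
qed (rule K)

locale dcf_universe =
  fixes \<delta> :: "'u::field_char_0 \<Rightarrow> 'u" and F :: "'u set"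
  assumes der: "derivation \<delta>" and U_model: "model_DCF0 \<delta> UNIV" and sat: "saturated \<delta>"
    and F_model: "model_DCF0 \<delta> F" and F_small: "F \<prec> (UNIV :: 'u set)"
begin

lemma F_field: "delta_subfield \<delta> F"
  using F_model by (simp add: model_DCF0_def)

lemma F_ring: "is_subring F" and F_dring: "diff_subring \<delta> F"
  using F_field delta_subfield_is_subring delta_subfield_diff_subring by blast+

lemma F_infinite: "infinite F"
proof
  assume "finite F"
  moreover have "range (of_nat :: nat \<Rightarrow> 'u) \<subseteq> F" using subring_of_nat[OF F_ring] by blast
  ultimately have "finite (range (of_nat :: nat \<Rightarrow> 'u))" by (rule rev_finite_subset)
  then show False using range_inj_infinite[OF inj_of_nat[where 'a = 'u]] by contradiction
qed

lemma small_Un_finite: "finite B \<Longrightarrow> F \<union> B \<prec> (UNIV :: 'u set)"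
proof (induction B rule: finite_induct)
  case (insert x B)
  have "infinite (F \<union> B)" using F_infinite by simp
  then have "insert x (F \<union> B) \<approx> F \<union> B" by (rule infinite_insert_eqpoll)
  then show ?case using insert.IH eq_lesspoll_trans by fastforce
qed (use F_small in simp)

lemma dpolys_ring: "is_subring (dpolys F vs)"
  by (rule is_subring_dpolys[OF F_ring])

lemma dpolys_dring: "diff_subring (dderiv \<delta>) (dpolys F vs)"
  by (rule diff_subring_dpolys[OF der F_dring])

lemma F_rationals: "has_rationals F"
  unfolding has_rationals_def
proof
  fix n
  have "inverse (of_nat (Suc n)) \<in> F"
    using F_field subring_of_nat[OF F_ring, of "Suc n"] unfolding delta_subfield_def by blast
  moreover have "of_nat (Suc n) * inverse (of_nat (Suc n)) = (1 :: 'u)"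
    by (rule right_inverse) (simp del: of_nat_Suc)
  ultimately show "\<exists>q\<in>F. of_nat (Suc n) * q = 1" by blast
qed

lemma dpolys_rationals: "has_rationals (dpolys F (vs :: 'v set))"
  unfolding has_rationals_def
proof
  fix n
  obtain q where q: "q \<in> F" "of_nat (Suc n) * q = 1" using F_rationals unfolding has_rationals_def by blast
  have "of_nat (Suc n) = (dconst (of_nat (Suc n)) :: ('v, 'u) dpoly)"
    by (simp add: dconst_def del: of_nat_Suc)
  then have "of_nat (Suc n) * dconst q = (1 :: ('v, 'u) dpoly)"
    using q(2) by (simp only: dconst_def mult_single add_0 single_one)
  with q(1) show "\<exists>q\<in>dpolys F vs. of_nat (Suc n) * q = 1" by (intro bexI[OF _ dpolys_dconst])
qed

text \<open>
  The conditions say that \<open>b\<close> realises a set of formulas in one free variable whose parameters are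
  elements of \<open>F\<close> and the finitely many coordinates \<open>a u\<close> with \<open>u \<in> vs\<close>; adding the latter does not enlarge the
  cardinality of \<open>F\<close>.
\<close>

lemma one_variable_saturation:
  assumes fin: "finite vs" and EG: "E \<subseteq> dpolys F (insert v vs)" "G \<subseteq> dpolys F (insert v vs)"
    and sat0: "\<And>E0 G0. finite E0 \<Longrightarrow> E0 \<subseteq> E \<Longrightarrow> finite G0 \<Longrightarrow> G0 \<subseteq> G \<Longrightarrow>
      \<exists>b. (\<forall>f\<in>E0. deval \<delta> (a(v := b)) f = 0) \<and> (\<forall>g\<in>G0. deval \<delta> (a(v := b)) g \<noteq> 0)"
  shows "\<exists>b. (\<forall>f\<in>E. deval \<delta> (a(v := b)) f = 0) \<and> (\<forall>g\<in>G. deval \<delta> (a(v := b)) g \<noteq> 0)"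
proof -
  define \<sigma> where "\<sigma> u = (if u = v then TVar 0 else TParam (a u))" for u
  have \<sigma>: "(\<lambda>u. tval \<delta> s (\<sigma> u)) = a(v := s 0)" for s by (auto simp: \<sigma>_def)
  let ?A = "F \<union> a ` vs"
  have "\<exists>t. (\<forall>s. tval \<delta> s t = deval \<delta> (a(v := s 0)) p) \<and> tvars t \<subseteq> {0} \<and> set_dterm t \<subseteq> ?A"
    if p: "p \<in> dpolys F (insert v vs)" for p
  proof -
    obtain t where t: "\<forall>s. tval \<delta> s t = deval \<delta> (\<lambda>u. tval \<delta> s (\<sigma> u)) p"
      "tvars t \<subseteq> (\<Union>u\<in>insert v vs. tvars (\<sigma> u))" "set_dterm t \<subseteq> F \<union> (\<Union>u\<in>insert v vs. set_dterm (\<sigma> u))"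
      using dpoly_term_exists[OF F_ring p, of \<delta> \<sigma>] by (elim exE conjE)
    have \<sigma>_sub: "(\<Union>u\<in>insert v vs. tvars (\<sigma> u)) \<subseteq> {0}" "(\<Union>u\<in>insert v vs. set_dterm (\<sigma> u)) \<subseteq> a ` vs"
      by (auto simp: \<sigma>_def split: if_splits)
    have "tvars t \<subseteq> {0}" by (rule order_trans[OF t(2) \<sigma>_sub(1)])
    moreover have "set_dterm t \<subseteq> ?A" by (rule order_trans[OF t(3) Un_mono[OF order_refl \<sigma>_sub(2)]])
    ultimately show ?thesis using t(1) unfolding \<sigma> by (intro exI[of _ t] conjI)
  qed
  then obtain t where t: "\<And>p s. p \<in> dpolys F (insert v vs) \<Longrightarrow> tval \<delta> s (t p) = deval \<delta> (a(v := s 0)) p"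
    "\<And>p. p \<in> dpolys F (insert v vs) \<Longrightarrow> tvars (t p) \<subseteq> {0}"
    "\<And>p. p \<in> dpolys F (insert v vs) \<Longrightarrow> set_dterm (t p) \<subseteq> ?A" by metis
  let ?e = "\<lambda>f. FEq (t f) TZero" and ?n = "\<lambda>f. FNot (FEq (t f) TZero)"
  let ?\<Phi> = "?e ` E \<union> ?n ` G"
  have "\<exists>s. \<forall>\<phi>\<in>?\<Phi>. sat \<delta> s \<phi>"
  proof (rule sat[unfolded saturated_def, rule_format, of ?A ?\<Phi> 1])
    show "?A \<prec> (UNIV :: 'u set)" using fin by (intro small_Un_finite) simp
    show "fvars \<phi> \<subseteq> {..<1} \<and> set_dform \<phi> \<subseteq> ?A" if "\<phi> \<in> ?\<Phi>" for \<phi>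
      using that t(2,3) EG by fastforce
    show "\<exists>s. \<forall>\<phi>\<in>\<Phi>\<^sub>0. sat \<delta> s \<phi>" if \<Phi>0: "\<Phi>\<^sub>0 \<subseteq> ?\<Phi>" "finite \<Phi>\<^sub>0" for \<Phi>\<^sub>0
    proof -
      obtain E0 where E0: "E0 \<subseteq> E" "finite E0" "\<Phi>\<^sub>0 \<inter> ?e ` E = ?e ` E0"
        using finite_subset_image[of "\<Phi>\<^sub>0 \<inter> ?e ` E" ?e E] \<Phi>0(2) by auto
      obtain G0 where G0: "G0 \<subseteq> G" "finite G0" "\<Phi>\<^sub>0 \<inter> ?n ` G = ?n ` G0"
        using finite_subset_image[of "\<Phi>\<^sub>0 \<inter> ?n ` G" ?n G] \<Phi>0(2) by auto
      obtain b where b: "\<forall>f\<in>E0. deval \<delta> (a(v := b)) f = 0" "\<forall>g\<in>G0. deval \<delta> (a(v := b)) g \<noteq> 0"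
        using sat0[OF E0(2,1) G0(2,1)] by blast
      have "sat \<delta> (\<lambda>_. b) \<phi>" if "\<phi> \<in> \<Phi>\<^sub>0" for \<phi>
      proof -
        have "\<phi> \<in> ?e ` E0 \<union> ?n ` G0" using that \<Phi>0 E0(3) G0(3) by blast
        then show ?thesis using b t(1) EG E0(1) G0(1) by (auto simp: subset_iff)
      qed
      then show ?thesis by blast
    qed
  qed
  then obtain s where s: "\<forall>\<phi>\<in>?\<Phi>. sat \<delta> s \<phi>" ..
  have "deval \<delta> (a(v := s 0)) f = 0" if "f \<in> E" for f
    using bspec[OF s UnI1[OF imageI[OF that]]] t(1)[of f s] that EG by (simp add: subset_iff)
  moreover have "deval \<delta> (a(v := s 0)) g \<noteq> 0" if "g \<in> G" for g
    using bspec[OF s UnI2[OF imageI[OF that]]] t(1)[of g s] that EG by (simp add: subset_iff)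
  ultimately show ?thesis by blast
qed

text \<open>
  The points of the variety of \<open>I\<close> at which nothing outside \<open>I\<close> vanishes.
\<close>

definition generic_for :: "('v, 'u) dpoly set \<Rightarrow> 'v set \<Rightarrow> ('v \<Rightarrow> 'u) \<Rightarrow> bool" where
  "generic_for I vs a \<longleftrightarrow> (\<forall>g\<in>dpolys F vs. g \<in> I \<longleftrightarrow> deval \<delta> a g = 0)"

lemma prime_dideal_vanishing: "prime_dideal (dderiv \<delta>) (dpolys F vs) {g \<in> dpolys F vs. deval \<delta> a g = 0}"
proof -
  have "dderiv \<delta> p \<in> dpolys F vs" if "p \<in> dpolys F vs" for p
    using dpolys_dring[of vs] that by (simp add: diff_subring_def)
  moreover have "deval \<delta> a 0 = 0" "deval \<delta> a 1 = 1"
    using deval_dconst[of \<delta> a 0] deval_dconst[of \<delta> a 1] by (simp_all add: dconst_def)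
  ultimately show ?thesis
    by (simp add: prime_dideal_def dideal_def deval_add deval_mult deval_dderiv[OF der] derivation_0[OF der]
      subring_0[OF dpolys_ring] subring_add[OF dpolys_ring] subring_mult[OF dpolys_ring])
qed

lemma prime_dideal_restrict:
  assumes "prime_dideal (dderiv \<delta>) (dpolys F ws) I" "vs \<subseteq> ws"
  shows "prime_dideal (dderiv \<delta>) (dpolys F vs) (I \<inter> dpolys F vs)"
proof -
  note I = prime_dideal_dideal[OF assms(1)]
  have sub: "p \<in> dpolys F ws" if "p \<in> dpolys F vs" for p using dpolys_mono[OF assms(2)] that by blast
  have "dderiv \<delta> p \<in> dpolys F vs" if "p \<in> dpolys F vs" for p
    using dpolys_dring[of vs] that by (simp add: diff_subring_def)
  then have "dideal (dderiv \<delta>) (dpolys F vs) (I \<inter> dpolys F vs)"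
    unfolding dideal_def
    by (simp add: dideal_0[OF I] subring_0[OF dpolys_ring] dideal_add[OF I] subring_add[OF dpolys_ring]
        dideal_mult[OF I] sub subring_mult[OF dpolys_ring] dideal_D[OF I])
  then show ?thesis
    using prime_dideal_1[OF assms(1)] prime_dideal_mult[OF assms(1)] sub by (simp add: prime_dideal_def)
qed


text \<open>
  If some derivative of \<open>v\<close> is algebraic modulo \<open>I\<close> over the preceding ones, take the least such order
  \<open>r\<close> and a polynomial \<open>f\<close> of least degree for the derivative of order \<open>r\<close>.  Blum's axiom and saturation give \<open>b\<close> with \<open>f = 0\<close>
  at which no polynomial of order less than \<open>r\<close> outside \<open>I\<close> vanishes.  The prime ideal of the new point
  then has the same trace as \<open>I\<close> on the polynomials of order less than \<open>r\<close>, and it contains \<open>f\<close>, so that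
  it is \<open>I\<close>.  If no derivative of \<open>v\<close> is algebraic, it suffices that no polynomial outside \<open>I\<close> vanishes.
\<close>

lemma generic_extension_step:
  assumes fin: "finite vs" and v: "v \<notin> vs"
    and I: "prime_dideal (dderiv \<delta>) (dpolys F (insert v vs)) I" and a: "generic_for I vs a"
  shows "\<exists>b. generic_for I (insert v vs) (a(v := b))"
proof -
  let ?R = "dpolys F (insert v vs)" and ?A = "\<lambda>r. apolys F (below vs v r)" and ?w = "\<lambda>r. dvar v r :: ('a, 'u) dpoly"
  note iI = prime_dideal_dideal[OF I]
  have sA: "is_subring (?A r)" for r by (rule is_subring_apolys[OF F_ring])
  have RA: "?R = (\<Union>r. ?A r)" by (rule dpolys_insert_below[OF F_ring])
  have AR: "?A r \<subseteq> ?R" for r unfolding RA by blast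
  have ASuc: "?A (Suc r) = pol (?A r) (?w r)" for r by (rule apolys_below_Suc[OF F_ring])
  have wR: "?w r \<in> ?R" for r by (rule dpolys_dvar[OF F_ring]) simp
  define N where "N b = {g \<in> ?R. deval \<delta> (a(v := b)) g = 0}" for b
  have pN: "prime_dideal (dderiv \<delta>) ?R (N b)" for b unfolding N_def by (rule prime_dideal_vanishing)
  \<comment> \<open>As long as no derivative of order less than \<open>s\<close> is algebraic, polynomials of
      order less than \<open>s\<close> in \<open>I\<close> have all their coefficients with
      respect to the derivatives of \<open>v\<close> in \<open>I\<close>; they vanish whatever
      \<open>b\<close> is.\<close>
  have low: "I \<inter> ?A s \<subseteq> N b" if no: "\<And>r f J d. r < s \<Longrightarrow> \<not> leads (?A r) (?w r) I f J d" for s b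
    using no
  proof (induction s)
    case 0
    show ?case
    proof
      fix g assume g: "g \<in> I \<inter> ?A 0"
      then have "g \<in> dpolys F vs" by (simp add: below_0 dpolys_eq_apolys)
      moreover have "deval \<delta> (a(v := b)) g = deval \<delta> a g"
        using calculation v by (intro deval_cong) auto
      ultimately show "g \<in> N b"
        using a g dideal_subset[OF iI] by (auto simp: generic_for_def N_def)
    qed
  next
    case (Suc s)
    show ?case
    proof
      fix g assume g: "g \<in> I \<inter> ?A (Suc s)"
      then obtain e where "g \<in> pol_lt (?A s) (?w s) e" by (auto simp: ASuc pol_def)
      moreover have "I \<inter> ?A s \<subseteq> N b" using Suc.IH Suc.prems by simp
      moreover have "g \<in> I" using g by simp
      ultimately show "g \<in> N b"
        using reduced_transfer[OF sA AR wR dpolys_ring iI prime_dideal_dideal[OF pN]] Suc.prems by blast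
    qed
  qed
  \<comment> \<open>Finitely many conditions \<open>g \<noteq> 0\<close> amount to one, for the product of the
      \<open>g\<close>.\<close>
  have prodI: "prod (\<lambda>g. g) G0 \<in> ?A r \<and> prod (\<lambda>g. g) G0 \<notin> I"
    if "finite G0" "G0 \<subseteq> ?A r - I" for G0 r
    using that prime_dideal_prod[OF dpolys_ring I that(1), of "\<lambda>g. g"] AR
      subring_prod[OF sA, of G0 "\<lambda>g. g" r] by blast
  have prod0: "\<forall>g\<in>G0. deval \<delta> a' g \<noteq> 0" if "finite G0" "deval \<delta> a' (prod (\<lambda>g. g) G0) \<noteq> 0" for G0 a'
    using that by (simp add: deval_prod)
  have pe: "partial_eval \<delta> a v g \<noteq> 0" if "g \<in> ?A r" "g \<notin> I" for g r
    using nonzero_coefficient[OF der F_ring v iI that] a by (auto simp: generic_for_def)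
  have occ: "k < r" if "g \<in> ?A r" "k \<in> occurring_orders (partial_eval \<delta> a v g)" for g r k
  proof -
    have "diff_subring \<delta> (UNIV :: 'u set)" by (simp add: diff_subring_def is_subring_UNIV)
    moreover have "g \<in> apolys UNIV (below vs v r)" using that(1) by (auto simp: apolys_def)
    ultimately have "partial_eval \<delta> a v g \<in> apolys UNIV ({()} \<times> {..<r})"
      using partial_eval_below[OF der _ v, of UNIV a g r] by simp
    then show ?thesis using that(2) occurring_orders_apolys by blast
  qed
  have U: "p \<in> dpolys UNIV UNIV" for p :: "(unit, 'u) dpoly" by (simp add: dpolys_def)
  show ?thesis
  proof (cases "\<exists>r d f J. leads (?A r) (?w r) I f J d")
    case True
    define r where "r = (LEAST r. \<exists>d f J. leads (?A r) (?w r) I f J d)"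
    have ex: "\<exists>d f J. leads (?A r) (?w r) I f J d" unfolding r_def by (rule LeastI_ex[OF True])
    have minr: "\<not> leads (?A r') (?w r') I f J d" if "r' < r" for r' f J d
      using not_less_Least[OF that[unfolded r_def]] by blast
    define d where "d = (LEAST d. \<exists>f J. leads (?A r) (?w r) I f J d)"
    have "\<exists>f J. leads (?A r) (?w r) I f J d" unfolding d_def by (rule LeastI_ex[OF ex])
    then obtain f J where f: "leads (?A r) (?w r) I f J d" by blast
    have mind: "\<not> leads (?A r) (?w r) I f' J' e" if "e < d" for f' J' e
      using not_less_Least[OF that[unfolded d_def]] by blast
    have fd: "f \<in> I" "J \<in> ?A r" "J \<notin> I" "f - J * ?w r ^ d \<in> pol_lt (?A r) (?w r) d"
      using f by (auto simp: leads_def)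
    have "d \<noteq> 0"
    proof
      assume "d = 0"
      then have "f = J" using fd(4) by (simp add: pol_lt_0[OF sA])
      then show False using fd by simp
    qed
    then have rocc: "r \<in> occurring_orders (partial_eval \<delta> a v f)"
      using partial_eval_lead(2)[OF der F_ring v fd(4,2) pe[OF fd(2,3)]] by blast
    have "\<exists>b. (\<forall>f\<in>{f}. deval \<delta> (a(v := b)) f = 0) \<and> (\<forall>g\<in>?A r - I. deval \<delta> (a(v := b)) g \<noteq> 0)"
    proof (rule one_variable_saturation[OF fin])
      show "{f} \<subseteq> ?R" using dideal_subset[OF iI fd(1)] by simp
      show "?A r - I \<subseteq> ?R" using AR by blast
      fix E0 G0 assume E0: "E0 \<subseteq> {f}" and G0: "finite G0" "G0 \<subseteq> ?A r - I"
      let ?g = "prod (\<lambda>g. g) G0"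
      have "\<forall>k\<in>occurring_orders (partial_eval \<delta> a v ?g). k < r" "partial_eval \<delta> a v ?g \<noteq> 0"
        using occ pe prodI[OF G0] by blast+
      then obtain b where "deval \<delta> (a(v := b)) f = 0" "deval \<delta> (a(v := b)) ?g \<noteq> 0"
        using model_DCF0_D[OF U_model U U, of "partial_eval \<delta> a v ?g" "partial_eval \<delta> a v f"] rocc
        by (auto simp: deval_partial_eval[OF der])
      then show "\<exists>b. (\<forall>f\<in>E0. deval \<delta> (a(v := b)) f = 0) \<and> (\<forall>g\<in>G0. deval \<delta> (a(v := b)) g \<noteq> 0)"
        using E0 prod0[OF G0(1)] by blast
    qed
    then obtain b where b: "deval \<delta> (a(v := b)) f = 0" "\<And>g. g \<in> ?A r \<Longrightarrow> g \<notin> I \<Longrightarrow> deval \<delta> (a(v := b)) g \<noteq> 0"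
      by auto
    have fN: "f \<in> N b" using b(1) dideal_subset[OF iI fd(1)] by (simp add: N_def)
    have "I \<inter> ?A r = N b \<inter> ?A r" using low[OF minr, of r b] b(2) by (auto simp: N_def)
    then have "I = N b"
      using prime_dideal_determined[OF derivation_dderiv[OF der] dpolys_dring dpolys_rationals sA ASuc dderiv_below[OF der F_dring]
          dderiv_dvar[OF der] RA I pN _ f mind fN] by blast
    then show ?thesis by (auto simp: generic_for_def N_def)
  next
    case False
    have "\<exists>b. (\<forall>f\<in>{}. deval \<delta> (a(v := b)) f = 0) \<and> (\<forall>g\<in>?R - I. deval \<delta> (a(v := b)) g \<noteq> 0)"
    proof (rule one_variable_saturation[OF fin])
      fix E0 G0 :: "('a, 'u) dpoly set" assume E0: "E0 \<subseteq> {}" and G0: "finite G0" "G0 \<subseteq> ?R - I"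
      let ?g = "prod (\<lambda>g. g) G0"
      have g: "?g \<in> ?R" "?g \<notin> I"
        using subring_prod[OF dpolys_ring, of G0 "\<lambda>g. g"] prime_dideal_prod[OF dpolys_ring I G0(1), of "\<lambda>g. g"] G0(2)
        by blast+
      then obtain r where r: "?g \<in> ?A r" unfolding RA by (elim UN_E)
      have "\<forall>k\<in>occurring_orders (partial_eval \<delta> a v ?g). k < r" "partial_eval \<delta> a v ?g \<noteq> 0"
        using occ pe r g by blast+
      then have "\<exists>b. deval \<delta> (\<lambda>_. b) (partial_eval \<delta> a v ?g) \<noteq> 0"
        using blum_nonzero[OF U_model U] by blast
      then obtain b where "deval \<delta> (a(v := b)) ?g \<noteq> 0" by (auto simp: deval_partial_eval[OF der])
      then show "\<exists>b. (\<forall>f\<in>E0. deval \<delta> (a(v := b)) f = 0) \<and> (\<forall>g\<in>G0. deval \<delta> (a(v := b)) g \<noteq> 0)"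
        using E0 prod0[OF G0(1)] by blast
    qed auto
    then obtain b where b: "\<And>g. g \<in> ?R \<Longrightarrow> g \<notin> I \<Longrightarrow> deval \<delta> (a(v := b)) g \<noteq> 0" by auto
    have "deval \<delta> (a(v := b)) g = 0" if g: "g \<in> I" for g
    proof -
      have "g \<in> ?R" using dideal_subset[OF iI g] .
      then obtain s where "g \<in> ?A s" unfolding RA by (elim UN_E)
      then have "g \<in> N b" using low[of s b] False g by blast
      then show ?thesis by (simp add: N_def)
    qed
    with b show ?thesis by (auto simp: generic_for_def)
  qed
qed

theorem generic_extension:
  assumes us: "finite us" and vs: "finite vs"
    and I: "prime_dideal (dderiv \<delta>) (dpolys F (vs \<union> us)) I" and a: "generic_for I vs a"
  shows "\<exists>a'. (\<forall>v\<in>vs. a' v = a v) \<and> generic_for I (vs \<union> us) a'"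
  using us I a
proof (induction us arbitrary: I rule: finite_induct)
  case empty
  then show ?case by auto
next
  case (insert u us)
  let ?I = "I \<inter> dpolys F (vs \<union> us)"
  have restr: "generic_for ?I ws b \<longleftrightarrow> generic_for I ws b" if "ws \<subseteq> vs \<union> us" for ws b
    using dpolys_mono[OF that, of F] by (auto simp: generic_for_def)
  have "prime_dideal (dderiv \<delta>) (dpolys F (vs \<union> us)) ?I"
    by (rule prime_dideal_restrict[OF insert.prems(1)]) blast
  moreover have "generic_for ?I vs a" using insert.prems(2) by (simp add: restr)
  ultimately obtain a' where a': "\<forall>v\<in>vs. a' v = a v" "generic_for I (vs \<union> us) a'"
    using insert.IH[of ?I] by (auto simp: restr)
  show ?case
  proof (cases "u \<in> vs \<union> us")
    case True
    then have "vs \<union> insert u us = vs \<union> us" by blast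
    then show ?thesis using a' by auto
  next
    case False
    have eq: "vs \<union> insert u us = insert u (vs \<union> us)" by blast
    obtain b where b: "generic_for I (insert u (vs \<union> us)) (a'(u := b))"
      using generic_extension_step[OF _ False insert.prems(1)[unfolded eq] a'(2)] vs insert.hyps(1) by auto
    have "\<forall>v\<in>vs. (a'(u := b)) v = a v" using a'(1) False by auto
    then show ?thesis using b eq by metis
  qed
qed

corollary generic_point:
  assumes "finite vs" and I: "prime_dideal (dderiv \<delta>) (dpolys F vs) I"
  shows "\<exists>a. generic_for I vs a"
proof -
  have "generic_for I {} a" for a
    unfolding generic_for_def
  proof
    fix g :: "('a, 'u) dpoly" assume "g \<in> dpolys F {}"
    then obtain c where c: "c \<in> F" "g = dconst c" by (rule dpolys_empty[OF F_ring])
    have "c = 0" if "g \<in> I"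
    proof (rule ccontr)
      assume "c \<noteq> 0"
      have "dconst (inverse c) * g \<in> I"
        using c(1) F_field by (intro dideal_mult[OF prime_dideal_dideal[OF I] dpolys_dconst that])
          (simp add: delta_subfield_def)
      moreover have "dconst (inverse c) * g = 1"
        using \<open>c \<noteq> 0\<close> by (simp add: c(2) dconst_def mult_single)
      ultimately show False using prime_dideal_1[OF I] by simp
    qed
    then show "g \<in> I \<longleftrightarrow> deval \<delta> a g = 0"
      using dideal_0[OF prime_dideal_dideal[OF I]]
      unfolding c(2) deval_dconst by (auto simp: dconst_def)
  qed
  from generic_extension[OF assms(1) finite.emptyI _ this] I show ?thesis by auto
qed

text \<open>
  If no power of \<open>f\<close> lies in the differential ideal, there is a prime differential ideal that contains
  \<open>S\<close> and no power of \<open>f\<close>; its generic point is a zero of \<open>S\<close> but not of \<open>f\<close>.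
\<close>

theorem differential_Nullstellensatz:
  assumes "finite vs" and S: "S \<subseteq> dpolys F vs" and f: "f \<in> dpolys F vs"
    and van: "\<And>a. (\<And>p. p \<in> S \<Longrightarrow> deval \<delta> a p = 0) \<Longrightarrow> deval \<delta> a f = 0"
  shows "\<exists>e. f ^ e \<in> diff_ideal \<delta> (dpolys F vs) S"
proof (rule ccontr)
  assume n: "\<nexists>e. f ^ e \<in> diff_ideal \<delta> (dpolys F vs) S"
  note J = dideal_diff_ideal[OF der dpolys_dring S]
  obtain I where I: "prime_dideal (dderiv \<delta>) (dpolys F vs) I" "diff_ideal \<delta> (dpolys F vs) S \<subseteq> I"
    "I \<inter> range (\<lambda>e. f ^ e) = {}"
  proof (rule prime_dideal_exists[OF derivation_dderiv[OF der] dpolys_dring dpolys_rationals J(1), of "range (\<lambda>e. f ^ e)"])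
    show "range (\<lambda>e. f ^ e) \<subseteq> dpolys F vs" using subring_power[OF dpolys_ring f] by blast
    show "1 \<in> range (\<lambda>e. f ^ e)" by (auto intro: image_eqI[of _ _ 0])
    show "p * q \<in> range (\<lambda>e. f ^ e)" if "p \<in> range (\<lambda>e. f ^ e)" "q \<in> range (\<lambda>e. f ^ e)" for p q
      using that by (auto simp flip: power_add)
    show "diff_ideal \<delta> (dpolys F vs) S \<inter> range (\<lambda>e. f ^ e) = {}" using n by auto
  qed
  from generic_point[OF assms(1) I(1)] obtain a where a: "generic_for I vs a" ..
  have "deval \<delta> a p = 0" if "p \<in> S" for p
    using that a J(2) I(2) S by (auto simp: generic_for_def)
  then have "deval \<delta> a f = 0" by (rule van)
  then have "f \<in> I" using a f by (simp add: generic_for_def)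
  moreover have "f \<in> range (\<lambda>e. f ^ e)" by (rule image_eqI[of _ _ 1]) simp_all
  ultimately show False using I(3) by blast
qed

end

section \<open>Homogeneity\<close>

text \<open>
  Homogeneity as a property of values, for all scalars of the universal field.
\<close>

definition hom_deg :: "('a::field \<Rightarrow> 'a) \<Rightarrow> 'v set \<Rightarrow> ('v, 'a) dpoly \<Rightarrow> nat \<Rightarrow> bool" where
  "hom_deg \<delta> xs p d \<longleftrightarrow>
     (\<forall>c a. c \<noteq> 0 \<longrightarrow> deval \<delta> (\<lambda>v. if v \<in> xs then c * a v else a v) p = c ^ d * deval \<delta> a p)"

lemma hom_degD:
  "hom_deg \<delta> xs p d \<Longrightarrow> c \<noteq> 0 \<Longrightarrow> deval \<delta> (\<lambda>v. if v \<in> xs then c * a v else a v) p = c ^ d * deval \<delta> a p"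
  by (simp add: hom_deg_def)

lemma hom_deg_disjoint:
  assumes p: "p \<in> dpolys K vs" and "vs \<inter> xs = {}"
  shows "hom_deg \<delta> xs p 0"
proof -
  have "deval \<delta> (\<lambda>v. if v \<in> xs then c * a v else a v) p = deval \<delta> a p" for c a
    using assms(2) by (intro deval_cong[OF p]) auto
  then show ?thesis by (simp add: hom_deg_def)
qed

context dcf_universe begin

text \<open>
  Formal homogeneity involves only scalars in the ground field \<open>F\<close>.  As \<open>F\<close> is differentially closed,
  its points are Kolchin-dense, and the identity extends to all scalars; conversely an identity between
  the values at all points is a formal one.
\<close>

theorem delta_homogeneous_iff:
  assumes "finite vs" and p: "p \<in> dpolys F vs"
  shows "delta_homogeneous \<delta> F xs p \<longleftrightarrow> (\<exists>d. hom_deg \<delta> xs p d)"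
proof
  assume "delta_homogeneous \<delta> F xs p"
  then obtain d where d: "\<And>c. c \<in> F \<Longrightarrow> c \<noteq> 0 \<Longrightarrow>
      dcomp \<delta> (\<lambda>v. if v \<in> xs then dconst c * dvar v 0 else dvar v 0) p = dconst (c ^ d) * p"
    unfolding delta_homogeneous_def by blast
  have ev: "deval \<delta> (\<lambda>v. if v \<in> xs then c * a v else a v) p = c ^ d * deval \<delta> a p"
    if "c \<in> F" "c \<noteq> 0" for c a
    using arg_cong[OF d[OF that], of "deval \<delta> a"]
    by (simp add: deval_dcomp[OF der] if_distrib[of "deval \<delta> a"] deval_mult deval_dconst deval_dvar cong: if_cong)
  \<comment> \<open>\<open>None\<close> is an indeterminate for the scalar. The factor in front makes
      \<open>q\<close> vanish also at points with scalar \<open>0\<close>.\<close>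
  define q where "q = dvar None 0 * (dcomp \<delta> (\<lambda>v. if v \<in> xs then dvar None 0 * dvar (Some v) 0 else dvar (Some v) 0) p
      - dvar None 0 ^ d * dcomp \<delta> (\<lambda>v. dvar (Some v) 0) p :: ('a option, 'u) dpoly)"
  have q_eval: "deval \<delta> a q = a None * (deval \<delta> (\<lambda>v. if v \<in> xs then a None * a (Some v) else a (Some v)) p
      - a None ^ d * deval \<delta> (\<lambda>v. a (Some v)) p)" for a
    by (simp add: q_def deval_dcomp[OF der] if_distrib[of "deval \<delta> a"] deval_mult deval_diff deval_power deval_dvar cong: if_cong)
  let ?ws = "insert None (Some ` vs)"
  have vars: "dvar u 0 \<in> dpolys F ?ws" if "u \<in> ?ws" for u
    by (rule dpolys_dvar[OF F_ring that])
  have "q \<in> dpolys F ?ws"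
    unfolding q_def
    by (intro subring_mult[OF dpolys_ring] subring_diff[OF dpolys_ring] subring_power[OF dpolys_ring]
        dcomp_dpolys[OF der F_dring p]) (auto intro: vars subring_mult[OF dpolys_ring])
  have "q = 0"
  proof (rule ccontr)
    assume "q \<noteq> 0"
    then obtain a where a: "\<forall>v. a v \<in> F" "deval \<delta> a q \<noteq> 0"
      using dpoly_nonzero_point[OF der F_model _ \<open>q \<in> dpolys F ?ws\<close>] assms(1) by auto
    then have "a None \<noteq> 0" unfolding q_eval by auto
    then show False using a ev[of "a None" "\<lambda>v. a (Some v)"] by (simp add: q_eval)
  qed
  then have q0: "deval \<delta> a q = 0" for a by (simp add: dsubst_def)
  have "deval \<delta> (\<lambda>v. if v \<in> xs then c * a v else a v) p = c ^ d * deval \<delta> a p" if "c \<noteq> 0" for c a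
    using q0[of "\<lambda>u. case u of None \<Rightarrow> c | Some v \<Rightarrow> a v"] that unfolding q_eval by (simp cong: if_cong)
  then show "\<exists>d. hom_deg \<delta> xs p d" unfolding hom_deg_def by blast
next
  assume "\<exists>d. hom_deg \<delta> xs p d"
  then obtain d where d: "hom_deg \<delta> xs p d" ..
  have "dcomp \<delta> (\<lambda>v. if v \<in> xs then dconst c * dvar v 0 else dvar v 0) p = dconst (c ^ d) * p"
    if c: "c \<in> F" "c \<noteq> 0" for c
  proof -
    let ?q = "dcomp \<delta> (\<lambda>v. if v \<in> xs then dconst c * dvar v 0 else dvar v 0) p - dconst (c ^ d) * p"
    have "?q \<in> dpolys F vs"
      using c(1) by (intro subring_mult[OF dpolys_ring] subring_diff[OF dpolys_ring] dpolys_dconst p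
        dcomp_dpolys[OF der F_dring p] subring_power[OF F_ring])
        (auto intro: dpolys_dvar[OF F_ring] dpolys_dconst subring_mult[OF dpolys_ring])
    moreover have "deval \<delta> a ?q = 0" for a
      using hom_degD[OF d c(2), of a]
      by (simp add: deval_dcomp[OF der] if_distrib[of "deval \<delta> a"] deval_mult deval_diff deval_dconst deval_dvar cong: if_cong)
    ultimately have "?q = 0" using dpoly_nonzero_point[OF der F_model assms(1)] by blast
    then show ?thesis by simp
  qed
  then show "delta_homogeneous \<delta> F xs p" unfolding delta_homogeneous_def by blast
qed

text \<open>
  The quotient rule, in the form needed for homogenization.
\<close>

lemma clear_denominators:
  assumes p: "p \<in> dpolys F vs" and y: "y \<in> vs" "y \<in> ys"
  shows "\<exists>h\<in>dpolys F vs. \<exists>N. \<forall>a. a y \<noteq> 0 \<longrightarrow>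
    deval \<delta> a h = a y ^ N * deval \<delta> (\<lambda>v. if v \<in> ys then a v / a y else a v) p"
  using p
proof (induction rule: dpolys_induct)
  case (const c)
  then show ?case by (intro bexI[of _ "dconst c"] exI[of _ 0]) (auto simp: deval_dconst dpolys_dconst)
next
  case (var v k)
  show ?case
  proof (cases "v \<in> ys")
    case False
    then show ?thesis using var dpolys_dvar[OF F_ring]
      by (intro bexI[of _ "dvar v k"] exI[of _ 0]) (auto simp: deval_dvar)
  next
    case True
    have "\<exists>h\<in>dpolys F vs. \<forall>a. a y \<noteq> 0 \<longrightarrow> (\<delta> ^^ k) (a v / a y) * a y ^ Suc k = deval \<delta> a h"
    proof (induction k)
      case 0
      then show ?case using dpolys_dvar[OF F_ring var]
        by (intro bexI[of _ "dvar v 0"]) (auto simp: deval_dvar)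
    next
      case (Suc k)
      then obtain h where h: "h \<in> dpolys F vs"
        "\<And>a. a y \<noteq> 0 \<Longrightarrow> (\<delta> ^^ k) (a v / a y) * a y ^ Suc k = deval \<delta> a h" by blast
      let ?h = "dvar y 0 * dderiv \<delta> h - of_nat (Suc k) * dvar y 1 * h"
      have "dderiv \<delta> h \<in> dpolys F vs" using dpolys_dring h(1) by (auto simp: diff_subring_def)
      then have hF: "?h \<in> dpolys F vs"
        by (intro subring_mult[OF dpolys_ring] subring_diff[OF dpolys_ring] dpolys_dvar[OF F_ring y(1)] h
            subring_of_nat[OF dpolys_ring])
      have "(\<delta> ^^ Suc k) (a v / a y) * a y ^ Suc (Suc k) = deval \<delta> a ?h" if "a y \<noteq> 0" for a
      proof -
        let ?z = "(\<delta> ^^ k) (a v / a y)"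
        have "deval \<delta> a (dderiv \<delta> h) = \<delta> (?z * a y ^ Suc k)"
          by (simp only: deval_dderiv[OF der] h(2)[of a, OF that])
        also have "\<dots> = \<delta> ?z * a y ^ Suc k + ?z * (of_nat (Suc k) * a y ^ k * \<delta> (a y))"
          by (simp only: derivation_mult[OF der] derivation_power_Suc[OF der])
        finally have e: "deval \<delta> a (dderiv \<delta> h) = \<dots>" .
        have "deval \<delta> a ?h = a y * deval \<delta> a (dderiv \<delta> h) - of_nat (Suc k) * \<delta> (a y) * deval \<delta> a h"
          by (simp only: deval_diff deval_mult deval_of_nat deval_dvar funpow_0 One_nat_def funpow.simps(2) o_apply)
        then show ?thesis by (simp add: e algebra_simps flip: h(2)[of a, OF that])
      qed
      with hF show ?case by blast
    qed
    then obtain h where "h \<in> dpolys F vs"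
        "\<And>a. a y \<noteq> 0 \<Longrightarrow> (\<delta> ^^ k) (a v / a y) * a y ^ Suc k = deval \<delta> a h" by blast
    then show ?thesis using True
      by (intro bexI[of _ h] exI[of _ "Suc k"]) (auto simp: deval_dvar mult.commute simp del: power_Suc)
  qed
next
  case (add p q)
  then obtain h h' N N' where *: "h \<in> dpolys F vs" "h' \<in> dpolys F vs"
    "\<forall>a. a y \<noteq> 0 \<longrightarrow> deval \<delta> a h = a y ^ N * deval \<delta> (\<lambda>v. if v \<in> ys then a v / a y else a v) p"
    "\<forall>a. a y \<noteq> 0 \<longrightarrow> deval \<delta> a h' = a y ^ N' * deval \<delta> (\<lambda>v. if v \<in> ys then a v / a y else a v) q"
    by (elim bexE exE)
  show ?case
    using * by (intro bexI[of _ "dvar y 0 ^ N' * h + dvar y 0 ^ N * h'"] exI[of _ "N + N'"])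
     (auto simp: deval_add deval_mult deval_power deval_dvar power_add algebra_simps
       intro!: subring_add[OF dpolys_ring] subring_mult[OF dpolys_ring] subring_power[OF dpolys_ring] dpolys_dvar[OF F_ring y(1)])
next
  case (mult p q)
  then obtain h h' N N' where *: "h \<in> dpolys F vs" "h' \<in> dpolys F vs"
    "\<forall>a. a y \<noteq> 0 \<longrightarrow> deval \<delta> a h = a y ^ N * deval \<delta> (\<lambda>v. if v \<in> ys then a v / a y else a v) p"
    "\<forall>a. a y \<noteq> 0 \<longrightarrow> deval \<delta> a h' = a y ^ N' * deval \<delta> (\<lambda>v. if v \<in> ys then a v / a y else a v) q"
    by (elim bexE exE)
  show ?case
    using * by (intro bexI[of _ "h * h'"] exI[of _ "N + N'"])
     (auto simp: deval_mult power_add algebra_simps intro!: subring_mult[OF dpolys_ring])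
qed (rule F_ring)

text \<open>
  \<open>h\<close> is the numerator of \<open>p(x / y)\<close> multiplied by one more factor \<open>y\<close>.  The additional factor makes \<open>h\<close>
  vanish where \<open>y\<close> does, so that the homogeneity of \<open>h\<close> can be checked on values.
\<close>

theorem homogenization:
  assumes p: "p \<in> dpolys F vs" and y: "y \<in> vs" "y \<in> ys"
  obtains h N where "h \<in> dpolys F vs" "hom_deg \<delta> ys h N"
    "\<And>a. a y = 0 \<Longrightarrow> deval \<delta> a h = 0"
    "\<And>a. a y \<noteq> 0 \<Longrightarrow> deval \<delta> a h = a y ^ N * deval \<delta> (\<lambda>v. if v \<in> ys then a v / a y else a v) p"
    "\<And>xs d. xs \<inter> ys = {} \<Longrightarrow> hom_deg \<delta> xs p d \<Longrightarrow> hom_deg \<delta> xs h d"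
proof -
  obtain h' N' where h': "h' \<in> dpolys F vs"
    "\<forall>a. a y \<noteq> 0 \<longrightarrow> deval \<delta> a h' = a y ^ N' * deval \<delta> (\<lambda>v. if v \<in> ys then a v / a y else a v) p"
    using clear_denominators[OF assms] by (elim bexE exE)
  define h where "h = dvar y 0 * h'"
  have h: "h \<in> dpolys F vs"
    unfolding h_def by (intro subring_mult[OF dpolys_ring] dpolys_dvar[OF F_ring y(1)] h'(1))
  have h0: "deval \<delta> a h = 0" if "a y = 0" for a
    using that by (simp add: h_def deval_mult deval_dvar)
  have h1: "deval \<delta> a h = a y ^ Suc N' * deval \<delta> (\<lambda>v. if v \<in> ys then a v / a y else a v) p" if "a y \<noteq> 0" for a
    using that h'(2) by (simp add: h_def deval_mult deval_dvar)
  have "hom_deg \<delta> ys h (Suc N')"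
    unfolding hom_deg_def
  proof (intro allI impI)
    fix c :: 'u and a assume c: "c \<noteq> 0"
    show "deval \<delta> (\<lambda>v. if v \<in> ys then c * a v else a v) h = c ^ Suc N' * deval \<delta> a h"
    proof (cases "a y = 0")
      case True
      then show ?thesis by (simp add: h0)
    next
      case False
      have "(\<lambda>v. if v \<in> ys then (if v \<in> ys then c * a v else a v) / (c * a y) else if v \<in> ys then c * a v else a v)
          = (\<lambda>v. if v \<in> ys then a v / a y else a v)" using c by auto
      then show ?thesis
        using h1[of "\<lambda>v. if v \<in> ys then c * a v else a v"] h1[of a] c False y(2)
        by (simp add: power_mult_distrib)
    qed
  qed
  moreover have "hom_deg \<delta> xs h d" if xs: "xs \<inter> ys = {}" "hom_deg \<delta> xs p d" for xs d
    unfolding hom_deg_def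
  proof (intro allI impI)
    fix c :: 'u and a assume c: "c \<noteq> 0"
    have yx: "y \<notin> xs" using xs y(2) by blast
    show "deval \<delta> (\<lambda>v. if v \<in> xs then c * a v else a v) h = c ^ d * deval \<delta> a h"
    proof (cases "a y = 0")
      case True
      then show ?thesis using yx by (simp add: h0)
    next
      case False
      let ?b = "\<lambda>v. if v \<in> ys then a v / a y else a v"
      have "(\<lambda>v. if v \<in> ys then (if v \<in> xs then c * a v else a v) / a y else if v \<in> xs then c * a v else a v)
          = (\<lambda>v. if v \<in> xs then c * ?b v else ?b v)" using xs(1) by auto
      then show ?thesis
        using h1[of "\<lambda>v. if v \<in> xs then c * a v else a v"] h1[of a] False yx hom_degD[OF xs(2) c, of ?b]
        by simp
    qed
  qed
  ultimately show thesis using that h h0 h1 by blast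
qed

end

section \<open>Projective zero sets\<close>

text \<open>
  The point with homogeneous coordinates \<open>a\<close>.
\<close>

definition pclass :: "nat \<Rightarrow> (nat \<Rightarrow> 'u::field) \<Rightarrow> (nat \<Rightarrow> 'u) set" where
  "pclass n a = proportional n `` {a}"

lemma mem_pclass_iff:
  assumes "a \<in> hom_coords n"
  shows "b \<in> pclass n a \<longleftrightarrow> (\<exists>c. c \<noteq> 0 \<and> b = (\<lambda>i. c * a i))"
  using assms by (auto simp: pclass_def proportional_def hom_coords_def)

lemma pclass_in_proj_space: "a \<in> hom_coords n \<Longrightarrow> pclass n a \<in> proj_space n"
  unfolding proj_space_def pclass_def by (rule quotientI)

lemma pclass_self: "a \<in> hom_coords n \<Longrightarrow> a \<in> pclass n a"
  by (auto simp: mem_pclass_iff intro!: exI[of _ 1])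

lemma proj_spaceE:
  assumes "A \<in> proj_space n"
  obtains a where "a \<in> hom_coords n" "A = pclass n a"
  using assms unfolding proj_space_def pclass_def by (auto elim: quotientE)

lemma pclass_scale:
  assumes a: "a \<in> hom_coords n" and "c \<noteq> 0"
  shows "(\<lambda>i. c * a i) \<in> hom_coords n" "pclass n (\<lambda>i. c * a i) = pclass n a"
proof -
  show ca: "(\<lambda>i. c * a i) \<in> hom_coords n" using assms by (auto simp: hom_coords_def)
  show "pclass n (\<lambda>i. c * a i) = pclass n a"
  proof (rule set_eqI)
    fix b
    have "(\<exists>d. d \<noteq> 0 \<and> b = (\<lambda>i. d * (c * a i))) \<longleftrightarrow> (\<exists>d. d \<noteq> 0 \<and> b = (\<lambda>i. d * a i))"
    proof
      assume "\<exists>d. d \<noteq> 0 \<and> b = (\<lambda>i. d * (c * a i))"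
      then show "\<exists>d. d \<noteq> 0 \<and> b = (\<lambda>i. d * a i)"
        using assms(2) by (metis (no_types, lifting) mult.assoc no_zero_divisors ext)
    next
      assume "\<exists>d. d \<noteq> 0 \<and> b = (\<lambda>i. d * a i)"
      then obtain d where "d \<noteq> 0" "b = (\<lambda>i. d * a i)" by blast
      then show "\<exists>d. d \<noteq> 0 \<and> b = (\<lambda>i. d * (c * a i))"
        using assms(2) by (intro exI[of _ "d / c"]) (auto simp: field_simps)
    qed
    then show "b \<in> pclass n (\<lambda>i. c * a i) \<longleftrightarrow> b \<in> pclass n a"
      by (simp add: mem_pclass_iff[OF ca] mem_pclass_iff[OF a])
  qed
qed

lemma deval_scale_x:
  assumes p: "p \<in> dpolys K (XV ` {0..n} \<union> YV ` Y)" and h: "hom_deg \<delta> (XV ` {0..n}) p d" and "c \<noteq> 0"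
  shows "deval \<delta> (case_coord (\<lambda>i. c * a i) b) p = c ^ d * deval \<delta> (case_coord a b) p"
proof -
  have "deval \<delta> (case_coord (\<lambda>i. c * a i) b) p =
      deval \<delta> (\<lambda>v. if v \<in> XV ` {0..n} then c * case_coord a b v else case_coord a b v) p"
    by (rule deval_cong[OF p]) auto
  then show ?thesis using hom_degD[OF h assms(3)] by simp
qed

lemma deval_scale_y:
  assumes p: "p \<in> dpolys K (XV ` X \<union> YV ` {0..l})" and h: "hom_deg \<delta> (YV ` {0..l}) p d" and "c \<noteq> 0"
  shows "deval \<delta> (case_coord a (\<lambda>i. c * b i)) p = c ^ d * deval \<delta> (case_coord a b) p"
proof -
  have "deval \<delta> (case_coord a (\<lambda>i. c * b i)) p =
      deval \<delta> (\<lambda>v. if v \<in> YV ` {0..l} then c * case_coord a b v else case_coord a b v) p"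
    by (rule deval_cong[OF p]) auto
  then show ?thesis using hom_degD[OF h assms(3)] by simp
qed

context dcf_universe begin

lemma proj_equationsD:
  assumes "p \<in> proj_equations \<delta> F n"
  shows "p \<in> dpolys F (XV ` {0..n})" "\<exists>d. hom_deg \<delta> (XV ` {0..n}) p d"
  using assms delta_homogeneous_iff[of "XV ` {0..n}" p "XV ` {0..n}"] by (auto simp: proj_equations_def)

lemma proj_equations_deval:
  assumes "p \<in> proj_equations \<delta> F n"
  shows "deval \<delta> (case_coord a b) p = deval \<delta> (case_coord a (\<lambda>_. 0)) p"
  by (rule deval_cong[OF proj_equationsD(1)[OF assms]]) auto

lemma proj_equations_scale:
  assumes "p \<in> proj_equations \<delta> F n" "c \<noteq> 0"
  shows "deval \<delta> (case_coord (\<lambda>i. c * a i) b) p = 0 \<longleftrightarrow> deval \<delta> (case_coord a b) p = 0"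
proof -
  obtain d where "hom_deg \<delta> (XV ` {0..n}) p d" using proj_equationsD(2)[OF assms(1)] by blast
  then show ?thesis
    using deval_scale_x[of p F n "{}" \<delta> d c a b] proj_equationsD(1)[OF assms(1)] assms(2) by simp
qed

lemma mem_proj_zeros_iff:
  assumes S: "S \<subseteq> proj_equations \<delta> F n" and a: "a \<in> hom_coords n"
  shows "pclass n a \<in> proj_zeros \<delta> n S \<longleftrightarrow> (\<forall>p\<in>S. deval \<delta> (case_coord a (\<lambda>_. 0)) p = 0)"
proof
  assume "pclass n a \<in> proj_zeros \<delta> n S"
  then show "\<forall>p\<in>S. deval \<delta> (case_coord a (\<lambda>_. 0)) p = 0"
    using pclass_self[OF a] by (auto simp: proj_zeros_def)
next
  assume z: "\<forall>p\<in>S. deval \<delta> (case_coord a (\<lambda>_. 0)) p = 0"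
  have "deval \<delta> (case_coord a' (\<lambda>_. 0)) p = 0" if a': "a' \<in> pclass n a" and p: "p \<in> S" for a' p
  proof -
    obtain c where "c \<noteq> 0" "a' = (\<lambda>i. c * a i)" using a' mem_pclass_iff[OF a] by blast
    then show ?thesis using proj_equations_scale[OF subsetD[OF S p]] z p by simp
  qed
  then show "pclass n a \<in> proj_zeros \<delta> n S"
    by (simp add: proj_zeros_def pclass_in_proj_space[OF a])
qed

lemma proj_proj_equationsI:
  assumes "p \<in> dpolys F (XV ` {0..n} \<union> YV ` {0..l})" "hom_deg \<delta> (XV ` {0..n}) p d" "hom_deg \<delta> (YV ` {0..l}) p e"
  shows "p \<in> proj_proj_equations \<delta> F n l"
  using assms delta_homogeneous_iff[of "XV ` {0..n} \<union> YV ` {0..l}" p] by (auto simp: proj_proj_equations_def)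

lemma proj_proj_equations_scale:
  assumes "p \<in> proj_proj_equations \<delta> F n l" "c \<noteq> 0" "c' \<noteq> 0"
  shows "deval \<delta> (case_coord (\<lambda>i. c * a i) (\<lambda>i. c' * b i)) p = 0 \<longleftrightarrow> deval \<delta> (case_coord a b) p = 0"
proof -
  have p: "p \<in> dpolys F (XV ` {0..n} \<union> YV ` {0..l})" using assms(1) by (simp add: proj_proj_equations_def)
  obtain d e where "hom_deg \<delta> (XV ` {0..n}) p d" "hom_deg \<delta> (YV ` {0..l}) p e"
    using assms(1) delta_homogeneous_iff[of "XV ` {0..n} \<union> YV ` {0..l}" p] by (auto simp: proj_proj_equations_def)
  then show ?thesis
    using deval_scale_x[OF p _ assms(2)] deval_scale_y[OF p _ assms(3)] assms(2,3) by simp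
qed

lemma mem_proj_proj_zeros_iff:
  assumes S: "S \<subseteq> proj_proj_equations \<delta> F n l" and a: "a \<in> hom_coords n" and b: "b \<in> hom_coords l"
  shows "(pclass n a, pclass l b) \<in> proj_proj_zeros \<delta> n l S \<longleftrightarrow> (\<forall>p\<in>S. deval \<delta> (case_coord a b) p = 0)"
proof
  assume "(pclass n a, pclass l b) \<in> proj_proj_zeros \<delta> n l S"
  then show "\<forall>p\<in>S. deval \<delta> (case_coord a b) p = 0"
    using pclass_self[OF a] pclass_self[OF b] by (auto simp: proj_proj_zeros_def)
next
  assume z: "\<forall>p\<in>S. deval \<delta> (case_coord a b) p = 0"
  have "deval \<delta> (case_coord a' b') p = 0" if a': "a' \<in> pclass n a" and b': "b' \<in> pclass l b" and p: "p \<in> S" for a' b' p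
  proof -
    obtain c where "c \<noteq> 0" "a' = (\<lambda>i. c * a i)" using a' mem_pclass_iff[OF a] by blast
    moreover obtain c' where "c' \<noteq> 0" "b' = (\<lambda>i. c' * b i)" using b' mem_pclass_iff[OF b] by blast
    ultimately show ?thesis using proj_proj_equations_scale[OF subsetD[OF S p]] z p by simp
  qed
  then show "(pclass n a, pclass l b) \<in> proj_proj_zeros \<delta> n l S"
    by (simp add: proj_proj_zeros_def pclass_in_proj_space[OF a] pclass_in_proj_space[OF b])
qed

lemma proj_equations_proj_proj:
  assumes p: "p \<in> proj_equations \<delta> F n"
  shows "p \<in> proj_proj_equations \<delta> F n l"
proof -
  obtain d where "hom_deg \<delta> (XV ` {0..n}) p d" using proj_equationsD(2)[OF p] by blast
  moreover have "hom_deg \<delta> (YV ` {0..l}) p 0"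
    by (rule hom_deg_disjoint[OF proj_equationsD(1)[OF p]]) auto
  moreover have "p \<in> dpolys F (XV ` {0..n} \<union> YV ` {0..l})"
    using proj_equationsD(1)[OF p] dpolys_mono[of "XV ` {0..n}" "XV ` {0..n} \<union> YV ` {0..l}" F] by blast
  ultimately show ?thesis by (intro proj_proj_equationsI)
qed

text \<open>
  The image of the zero set of \<open>D\<close> under the projection to \<open>\<A>\<^sup>m\<close> is closed: homogenize the equations with
  respect to \<open>y\<^sub>0, \<dots>, y\<^sub>m\<close>, apply completeness with \<open>W = \<P>\<^sup>m\<close>, and dehomogenize the equations of the
  image.  The origin does not belong to the image, so one of the latter equations has a non-zero constant
  term.
\<close>

theorem complete_separates_origin:
  assumes complete: "delta_complete \<delta> F n V" and P: "P \<subseteq> proj_equations \<delta> F n" and V: "V = proj_zeros \<delta> n P"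
    and D: "D \<subseteq> dpolys F (XV ` {0..n} \<union> YV ` {1..m})" "\<And>p. p \<in> D \<Longrightarrow> \<exists>d. hom_deg \<delta> (XV ` {0..n}) p d"
    and PD: "P \<subseteq> D"
    and avoid: "\<And>a. a \<in> hom_coords n \<Longrightarrow> \<exists>p\<in>D. deval \<delta> (case_coord a (\<lambda>_. 0)) p \<noteq> 0"
  obtains g where "g \<in> dpolys F (YV ` {1..m})" "constant_term g \<noteq> 0"
    "\<And>a b. a \<in> hom_coords n \<Longrightarrow> \<forall>p\<in>D. deval \<delta> (case_coord a b) p = 0 \<Longrightarrow> deval \<delta> (case_coord a b) g = 0"
proof -
  let ?vs = "XV ` {0..n} \<union> YV ` {0..m}" and ?ys = "YV ` {0..m}"
  have "\<exists>h. h \<in> proj_proj_equations \<delta> F n m \<and> (\<forall>a b. b 0 = 1 \<longrightarrow> deval \<delta> (case_coord a b) h = deval \<delta> (case_coord a b) p)"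
    if p: "p \<in> D" for p
  proof -
    have "XV ` {0..n} \<union> YV ` {1..m} \<subseteq> ?vs" by auto
    then have pF: "p \<in> dpolys F ?vs" using p D(1) dpolys_mono by blast
    obtain d where d: "hom_deg \<delta> (XV ` {0..n}) p d" using D(2)[OF p] by blast
    obtain h N where h: "h \<in> dpolys F ?vs" "hom_deg \<delta> ?ys h N"
      "\<And>a. a (YV 0) \<noteq> 0 \<Longrightarrow> deval \<delta> a h = a (YV 0) ^ N * deval \<delta> (\<lambda>v. if v \<in> ?ys then a v / a (YV 0) else a v) p"
      "\<And>xs d. xs \<inter> ?ys = {} \<Longrightarrow> hom_deg \<delta> xs p d \<Longrightarrow> hom_deg \<delta> xs h d"
      by (rule homogenization[OF pF, of "YV 0" ?ys]) simp_all
    have hx: "hom_deg \<delta> (XV ` {0..n}) h d" by (rule h(4)[OF _ d]) auto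
    have "deval \<delta> (case_coord a b) h = deval \<delta> (case_coord a b) p" if "b 0 = 1" for a b
      using h(3)[of "case_coord a b"] that by (simp cong: if_cong)
    then show ?thesis using proj_proj_equationsI[OF h(1) hx h(2)] by blast
  qed
  then obtain h where h: "\<And>p. p \<in> D \<Longrightarrow> h p \<in> proj_proj_equations \<delta> F n m"
    "\<And>p a b. p \<in> D \<Longrightarrow> b 0 = 1 \<Longrightarrow> deval \<delta> (case_coord a b) (h p) = deval \<delta> (case_coord a b) p" by metis
  define S where "S = h ` D \<union> P"
  have S: "S \<subseteq> proj_proj_equations \<delta> F n m"
    using h(1) P proj_equations_proj_proj by (auto simp: S_def)
  let ?Z = "proj_proj_zeros \<delta> n m S"
  have "?Z \<subseteq> V \<times> proj_space m"
  proof clarify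
    fix A B assume AB: "(A, B) \<in> ?Z"
    then obtain a b where a: "a \<in> hom_coords n" "A = pclass n a" "b \<in> hom_coords m" "B = pclass m b"
      by (auto simp: proj_proj_zeros_def elim!: proj_spaceE)
    then have "\<forall>p\<in>P. deval \<delta> (case_coord a b) p = 0"
      using mem_proj_proj_zeros_iff[OF S] AB by (auto simp: S_def)
    then have "\<forall>p\<in>P. deval \<delta> (case_coord a (\<lambda>_. 0)) p = 0"
      using proj_equations_deval[OF subsetD[OF P], of _ a b] by simp
    then show "A \<in> V \<and> B \<in> proj_space m"
      using mem_proj_zeros_iff[OF P a(1)] a pclass_in_proj_space by (auto simp: V)
  qed
  moreover have "proj_proj_closed \<delta> F n m ?Z" using S by (auto simp: proj_proj_closed_def)
  moreover have "proj_closed \<delta> F m (proj_space m)"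
    unfolding proj_closed_def by (intro exI[of _ "{}"]) (auto simp: proj_zeros_def)
  ultimately have "proj_closed \<delta> F m (snd ` ?Z)" using complete unfolding delta_complete_def by blast
  then obtain S' where S': "S' \<subseteq> proj_equations \<delta> F m" "snd ` ?Z = proj_zeros \<delta> m S'"
    by (auto simp: proj_closed_def)
  \<comment> \<open>The origin of \<open>\<A>\<^sup>m\<close>, as a point of \<open>\<P>\<^sup>m\<close>.\<close>
  define e where "e = (\<lambda>i::nat. if i = 0 then 1 else 0 :: 'u)"
  have e: "e \<in> hom_coords m" by (auto simp: e_def hom_coords_def)
  have "pclass m e \<notin> snd ` ?Z"
  proof
    assume "pclass m e \<in> snd ` ?Z"
    then obtain A where A: "(A, pclass m e) \<in> ?Z" by auto
    then obtain a where a: "a \<in> hom_coords n" "A = pclass n a"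
      by (auto simp: proj_proj_zeros_def elim!: proj_spaceE)
    then have z: "\<forall>p\<in>S. deval \<delta> (case_coord a e) p = 0" using mem_proj_proj_zeros_iff[OF S a(1) e] A by simp
    obtain p where p: "p \<in> D" "deval \<delta> (case_coord a (\<lambda>_. 0)) p \<noteq> 0" using avoid[OF a(1)] by blast
    have "p \<in> dpolys F (XV ` {0..n} \<union> YV ` {1..m})" using p D by blast
    then have "deval \<delta> (case_coord a (\<lambda>_. 0)) p = deval \<delta> (case_coord a e) p"
      by (rule deval_cong) (auto simp: e_def)
    also have "\<dots> = deval \<delta> (case_coord a e) (h p)" using h(2)[OF p(1), of e a] by (simp add: e_def)
    also have "\<dots> = 0" using z p(1) by (simp add: S_def)
    finally show False using p(2) by simp
  qed
  then obtain p where p: "p \<in> S'" "deval \<delta> (case_coord e (\<lambda>_. 0)) p \<noteq> 0"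
    unfolding S'(2) mem_proj_zeros_iff[OF S'(1) e] by blast
  have pF: "p \<in> dpolys F (XV ` {0..m})" using proj_equationsD(1) p(1) S'(1) by blast
  \<comment> \<open>Closed sets in \<open>\<P>\<^sup>m\<close> have equations in \<open>XV 0, \<dots>, XV
      m\<close>; dehomogenization also renames these variables.\<close>
  define \<sigma> where "\<sigma> = case_coord (\<lambda>i. if i = 0 then dconst 1 else dvar (YV i) 0 :: (coord, 'u) dpoly) (\<lambda>_. dconst 0)"
  define g where "g = dcomp \<delta> \<sigma> p"
  have g_eval: "deval \<delta> a g = deval \<delta> (case_coord (\<lambda>i. if i = 0 then 1 else a (YV i)) (\<lambda>_. 0)) p" for a
    unfolding g_def deval_dcomp[OF der]
    by (rule arg_cong[of _ _ "\<lambda>f. deval \<delta> f p"])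
      (auto simp: \<sigma>_def deval_dconst deval_dvar fun_eq_iff split: coord.split)
  have "g \<in> dpolys F (YV ` {1..m})"
    unfolding g_def
    by (rule dcomp_dpolys[OF der F_dring pF])
      (auto simp: \<sigma>_def intro!: dpolys_dvar[OF F_ring] dpolys_dconst subring_1[OF F_ring])
  moreover have "constant_term g \<noteq> 0"
    using p(2) unfolding deval_zero_point[OF der, symmetric] g_eval by (simp add: e_def)
  moreover have "deval \<delta> (case_coord a b) g = 0"
    if a: "a \<in> hom_coords n" and z: "\<forall>p\<in>D. deval \<delta> (case_coord a b) p = 0" for a b
  proof -
    \<comment> \<open>The point of \<open>\<P>\<^sup>m\<close> with affine coordinates \<open>b\<close>.\<close>
    define b' where "b' i = (if i = 0 then 1 else if i \<le> m then b i else 0)" for i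
    have b': "b' \<in> hom_coords m" by (auto simp: b'_def hom_coords_def)
    have zb: "deval \<delta> (case_coord a b') q = 0" if "q \<in> D" for q
    proof -
      have "q \<in> dpolys F (XV ` {0..n} \<union> YV ` {1..m})" using that D by blast
      then have "deval \<delta> (case_coord a b') q = deval \<delta> (case_coord a b) q"
        by (rule deval_cong) (auto simp: b'_def)
      then show ?thesis using z that by simp
    qed
    then have "\<forall>q\<in>S. deval \<delta> (case_coord a b') q = 0"
      using h(2)[of _ b' a] PD by (auto simp: S_def b'_def)
    then have "(pclass n a, pclass m b') \<in> ?Z" using mem_proj_proj_zeros_iff[OF S a b'] by simp
    then have "pclass m b' \<in> proj_zeros \<delta> m S'" unfolding S'(2)[symmetric] by force
    then have "deval \<delta> (case_coord b' (\<lambda>_. 0)) p = 0"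
      using mem_proj_zeros_iff[OF S'(1) b'] p(1) by simp
    moreover have "deval \<delta> (case_coord (\<lambda>i. if i = 0 then 1 else b i) (\<lambda>_. 0)) p = deval \<delta> (case_coord b' (\<lambda>_. 0)) p"
      by (rule deval_cong[OF pF]) (auto simp: b'_def)
    ultimately show ?thesis unfolding g_eval coord.case by simp
  qed
  ultimately show thesis using that by blast
qed


section \<open>Completeness implies the elimination property\<close>

text \<open>
  \<open>h\<close> has the same zeros as \<open>cleared \<delta> i j T lab\<close> where \<open>x\<^sub>i \<noteq> 0\<close>, and it vanishes where \<open>x\<^sub>i\<close> does.
  The sets in \<open>\<W>\<close> may be enlarged in this way, since also the larger sets avoid \<open>y = 0\<close>: there
  \<open>h\<close> is \<open>- x\<^sub>i ^ N\<close>.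
\<close>

lemma W_equation_homogeneous:
  assumes fin: "finite T" and lab: "\<forall>t\<in>T. lab t \<in> {1..m}" and i: "i \<le> n" and j: "j \<le> n"
  obtains h d where "h \<in> dpolys F (XV ` {0..n} \<union> YV ` {1..m})" "hom_deg \<delta> (XV ` {0..n}) h d"
    "\<And>a. deval \<delta> a (cleared \<delta> i j T lab) = 0 \<Longrightarrow> deval \<delta> a h = 0"
    "\<And>a. a (XV i) \<noteq> 0 \<Longrightarrow> \<forall>t\<in>T. a (YV (lab t)) = 0 \<Longrightarrow> deval \<delta> a h \<noteq> 0"
proof -
  let ?vs = "XV ` {0..n} \<union> YV ` {1..m}"
  define p where "p = (\<Sum>t\<in>T. dvar (YV (lab t)) 0 *
      (\<Prod>k\<in>Poly_Mapping.keys t. dvar (XV j) k ^ Poly_Mapping.lookup t k)) - (1 :: (coord, 'u) dpoly)"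
  have p: "p \<in> dpolys F ?vs"
    unfolding p_def using i j lab
    by (intro subring_diff[OF dpolys_ring] subring_sum[OF dpolys_ring] subring_mult[OF dpolys_ring]
      subring_prod[OF dpolys_ring] subring_power[OF dpolys_ring] subring_1[OF dpolys_ring] dpolys_dvar[OF F_ring]) auto
  have i': "XV i \<in> ?vs" "XV i \<in> XV ` {0..n}" and j': "XV j \<in> XV ` {0..n}" using i j by auto
  have ev1: "deval \<delta> a 1 = 1" for a :: "coord \<Rightarrow> 'u"
    using deval_dconst[of \<delta> a 1] by (simp add: dconst_def)
  obtain h N where h: "h \<in> dpolys F ?vs" "hom_deg \<delta> (XV ` {0..n}) h N"
    "\<And>a. a (XV i) = 0 \<Longrightarrow> deval \<delta> a h = 0"
    "\<And>a. a (XV i) \<noteq> 0 \<Longrightarrow> deval \<delta> a h =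
      a (XV i) ^ N * deval \<delta> (\<lambda>v. if v \<in> XV ` {0..n} then a v / a (XV i) else a v) p"
    by (rule homogenization[OF p i'], rule that)
  have ev: "deval \<delta> a h = a (XV i) ^ N * ((\<Sum>t\<in>T. a (YV (lab t)) *
         (\<Prod>k\<in>Poly_Mapping.keys t. (\<delta> ^^ k) (a (XV j) / a (XV i)) ^ Poly_Mapping.lookup t k)) - 1)"
    if "a (XV i) \<noteq> 0" for a
  proof -
    have "YV l \<notin> XV ` {0..n}" for l by auto
    then show ?thesis
      unfolding h(4)[of a, OF that] p_def deval_diff deval_sum deval_mult deval_prod deval_power deval_dvar ev1
      using j' by simp
  qed
  have "deval \<delta> a h = 0" if z: "deval \<delta> a (cleared \<delta> i j T lab) = 0" for a
  proof (cases "a (XV i) = 0")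
    case False
    then show ?thesis using z unfolding deval_cleared[where a = a and i = i, OF der False fin] ev[of a, OF False] by simp
  qed (rule h(3))
  moreover have "deval \<delta> a h \<noteq> 0" if "a (XV i) \<noteq> 0" "\<forall>t\<in>T. a (YV (lab t)) = 0" for a
    using that by (simp add: ev)
  ultimately show thesis using that h(1,2) by blast
qed

lemma dpolys_XV_subset: "dpolys F (XV ` {0..n}) \<subseteq> dpolys F (XV ` {0..n} \<union> Y)"
  by (rule dpolys_mono) blast

lemma cleared_dpolys:
  assumes ij: "i \<le> n" "j \<le> n" and lab: "\<forall>t\<in>T. lab t \<in> {1..m}"
  shows "cleared \<delta> i j T lab \<in> dpolys F (XV ` {0..n} \<union> YV ` {1..m})"
proof -
  let ?R = "dpolys F (XV ` {0..n} \<union> YV ` {1..m})"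
  have x: "dvar (XV i) k \<in> ?R" "dvar (XV j) k \<in> ?R" for k
    using ij by (auto intro!: dpolys_dvar[OF F_ring])
  have y: "dvar (YV (lab t)) 0 \<in> ?R" if "t \<in> T" for t
    using lab that by (intro dpolys_dvar[OF F_ring]) auto
  have "quot_num \<delta> i j k \<in> ?R" for k
  proof (induction k)
    case (Suc k)
    then have "dderiv \<delta> (quot_num \<delta> i j k) \<in> ?R" using dpolys_dring by (auto simp: diff_subring_def)
    then show ?case unfolding quot_num.simps
      by (intro subring_diff[OF dpolys_ring] subring_mult[OF dpolys_ring] subring_of_nat[OF dpolys_ring] Suc x)
  qed (use x in simp)
  then show ?thesis
    unfolding cleared_def Let_def monom_num_def
    by (intro subring_diff[OF dpolys_ring] subring_sum[OF dpolys_ring] subring_mult[OF dpolys_ring]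
        subring_prod[OF dpolys_ring] subring_power[OF dpolys_ring] x y)
qed

text \<open>
  A polynomial \<open>g\<close> in \<open>y\<close> with non-zero constant term that vanishes on the projection exists by completeness.
  Every \<open>x\<^sub>i * g\<close> then vanishes at all zeros of \<open>D\<close>, those with \<open>x = 0\<close> included, and the Nullstellensatz puts a
  power of it into the differential ideal of \<open>D\<close>.
\<close>

theorem complete_imp_elimination:
  assumes complete: "delta_complete \<delta> F n V" and P: "P \<subseteq> proj_equations \<delta> F n" and V: "V = proj_zeros \<delta> n P"
    and W: "(m, W, D) \<in> W_collection \<delta> n P"
  shows "\<exists>g\<in>elim_ideal F n m (diff_ideal \<delta> (dpolys F (XV ` {0..n} \<union> YV ` {1..m})) D). constant_term g \<noteq> 0"
proof -
  let ?vs = "XV ` {0..n} \<union> YV ` {1..m}"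
  let ?R = "dpolys F ?vs"
  obtain E j T lab where E: "E \<noteq> {}" "E \<subseteq> {0..n}" and j: "\<forall>i\<in>E. j i \<le> n \<and> j i \<noteq> i"
    and T: "\<forall>i\<in>E. finite (T i)" and lab: "bij_betw lab (SIGMA i:E. T i) {1..m}"
    and D: "D = {dvar (XV i) 0 | i. i \<in> {0..n} - E} \<union>
            {cleared \<delta> i (j i) (T i) (\<lambda>t. lab (i, t)) | i. i \<in> E} \<union> P"
    using W unfolding W_collection_def by blast
  have lab': "lab (i, t) \<in> {1..m}" if "i \<in> E" "t \<in> T i" for i t
    using bij_betwE[OF lab] that by blast
  have "\<forall>i\<in>E. \<exists>h. h \<in> ?R \<and> (\<exists>d. hom_deg \<delta> (XV ` {0..n}) h d) \<and>
      (\<forall>a. deval \<delta> a (cleared \<delta> i (j i) (T i) (\<lambda>t. lab (i, t))) = 0 \<longrightarrow> deval \<delta> a h = 0) \<and>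
      (\<forall>a. a (XV i) \<noteq> 0 \<and> (\<forall>t\<in>T i. a (YV (lab (i, t))) = 0) \<longrightarrow> deval \<delta> a h \<noteq> 0)"
  proof
    fix i assume i: "i \<in> E"
    have "finite (T i)" "i \<le> n" "j i \<le> n" "\<forall>t\<in>T i. lab (i, t) \<in> {1..m}"
      using i E j T lab' by auto
    note W_equation = W_equation_homogeneous[where lab = "\<lambda>t. lab (i, t)", OF this(1,4,2,3)]
    obtain h d where "h \<in> ?R" "hom_deg \<delta> (XV ` {0..n}) h d"
      "\<And>a. deval \<delta> a (cleared \<delta> i (j i) (T i) (\<lambda>t. lab (i, t))) = 0 \<Longrightarrow> deval \<delta> a h = 0"
      "\<And>a. a (XV i) \<noteq> 0 \<Longrightarrow> \<forall>t\<in>T i. a (YV (lab (i, t))) = 0 \<Longrightarrow> deval \<delta> a h \<noteq> 0"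
      by (rule W_equation, rule that)
    then show "\<exists>h. h \<in> ?R \<and> (\<exists>d. hom_deg \<delta> (XV ` {0..n}) h d) \<and>
      (\<forall>a. deval \<delta> a (cleared \<delta> i (j i) (T i) (\<lambda>t. lab (i, t))) = 0 \<longrightarrow> deval \<delta> a h = 0) \<and>
      (\<forall>a. a (XV i) \<noteq> 0 \<and> (\<forall>t\<in>T i. a (YV (lab (i, t))) = 0) \<longrightarrow> deval \<delta> a h \<noteq> 0)"
      by (intro exI[of _ h] conjI exI[of _ d]) simp_all
  qed
  from bchoice[OF this] obtain h where h0: "\<forall>i\<in>E. h i \<in> ?R \<and> (\<exists>d. hom_deg \<delta> (XV ` {0..n}) (h i) d) \<and>
      (\<forall>a. deval \<delta> a (cleared \<delta> i (j i) (T i) (\<lambda>t. lab (i, t))) = 0 \<longrightarrow> deval \<delta> a (h i) = 0) \<and>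
      (\<forall>a. a (XV i) \<noteq> 0 \<and> (\<forall>t\<in>T i. a (YV (lab (i, t))) = 0) \<longrightarrow> deval \<delta> a (h i) \<noteq> 0)" ..
  then have h: "\<And>i. i \<in> E \<Longrightarrow> h i \<in> ?R" "\<And>i. i \<in> E \<Longrightarrow> \<exists>d. hom_deg \<delta> (XV ` {0..n}) (h i) d"
    "\<And>i a. i \<in> E \<Longrightarrow> deval \<delta> a (cleared \<delta> i (j i) (T i) (\<lambda>t. lab (i, t))) = 0 \<Longrightarrow> deval \<delta> a (h i) = 0"
    "\<And>i a. i \<in> E \<Longrightarrow> a (XV i) \<noteq> 0 \<Longrightarrow> \<forall>t\<in>T i. a (YV (lab (i, t))) = 0 \<Longrightarrow> deval \<delta> a (h i) \<noteq> 0"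
    by simp_all
  note h_ring = h(1) and h_zero = h(3)
  \<comment> \<open>The equations of \<open>W\<close>, with the homogeneous \<open>h i\<close> in place of the
      cleared ones; this can only enlarge the zero set.\<close>
  define D' where "D' = {dvar (XV i) 0 | i. i \<in> {0..n} - E} \<union> h ` E \<union> P"
  have xR: "dvar (XV i) 0 \<in> ?R" if "i \<le> n" for i using that by (intro dpolys_dvar[OF F_ring]) auto
  have PR: "p \<in> ?R" if "p \<in> P" for p
    using proj_equationsD(1)[OF subsetD[OF P that]] dpolys_XV_subset by blast
  have xh: "hom_deg \<delta> (XV ` {0..n}) (dvar (XV i) 0) 1" if "i \<le> n" for i
    using that by (auto simp: hom_deg_def deval_dvar)
  obtain g where g: "g \<in> dpolys F (YV ` {1..m})" "constant_term g \<noteq> 0"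
    "\<And>a b. a \<in> hom_coords n \<Longrightarrow> \<forall>p\<in>D'. deval \<delta> (case_coord a b) p = 0 \<Longrightarrow> deval \<delta> (case_coord a b) g = 0"
  proof (rule complete_separates_origin[OF complete P V, of D' m])
    show "D' \<subseteq> ?R" using xR h(1) PR by (auto simp: D'_def)
    show "\<exists>d. hom_deg \<delta> (XV ` {0..n}) p d" if "p \<in> D'" for p
      using that xh h(2) proj_equationsD(2) P by (force simp: D'_def)
    show "P \<subseteq> D'" by (simp add: D'_def)
    show "\<exists>p\<in>D'. deval \<delta> (case_coord a (\<lambda>_. 0)) p \<noteq> 0" if a: "a \<in> hom_coords n" for a
    proof -
      obtain i where i: "i \<le> n" "a i \<noteq> 0" using a by (auto simp: hom_coords_def)
      show ?thesis
      proof (cases "i \<in> E")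
        case True
        then show ?thesis using h(4)[of i "case_coord a (\<lambda>_. 0)"] i(2) by (force simp: D'_def)
      next
        case False
        then have "dvar (XV i) 0 \<in> D'" using i(1) by (auto simp: D'_def)
        moreover have "deval \<delta> (case_coord a (\<lambda>_. 0)) (dvar (XV i) 0) \<noteq> 0" using i(2) by (simp add: deval_dvar)
        ultimately show ?thesis by blast
      qed
    qed
  qed (rule that)
  have gR: "g \<in> ?R" using g(1) dpolys_mono[of "YV ` {1..m}" ?vs F] by blast
  have clR: "cleared \<delta> i (j i) (T i) (\<lambda>t. lab (i, t)) \<in> ?R" if "i \<in> E" for i
    using that E j lab' by (intro cleared_dpolys) auto
  have DR: "D \<subseteq> ?R" unfolding D using xR clR PR by auto
  have van: "deval \<delta> s (dvar (XV i) 0 * g) = 0"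
    if i: "i \<le> n" and z: "\<And>p. p \<in> D \<Longrightarrow> deval \<delta> s p = 0" for s i
  proof (cases "s (XV i) = 0")
    case True
    then show ?thesis by (simp add: deval_mult deval_dvar)
  next
    case False
    define a where "a i = (if i \<le> n then s (XV i) else 0)" for i
    have a: "a \<in> hom_coords n" using i False by (auto simp: hom_coords_def a_def)
    have cong: "deval \<delta> (case_coord a (s \<circ> YV)) p = deval \<delta> s p" if "p \<in> ?R" for p
      by (rule deval_cong[OF that]) (auto simp: a_def)
    have "deval \<delta> s p = 0 \<and> p \<in> ?R" if pD: "p \<in> D'" for p
    proof -
      consider (x) k where "k \<in> {0..n} - E" "p = dvar (XV k) 0" | (h) k where "k \<in> E" "p = h k" | (P) "p \<in> P"
        using pD unfolding D'_def by blast
      then show ?thesis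
      proof cases
        case x
        then have "p \<in> D" unfolding D by blast
        then show ?thesis using z xR x by simp
      next
        case h
        then have "cleared \<delta> k (j k) (T k) (\<lambda>t. lab (k, t)) \<in> D" unfolding D by blast
        from h_zero[OF h(1) z[OF this]] h_ring[OF h(1)] show ?thesis by (simp add: h(2))
      next
        case P
        then have "p \<in> D" unfolding D by blast
        then show ?thesis using z PR[OF P] by simp
      qed
    qed
    then have "deval \<delta> (case_coord a (s \<circ> YV)) g = 0" using g(3)[OF a] cong by simp
    then show ?thesis using cong[OF gR] by (simp add: deval_mult)
  qed
  have xg: "dvar (XV i) 0 * g \<in> ?R" if "i \<le> n" for i by (intro subring_mult[OF dpolys_ring] xR that gR)
  note I = dideal_diff_ideal(1)[OF der dpolys_dring DR]
  have "\<exists>e. (dvar (XV i) 0 * g) ^ e \<in> diff_ideal \<delta> ?R D" if "i \<le> n" for i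
    by (rule differential_Nullstellensatz[OF _ DR xg[OF that] van[OF that]]) auto
  then obtain e where e: "\<And>i. i \<le> n \<Longrightarrow> (dvar (XV i) 0 * g) ^ e i \<in> diff_ideal \<delta> ?R D" by metis
  define N where "N = (\<Sum>i\<le>n. e i)"
  have "dvar (XV i) 0 ^ N * g ^ N \<in> diff_ideal \<delta> ?R D" if i: "i \<le> n" for i
  proof -
    have "e i \<le> N" unfolding N_def using i by (intro member_le_sum) auto
    then have "(dvar (XV i) 0 * g) ^ N \<in> diff_ideal \<delta> ?R D"
      using dideal_power_mono[OF dpolys_ring I xg[OF i] e[OF i]] by blast
    then show ?thesis by (simp add: power_mult_distrib)
  qed
  then have "\<exists>e. dvar (XV i) 0 ^ e * g ^ N \<in> diff_ideal \<delta> ?R D" if "i \<le> n" for i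
    using that by blast
  then have "g ^ N \<in> elim_ideal F n m (diff_ideal \<delta> ?R D)"
    using subring_power[OF dpolys_ring g(1), of N] unfolding elim_ideal_def by simp
  moreover have "constant_term (g ^ N) \<noteq> 0"
    using g(2) by (simp add: deval_power flip: deval_zero_point[OF der])
  ultimately show ?thesis by blast
qed

end

section \<open>Maximal specializations\<close>

text \<open>
  The differential ring \<open>R{x}\<close>.
\<close>

definition adjoin :: "('u::field \<Rightarrow> 'u) \<Rightarrow> 'u set \<Rightarrow> 'u \<Rightarrow> 'u set" where
  "adjoin \<delta> R x = {deval \<delta> (\<lambda>_. x) p | p :: (unit, 'u) dpoly. p \<in> dpolys R UNIV}"

text \<open>
  The ideal of \<open>S\<close> generated by \<open>M\<close>.
\<close>

inductive_set gen_ideal :: "'a::comm_ring_1 set \<Rightarrow> 'a set \<Rightarrow> 'a set" for M S where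
  zero: "0 \<in> gen_ideal M S"
| add: "m \<in> M \<Longrightarrow> s \<in> S \<Longrightarrow> a \<in> gen_ideal M S \<Longrightarrow> m * s + a \<in> gen_ideal M S"

lemma gen_ideal_plus: "a \<in> gen_ideal M S \<Longrightarrow> b \<in> gen_ideal M S \<Longrightarrow> a + b \<in> gen_ideal M S"
  by (induction rule: gen_ideal.induct) (auto simp: add.assoc intro: gen_ideal.add)

lemma gen_ideal_base: "m \<in> M \<Longrightarrow> s \<in> S \<Longrightarrow> m * s \<in> gen_ideal M S"
  using gen_ideal.add[OF _ _ gen_ideal.zero, of m M s S] by simp

lemma dideal_gen_ideal:
  assumes D: "derivation D" and S: "diff_subring D S" and M: "M \<subseteq> S" "\<And>m. m \<in> M \<Longrightarrow> D m \<in> M"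
  shows "dideal D S (gen_ideal M S)"
proof -
  have sS: "is_subring S" and DS: "\<And>s. s \<in> S \<Longrightarrow> D s \<in> S" using S by (auto simp: diff_subring_def)
  have "a \<in> S" if "a \<in> gen_ideal M S" for a
    using that by induction (use M(1) in \<open>auto intro: subring_0[OF sS] subring_add[OF sS] subring_mult[OF sS]\<close>)
  moreover have "r * a \<in> gen_ideal M S" if "r \<in> S" "a \<in> gen_ideal M S" for r a
    using that(2)
  proof induction
    case (add m s a)
    have "m * (r * s) + r * a \<in> gen_ideal M S"
      by (intro gen_ideal.add add subring_mult[OF sS] that(1))
    then show ?case by (simp add: algebra_simps)
  qed (simp add: gen_ideal.zero)
  moreover have "D a \<in> gen_ideal M S" if "a \<in> gen_ideal M S" for a
    using that
  proof induction
    case (add m s a)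
    have "D m * s + (m * D s + D a) \<in> gen_ideal M S"
      by (intro gen_ideal.add add M(2) DS)
    then show ?case by (simp add: derivation_add[OF D] derivation_mult[OF D] algebra_simps)
  qed (simp add: gen_ideal.zero derivation_0[OF D])
  ultimately show ?thesis
    unfolding dideal_def using gen_ideal_plus gen_ideal.zero by blast
qed

context
  fixes \<delta> :: "'u::field \<Rightarrow> 'u" and R :: "'u set" and x :: 'u
  assumes der: "derivation \<delta>" and R: "diff_subring \<delta> R"
begin

lemma R_ring: "is_subring R" using R by (simp add: diff_subring_def)

lemma diff_subring_adjoin: "diff_subring \<delta> (adjoin \<delta> R x)"
proof -
  note s = is_subring_dpolys[OF R_ring, of "UNIV :: unit set"]
  have d: "dderiv \<delta> p \<in> dpolys R UNIV" if "p \<in> dpolys R UNIV" for p :: "(unit, 'u) dpoly"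
    using diff_subring_dpolys[OF der R, of "UNIV :: unit set"] that by (simp add: diff_subring_def)
  have 1: "1 \<in> adjoin \<delta> R x"
    unfolding adjoin_def mem_Collect_eq
    using deval_dconst[of \<delta> "\<lambda>_ :: unit. x" 1] subring_1[OF s]
    by (intro exI[of _ 1]) (simp add: dconst_def)
  have "a - b \<in> adjoin \<delta> R x \<and> a * b \<in> adjoin \<delta> R x" if ab: "a \<in> adjoin \<delta> R x" "b \<in> adjoin \<delta> R x" for a b
  proof -
    from ab obtain p q :: "(unit, 'u) dpoly" where pq: "p \<in> dpolys R UNIV" "q \<in> dpolys R UNIV"
      "a = deval \<delta> (\<lambda>_. x) p" "b = deval \<delta> (\<lambda>_. x) q" by (auto simp: adjoin_def)
    have "a - b = deval \<delta> (\<lambda>_. x) (p - q)" "a * b = deval \<delta> (\<lambda>_. x) (p * q)"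
      by (simp_all add: pq deval_diff deval_mult)
    then show ?thesis using subring_diff[OF s pq(1,2)] subring_mult[OF s pq(1,2)]
      unfolding adjoin_def by blast
  qed
  moreover have "\<delta> a \<in> adjoin \<delta> R x" if a: "a \<in> adjoin \<delta> R x" for a
  proof -
    from a obtain p :: "(unit, 'u) dpoly" where p: "p \<in> dpolys R UNIV" "a = deval \<delta> (\<lambda>_. x) p"
      by (auto simp: adjoin_def)
    have "\<delta> a = deval \<delta> (\<lambda>_. x) (dderiv \<delta> p)" by (simp add: p deval_dderiv[OF der])
    then show ?thesis using d[OF p(1)] unfolding adjoin_def by blast
  qed
  ultimately show ?thesis using 1 by (simp add: diff_subring_def is_subring_def)
qed

lemma adjoin_base: "R \<subseteq> adjoin \<delta> R x"
proof
  fix c assume c: "c \<in> R"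
  show "c \<in> adjoin \<delta> R x"
    unfolding adjoin_def mem_Collect_eq
    by (intro exI[of _ "dconst c"] conjI dpolys_dconst c) (simp add: deval_dconst)
qed

lemma adjoin_gen: "x \<in> adjoin \<delta> R x"
  unfolding adjoin_def mem_Collect_eq
  by (intro exI[of _ "dvar () 0"] conjI dpolys_dvar[OF R_ring UNIV_I]) (simp add: deval_dvar)

lemma gen_ideal_adjoin_poly:
  assumes M: "dideal \<delta> R M" and a: "a \<in> gen_ideal M (adjoin \<delta> R x)"
  shows "\<exists>p :: (unit, 'u) dpoly. (\<forall>\<mu>. Poly_Mapping.lookup p \<mu> \<in> M) \<and> deval \<delta> (\<lambda>_. x) p = a"
  using a
proof induction
  case zero
  then show ?case using dideal_0[OF M] by (intro exI[of _ 0]) (simp add: dsubst_def)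
next
  case (add m s a)
  then obtain p q :: "(unit, 'u) dpoly" where p: "\<forall>\<mu>. Poly_Mapping.lookup p \<mu> \<in> M" "deval \<delta> (\<lambda>_. x) p = a"
    and q: "q \<in> dpolys R UNIV" "s = deval \<delta> (\<lambda>_. x) q" by (auto simp: adjoin_def)
  have "Poly_Mapping.lookup (dconst m * q) \<mu> = m * Poly_Mapping.lookup q \<mu>" for \<mu>
  proof -
    have "dconst m * q = (\<Sum>\<kappa>\<in>Poly_Mapping.keys q. Poly_Mapping.single \<kappa> (m * Poly_Mapping.lookup q \<kappa>))"
      by (subst poly_mapping_sum_singles[of q]) (simp add: sum_distrib_left mult_single dconst_def)
    then show ?thesis by (simp add: lookup_sum lookup_single when_def in_keys_iff)
  qed
  moreover have "Poly_Mapping.lookup q \<mu> \<in> R" for \<mu>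
    using q(1) apolys_lookup[OF R_ring] by (simp add: dpolys_eq_apolys)
  ultimately have "\<forall>\<mu>. Poly_Mapping.lookup (dconst m * q + p) \<mu> \<in> M"
    using add.hyps(1) p(1) by (auto simp: lookup_add intro!: dideal_add[OF M] dideal_mult'[OF M])
  moreover have "deval \<delta> (\<lambda>_. x) (dconst m * q + p) = m * s + a"
    by (simp add: deval_add deval_mult deval_dconst p q)
  ultimately show ?case by blast
qed

end

lemma adjoin_inverse_denominator:
  fixes \<delta> :: "'u::field \<Rightarrow> 'u"
  assumes der: "derivation \<delta>" and R: "diff_subring \<delta> R" and s: "s \<in> R" "s \<noteq> 0" and a: "a \<in> adjoin \<delta> R (inverse s)"
  shows "\<exists>N. s ^ N * a \<in> R"
proof -
  have sR: "is_subring R" using R by (simp add: diff_subring_def)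
  have up: "s ^ N' * a \<in> R" if "s ^ N * a \<in> R" "N \<le> N'" for N N' a
    using subring_mult[OF sR subring_power[OF sR s(1), of "N' - N"] that(1)] that(2)
    by (simp add: mult.assoc[symmetric] flip: power_add)
  have D: "\<exists>N. s ^ N * (\<delta> ^^ k) (inverse s) \<in> R" for k
  proof (induction k)
    case 0
    then show ?case using s subring_1[OF sR] by (intro exI[of _ 1]) simp
  next
    case (Suc k)
    then obtain N where N: "s ^ N * (\<delta> ^^ k) (inverse s) \<in> R" by blast
    let ?z = "(\<delta> ^^ k) (inverse s)"
    have N': "s ^ Suc N * ?z \<in> R" using up[OF N, of "Suc N"] by simp
    have "\<delta> (s ^ Suc N * ?z) = of_nat (Suc N) * \<delta> s * (s ^ N * ?z) + s ^ Suc N * \<delta> ?z"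
      by (simp add: derivation_mult[OF der] derivation_power_Suc[OF der] algebra_simps del: power_Suc of_nat_Suc)
    then have "s ^ Suc N * (\<delta> ^^ Suc k) (inverse s) = \<delta> (s ^ Suc N * ?z) - of_nat (Suc N) * \<delta> s * (s ^ N * ?z)"
      by simp
    also have "\<delta> (s ^ Suc N * ?z) - of_nat (Suc N) * \<delta> s * (s ^ N * ?z) \<in> R"
    proof -
      have "\<delta> (s ^ Suc N * ?z) \<in> R" "\<delta> s \<in> R" using R N' s(1) unfolding diff_subring_def by blast+
      then show ?thesis by (intro subring_diff[OF sR] subring_mult[OF sR] subring_of_nat[OF sR] N)
    qed
    finally show ?case by blast
  qed
  from a obtain p :: "(unit, 'u) dpoly" where p: "p \<in> dpolys R UNIV" "a = deval \<delta> (\<lambda>_. inverse s) p"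
    by (auto simp: adjoin_def)
  have "\<exists>N. s ^ N * deval \<delta> (\<lambda>_. inverse s) p \<in> R"
    using p(1)
  proof (induction rule: dpolys_induct)
    case (const c)
    then show ?case by (intro exI[of _ 0]) (simp add: deval_dconst)
  next
    case (var v k)
    then show ?case using D by (simp add: deval_dvar)
  next
    case (add p q)
    then obtain N N' where "s ^ N * deval \<delta> (\<lambda>_. inverse s) p \<in> R" "s ^ N' * deval \<delta> (\<lambda>_. inverse s) q \<in> R" by blast
    then have "s ^ (N + N') * deval \<delta> (\<lambda>_. inverse s) p + s ^ (N + N') * deval \<delta> (\<lambda>_. inverse s) q \<in> R"
      using up by (intro subring_add[OF sR]) auto
    then show ?case by (auto simp: deval_add distrib_left)
  next
    case (mult p q)
    then obtain N N' where "s ^ N * deval \<delta> (\<lambda>_. inverse s) p \<in> R" "s ^ N' * deval \<delta> (\<lambda>_. inverse s) q \<in> R" by blast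
    from subring_mult[OF sR this] have "s ^ (N + N') * (deval \<delta> (\<lambda>_. inverse s) p * deval \<delta> (\<lambda>_. inverse s) q) \<in> R"
      by (simp add: power_add ac_simps)
    then show ?case by (auto simp: deval_mult)
  qed (rule sR)
  then show ?thesis by (simp add: p(2))
qed

text \<open>
  A pair of a differential ring \<open>R\<close> and a prime differential ideal \<open>M\<close> of \<open>R\<close> stands for the specialization
  of \<open>R\<close> with kernel \<open>M\<close>.  Domination is extension of the specialization to a larger ring.
\<close>

definition dominates :: "'a set \<times> 'a set \<Rightarrow> 'a set \<times> 'a set \<Rightarrow> bool" where
  "dominates X Y \<longleftrightarrow> fst X \<subseteq> fst Y \<and> snd Y \<inter> fst X = snd X"

definition local_pair :: "('u::field \<Rightarrow> 'u) \<Rightarrow> 'u set \<times> 'u set \<Rightarrow> bool" where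
  "local_pair \<delta> X \<longleftrightarrow> diff_subring \<delta> (fst X) \<and> prime_dideal \<delta> (fst X) (snd X)"

lemma dominates_refl: "local_pair \<delta> X \<Longrightarrow> dominates X X"
  using prime_dideal_dideal[of \<delta> "fst X" "snd X"] dideal_subset[of \<delta> "fst X" "snd X"]
  by (auto simp: dominates_def local_pair_def)

lemma dominates_trans: "dominates X Y \<Longrightarrow> dominates Y Z \<Longrightarrow> dominates X Z"
  by (auto simp: dominates_def)

lemma dominates_antisym:
  "local_pair \<delta> X \<Longrightarrow> local_pair \<delta> Y \<Longrightarrow> dominates X Y \<Longrightarrow> dominates Y X \<Longrightarrow> X = Y"
  using dominates_refl[of \<delta> X] dominates_refl[of \<delta> Y]
  by (cases X; cases Y) (auto simp: dominates_def)

lemma local_pair_Union: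
  assumes C: "C \<noteq> {}" "\<And>X. X \<in> C \<Longrightarrow> local_pair \<delta> X"
    and chain: "\<And>X Y. X \<in> C \<Longrightarrow> Y \<in> C \<Longrightarrow> dominates X Y \<or> dominates Y X"
  defines "Y \<equiv> (\<Union>(fst ` C), \<Union>(snd ` C))"
  shows "local_pair \<delta> Y" "\<And>X. X \<in> C \<Longrightarrow> dominates X Y"
proof -
  have sub: "snd X \<subseteq> fst X" if "X \<in> C" for X
    using C(2)[OF that] prime_dideal_dideal[of \<delta> "fst X" "snd X"] dideal_subset[of \<delta> "fst X" "snd X"]
    by (auto simp: local_pair_def)
  show dom: "dominates X Y" if X: "X \<in> C" for X
  proof -
    have "a \<in> snd X" if "Z \<in> C" "a \<in> snd Z" "a \<in> fst X" for Z a
      using chain[OF X \<open>Z \<in> C\<close>] that sub[OF that(1)] by (auto simp: dominates_def)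
    then show ?thesis using X sub[OF X] by (auto simp: dominates_def Y_def)
  qed
  have common: "\<exists>X\<in>C. a \<in> fst X \<and> b \<in> fst X" if ab: "a \<in> fst Y" "b \<in> fst Y" for a b
  proof -
    from ab obtain X X' where "X \<in> C" "X' \<in> C" "a \<in> fst X" "b \<in> fst X'" by (auto simp: Y_def)
    then show ?thesis using chain[of X X'] by (auto simp: dominates_def)
  qed
  have up: "fst X \<subseteq> fst Y" and eq: "a \<in> snd Y \<longleftrightarrow> a \<in> snd X" if "X \<in> C" "a \<in> fst X" for X a
    using dom[OF that(1)] that(2) by (auto simp: dominates_def)
  have loc: "is_subring (fst X)" "\<And>a. a \<in> fst X \<Longrightarrow> \<delta> a \<in> fst X" "prime_dideal \<delta> (fst X) (snd X)"
    "dideal \<delta> (fst X) (snd X)" if "X \<in> C" for X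
    using C(2)[OF that] prime_dideal_dideal[of \<delta> "fst X" "snd X"] by (auto simp: local_pair_def diff_subring_def)
  obtain X0 where X0: "X0 \<in> C" using C(1) by blast
  have "a - b \<in> fst Y \<and> a * b \<in> fst Y" if ab: "a \<in> fst Y" "b \<in> fst Y" for a b
  proof -
    from common[OF ab] obtain X where X: "X \<in> C" "a \<in> fst X" "b \<in> fst X" by blast
    then show ?thesis
      using subring_diff[OF loc(1)[OF X(1)] X(2,3)] subring_mult[OF loc(1)[OF X(1)] X(2,3)] up[OF X(1,2)] by blast
  qed
  moreover have "\<delta> a \<in> fst Y" if a: "a \<in> fst Y" for a
  proof -
    from common[OF a a] obtain X where X: "X \<in> C" "a \<in> fst X" by blast
    then show ?thesis using loc(2)[OF X] up[OF X] by blast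
  qed
  moreover have "1 \<in> fst Y" using up[OF X0] subring_1[OF loc(1)[OF X0]] by blast
  ultimately have ring: "diff_subring \<delta> (fst Y)" by (simp add: diff_subring_def is_subring_def)
  have sY: "snd Y \<subseteq> fst Y" using sub by (auto simp: Y_def)
  have "0 \<in> snd Y" using X0 dideal_0[OF loc(4)[OF X0]] by (auto simp: Y_def)
  moreover have "a + b \<in> snd Y" if ab: "a \<in> snd Y" "b \<in> snd Y" for a b
  proof -
    from common[of a b] ab sY obtain X where X: "X \<in> C" "a \<in> fst X" "b \<in> fst X" by blast
    then have "a + b \<in> snd X" using ab eq by (intro dideal_add[OF loc(4)[OF X(1)]]) auto
    then show ?thesis using X(1) by (auto simp: Y_def)
  qed
  moreover have "r * a \<in> snd Y" if ra: "r \<in> fst Y" "a \<in> snd Y" for r a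
  proof -
    from common[of r a] ra sY obtain X where X: "X \<in> C" "r \<in> fst X" "a \<in> fst X" by blast
    then have "r * a \<in> snd X" using ra eq by (intro dideal_mult[OF loc(4)[OF X(1)]]) auto
    then show ?thesis using X(1) by (auto simp: Y_def)
  qed
  moreover have "\<delta> a \<in> snd Y" if a: "a \<in> snd Y" for a
  proof -
    from a obtain X where X: "X \<in> C" "a \<in> snd X" by (auto simp: Y_def)
    then show ?thesis using dideal_D[OF loc(4)[OF X(1)] X(2)] by (auto simp: Y_def)
  qed
  ultimately have "dideal \<delta> (fst Y) (snd Y)" using sY by (simp add: dideal_def)
  moreover have "1 \<notin> snd Y"
    using eq[OF X0 subring_1[OF loc(1)[OF X0]]] prime_dideal_1[OF loc(3)[OF X0]] by simp
  moreover have "a \<in> snd Y \<or> b \<in> snd Y" if ab: "a \<in> fst Y" "b \<in> fst Y" "a * b \<in> snd Y" for a b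
  proof -
    from common[OF ab(1,2)] obtain X where X: "X \<in> C" "a \<in> fst X" "b \<in> fst X" by blast
    have "a * b \<in> snd X"
      using eq[OF X(1) subring_mult[OF loc(1)[OF X(1)] X(2,3)]] ab(3) by simp
    then show ?thesis using prime_dideal_mult[OF loc(3)[OF X(1)] X(2,3)] eq X by blast
  qed
  ultimately show "local_pair \<delta> Y" using ring by (auto simp: local_pair_def prime_dideal_def)
qed

theorem maximal_pair_exists:
  assumes X0: "local_pair \<delta> X0"
  obtains X where "local_pair \<delta> X" "dominates X0 X" "\<And>Y. local_pair \<delta> Y \<Longrightarrow> dominates X Y \<Longrightarrow> Y = X"
proof -
  let ?A = "{X. local_pair \<delta> X \<and> dominates X0 X}"
  have "\<exists>X\<in>?A. \<forall>Y\<in>?A. dominates X Y \<longrightarrow> Y = X"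
  proof (rule predicate_Zorn)
    show "partial_order_on ?A (relation_of dominates ?A)"
      by (rule partial_order_on_relation_ofI)
        (use dominates_refl dominates_antisym in blast, use dominates_trans in blast, use dominates_antisym in blast)
  next
    fix C assume C: "C \<in> Chains (relation_of dominates ?A)"
    show "\<exists>Y\<in>?A. \<forall>X\<in>C. dominates X Y"
    proof (cases "C = {}")
      case True
      then show ?thesis using X0 dominates_refl[OF X0] by blast
    next
      case False
      have CA: "X \<in> ?A" if "X \<in> C" for X
        using C that by (auto simp: Chains_def relation_of_def)
      have chain: "dominates X Y \<or> dominates Y X" if "X \<in> C" "Y \<in> C" for X Y
        using C that by (auto simp: Chains_def relation_of_def)
      have loc: "local_pair \<delta> X" if "X \<in> C" for X using CA[OF that] by simp
      have U1: "local_pair \<delta> (\<Union>(fst ` C), \<Union>(snd ` C))"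
        by (rule local_pair_Union(1)[OF False]) (use loc chain in blast)+
      have U2: "dominates X (\<Union>(fst ` C), \<Union>(snd ` C))" if "X \<in> C" for X
        by (rule local_pair_Union(2)[OF False _ _ that]) (use loc chain in blast)+
      obtain Z where Z: "Z \<in> C" using False by blast
      have "dominates X0 Z" using CA[OF Z] by simp
      from dominates_trans[OF this U2[OF Z]] U1
      show ?thesis using U2 by (intro bexI[OF _ CollectI] ballI conjI) auto
    qed
  qed
  then obtain X where XA: "X \<in> ?A" and max: "\<forall>Y\<in>?A. dominates X Y \<longrightarrow> Y = X" ..
  then have X: "local_pair \<delta> X" "dominates X0 X" by simp_all
  have "Y = X" if "local_pair \<delta> Y" "dominates X Y" for Y
    using bspec[OF max, of Y] dominates_trans[OF X(2) that(2)] that by simp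
  then show thesis by (rule that[OF X])
qed

context
  fixes \<delta> :: "'u::field \<Rightarrow> 'u" and R M :: "'u set"
  assumes der: "derivation \<delta>" and loc: "local_pair \<delta> (R, M)" and rat: "has_rationals R"
    and max: "\<And>Y. local_pair \<delta> Y \<Longrightarrow> dominates (R, M) Y \<Longrightarrow> Y = (R, M)"
begin

lemma pair_facts: "diff_subring \<delta> R" "is_subring R" "prime_dideal \<delta> R M" "dideal \<delta> R M"
  using loc prime_dideal_dideal[of \<delta> R M] by (auto simp: local_pair_def diff_subring_def)

text \<open>
  There is a prime differential ideal of \<open>R{x}\<close> that contains \<open>M\<close> and is disjoint from \<open>R - M\<close>.  It extends
  the specialization to \<open>R{x}\<close>, which by maximality is \<open>R\<close>.
\<close>

lemma mem_maximal_of_disjoint: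
  assumes disj: "gen_ideal M (adjoin \<delta> R x) \<inter> (R - M) = {}"
  shows "x \<in> R"
proof -
  let ?S = "adjoin \<delta> R x"
  note S = diff_subring_adjoin[OF der pair_facts(1), of x] and RS = adjoin_base[OF der pair_facts(1), of x]
  have sS: "is_subring ?S" using S by (simp add: diff_subring_def)
  have MR: "M \<subseteq> R" using dideal_subset[OF pair_facts(4)] by blast
  have rS: "has_rationals ?S" using rat RS by (fastforce simp: has_rationals_def)
  have id: "dideal \<delta> ?S (gen_ideal M ?S)"
    using MR RS by (intro dideal_gen_ideal[OF der S] dideal_D[OF pair_facts(4)]) auto
  obtain N where N: "prime_dideal \<delta> ?S N" "gen_ideal M ?S \<subseteq> N" "N \<inter> (R - M) = {}"
  proof (rule prime_dideal_exists[OF der S rS id _ _ _ disj])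
    show "R - M \<subseteq> ?S" using RS by blast
    show "1 \<in> R - M" using subring_1[OF pair_facts(2)] prime_dideal_1[OF pair_facts(3)] by blast
    show "a * b \<in> R - M" if "a \<in> R - M" "b \<in> R - M" for a b
      using that prime_dideal_mult[OF pair_facts(3)] subring_mult[OF pair_facts(2)] by blast
  qed
  have "m \<in> gen_ideal M ?S" if "m \<in> M" for m
    using gen_ideal_base[OF that subring_1[OF sS]] by simp
  then have "M \<subseteq> N" using N(2) by blast
  then have "N \<inter> R = M" using N(3) MR by blast
  then have "(?S, N) = (R, M)"
    using S N(1) RS by (intro max) (auto simp: local_pair_def dominates_def)
  then show ?thesis using adjoin_gen[OF der pair_facts(1), of x] by simp
qed

text \<open>
  A relation witnessing the contrary in \<open>R{1/s}\<close> becomes, after multiplication by a power of \<open>s\<close>, a relation in \<open>R\<close>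
  that contradicts the primality of \<open>M\<close>.  Maximal rings are therefore local.
\<close>

lemma inverse_mem_maximal:
  assumes s: "s \<in> R" "s \<notin> M"
  shows "inverse s \<in> R"
proof (rule mem_maximal_of_disjoint, rule ccontr)
  have s0: "s \<noteq> 0" using s dideal_0[OF pair_facts(4)] by auto
  assume "gen_ideal M (adjoin \<delta> R (inverse s)) \<inter> (R - M) \<noteq> {}"
  then obtain t where t: "t \<in> gen_ideal M (adjoin \<delta> R (inverse s))" "t \<in> R" "t \<notin> M" by blast
  have "\<exists>N. s ^ N * t \<in> M"
    using t(1)
  proof induction
    case zero
    then show ?case using dideal_0[OF pair_facts(4)] by simp
  next
    case (add m b a)
    then obtain N where N: "s ^ N * a \<in> M" by blast
    obtain N' where N': "s ^ N' * b \<in> R"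
      using adjoin_inverse_denominator[OF der pair_facts(1) s(1) s0 add(2)] by blast
    have "s ^ N * ((s ^ N' * b) * m) + s ^ N' * (s ^ N * a) \<in> M"
      using subring_power[OF pair_facts(2) s(1)]
      by (intro dideal_add[OF pair_facts(4)] dideal_mult[OF pair_facts(4)] N N' add(1)) auto
    then show ?case by (intro exI[of _ "N + N'"]) (simp add: power_add algebra_simps)
  qed
  then obtain N where "s ^ N * t \<in> M" by blast
  then have "s ^ N \<in> M"
    using prime_dideal_mult[OF pair_facts(3) subring_power[OF pair_facts(2) s(1)] t(2)] t(3) by blast
  then show False using prime_dideal_power[OF pair_facts(2,3) s(1)] s(2) by blast
qed

text \<open>
  The differential analogue of the fact that, for a valuation ring \<open>R\<close> and \<open>x \<notin> R\<close>, the inverse of \<open>x\<close> lies in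
  the maximal ideal.  The specialization does not extend to \<open>R{x}\<close>, so some \<open>t \<in> R - M\<close> lies in the ideal of
  \<open>R{x}\<close> generated by \<open>M\<close>; as \<open>t\<close> is a unit of \<open>R\<close>, so does \<open>1\<close>.
\<close>

theorem not_mem_maximal_relation:
  assumes x: "x \<notin> R"
  shows "\<exists>T c. finite T \<and> (\<forall>t\<in>T. c t \<in> M) \<and>
    (\<Sum>t\<in>T. c t * (\<Prod>k\<in>Poly_Mapping.keys t. (\<delta> ^^ k) x ^ Poly_Mapping.lookup t k)) = 1"
proof -
  let ?S = "adjoin \<delta> R x"
  note S = diff_subring_adjoin[OF der pair_facts(1), of x] and RS = adjoin_base[OF der pair_facts(1), of x]
  have MR: "M \<subseteq> R" using dideal_subset[OF pair_facts(4)] by blast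
  have id: "dideal \<delta> ?S (gen_ideal M ?S)"
    using MR RS by (intro dideal_gen_ideal[OF der S] dideal_D[OF pair_facts(4)]) auto
  have "gen_ideal M ?S \<inter> (R - M) \<noteq> {}" using mem_maximal_of_disjoint x by blast
  then obtain t where t: "t \<in> gen_ideal M ?S" "t \<in> R" "t \<notin> M" by blast
  have "t \<noteq> 0" using t(3) dideal_0[OF pair_facts(4)] by auto
  moreover have "inverse t * t \<in> gen_ideal M ?S"
    using inverse_mem_maximal[OF t(2,3)] RS by (intro dideal_mult[OF id] t(1)) auto
  ultimately have "1 \<in> gen_ideal M ?S" by simp
  from gen_ideal_adjoin_poly[OF der pair_facts(1,4) this] obtain p :: "(unit, 'u) dpoly"
    where p: "\<And>\<mu>. Poly_Mapping.lookup p \<mu> \<in> M" "deval \<delta> (\<lambda>_. x) p = 1" by blast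
  let ?emb = "\<lambda>k::nat. ((), k)"
  have emb: "inj ?emb" by (simp add: inj_def)
  define \<phi> :: "unit dmonom \<Rightarrow> (nat \<Rightarrow>\<^sub>0 nat)" where "\<phi> = Poly_Mapping.map_key ?emb"
  have look: "Poly_Mapping.lookup (\<phi> \<mu>) k = Poly_Mapping.lookup \<mu> ((), k)" for \<mu> k
    by (simp add: \<phi>_def map_key.rep_eq[OF emb])
  have inj: "inj \<phi>"
  proof
    fix \<mu> \<nu> assume "\<phi> \<mu> = \<phi> \<nu>"
    then have "Poly_Mapping.lookup \<mu> ((), k) = Poly_Mapping.lookup \<nu> ((), k)" for k
      by (metis look)
    then show "\<mu> = \<nu>" by (intro poly_mapping_eqI) auto
  qed
  have keys: "Poly_Mapping.keys \<mu> = ?emb ` Poly_Mapping.keys (\<phi> \<mu>)" for \<mu>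
    by (auto simp: in_keys_iff look image_iff)
  have "(\<Sum>\<mu>\<in>Poly_Mapping.keys p. Poly_Mapping.lookup p \<mu> *
      (\<Prod>k\<in>Poly_Mapping.keys (\<phi> \<mu>). (\<delta> ^^ k) x ^ Poly_Mapping.lookup (\<phi> \<mu>) k)) = deval \<delta> (\<lambda>_. x) p"
    unfolding dsubst_def
  proof (intro sum.cong refl arg_cong2[where f = "(*)"])
    fix \<mu>
    show "(\<Prod>k\<in>Poly_Mapping.keys (\<phi> \<mu>). (\<delta> ^^ k) x ^ Poly_Mapping.lookup (\<phi> \<mu>) k) =
      (\<Prod>(v, k)\<in>Poly_Mapping.keys \<mu>. (\<delta> ^^ k) x ^ Poly_Mapping.lookup \<mu> (v, k))"
      unfolding keys[of \<mu>] by (subst prod.reindex) (auto simp: inj_on_def look)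
  qed
  then have "(\<Sum>t\<in>\<phi> ` Poly_Mapping.keys p. Poly_Mapping.lookup p (inv \<phi> t) *
      (\<Prod>k\<in>Poly_Mapping.keys t. (\<delta> ^^ k) x ^ Poly_Mapping.lookup t k)) = 1"
    using p(2) inj by (subst sum.reindex) (auto simp: inj_on_def)
  then show ?thesis using p(1)
    by (intro exI[of _ "\<phi> ` Poly_Mapping.keys p"] exI[of _ "\<lambda>t. Poly_Mapping.lookup p (inv \<phi> t)"]) auto
qed

end

context dcf_universe begin

section \<open>The elimination property implies completeness\<close>

text \<open>
  Modulo \<open>M\<close> all variables specialize to \<open>0\<close>.
\<close>

lemma deval_infinitesimal_argument:
  assumes R: "diff_subring \<delta> R" "F \<subseteq> R" and M: "dideal \<delta> R M"
    and s: "\<And>v. v \<in> vs \<Longrightarrow> s v \<in> M" and p: "p \<in> dpolys F vs"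
  shows "deval \<delta> s p - constant_term p \<in> M"
proof -
  have sR: "is_subring R" using R by (simp add: diff_subring_def)
  have DM: "(\<delta> ^^ k) m \<in> M" if "m \<in> M" for m k
    using that by (induction k) (auto intro: dideal_D[OF M])
  have D0: "(\<delta> ^^ k) 0 = 0" for k by (induction k) (auto simp: derivation_0[OF der])
  have "deval \<delta> s p - deval \<delta> (\<lambda>_. 0) p \<in> M \<and> deval \<delta> s p \<in> R \<and> deval \<delta> (\<lambda>_. 0) p \<in> R"
    using p
  proof (induction rule: dpolys_induct)
    case (const c)
    then show ?case using R dideal_0[OF M] by (auto simp: deval_dconst)
  next
    case (var v k)
    then show ?case
      using DM[OF s] dideal_subset[OF M] subring_0[OF sR] by (simp add: deval_dvar D0)
  next
    case (add p q)
    let ?p = "deval \<delta> s p" and ?q = "deval \<delta> s q" and ?pc = "deval \<delta> (\<lambda>_. 0) p" and ?qc = "deval \<delta> (\<lambda>_. 0) q"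
    have "(?p - ?pc) + (?q - ?qc) \<in> M" using add dideal_add[OF M, of "?p - ?pc" "?q - ?qc"] by blast
    then show ?case using add subring_add[OF sR] by (simp add: deval_add algebra_simps)
  next
    case (mult p q)
    let ?p = "deval \<delta> s p" and ?q = "deval \<delta> s q" and ?pc = "deval \<delta> (\<lambda>_. 0) p" and ?qc = "deval \<delta> (\<lambda>_. 0) q"
    have "(?p - ?pc) * ?q + ?pc * (?q - ?qc) \<in> M"
      using mult dideal_add[OF M dideal_mult'[OF M, of ?q "?p - ?pc"] dideal_mult[OF M, of ?pc "?q - ?qc"]] by blast
    then show ?case using mult subring_mult[OF sR] by (simp add: deval_mult algebra_simps)
  qed (rule F_ring)
  then show ?thesis by (simp add: deval_zero_point[OF der])
qed

lemma diff_ideal_vanishes: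
  assumes D: "D \<subseteq> dpolys F vs" and z: "\<And>p. p \<in> D \<Longrightarrow> deval \<delta> s p = 0" and p: "p \<in> diff_ideal \<delta> (dpolys F vs) D"
  shows "deval \<delta> s p = 0"
proof -
  have "D \<subseteq> {g \<in> dpolys F vs. deval \<delta> s g = 0}" using D z by blast
  from diff_ideal_minimal[OF prime_dideal_dideal[OF prime_dideal_vanishing] this] p show ?thesis by blast
qed

lemma local_pair_image:
  assumes N: "prime_dideal (dderiv \<delta>) (dpolys F vs) N"
    and iff: "\<And>g. g \<in> dpolys F vs \<Longrightarrow> deval \<delta> s g \<in> M \<longleftrightarrow> g \<in> N" and M: "M = deval \<delta> s ` N"
  shows "local_pair \<delta> (deval \<delta> s ` dpolys F vs, M)"
proof -
  note iN = prime_dideal_dideal[OF N]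
  let ?R = "deval \<delta> s ` dpolys F vs"
  have ev1: "deval \<delta> s 1 = 1" and ev0: "deval \<delta> s 0 = 0"
    using deval_dconst[of \<delta> s 1] deval_dconst[of \<delta> s 0] by (simp_all add: dconst_def)
  have dR: "dderiv \<delta> g \<in> dpolys F vs" if "g \<in> dpolys F vs" for g
    using dpolys_dring[of vs] that by (simp add: diff_subring_def)
  have 1: "1 \<in> ?R" using subring_1[OF dpolys_ring] ev1 by (metis imageI)
  have ring: "diff_subring \<delta> ?R"
    unfolding diff_subring_def is_subring_def
  proof (intro conjI ballI 1)
    fix a b assume "a \<in> ?R" "b \<in> ?R"
    then obtain f g where "f \<in> dpolys F vs" "g \<in> dpolys F vs" "a = deval \<delta> s f" "b = deval \<delta> s g" by blast
    then show "a - b \<in> ?R" "a * b \<in> ?R"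
      by (simp_all add: imageI subring_diff[OF dpolys_ring] subring_mult[OF dpolys_ring] flip: deval_diff deval_mult)
  next
    fix a assume "a \<in> ?R"
    then show "\<delta> a \<in> ?R" using dR by (auto simp flip: deval_dderiv[OF der])
  qed
  have "dideal \<delta> ?R M"
    unfolding dideal_def
  proof (intro conjI ballI)
    show "M \<subseteq> ?R" using dideal_subset[OF iN] by (auto simp: M)
    show "0 \<in> M" using dideal_0[OF iN] ev0 unfolding M by (metis imageI)
  next
    fix a b assume "a \<in> M" "b \<in> M"
    then show "a + b \<in> M" using dideal_add[OF iN] by (auto simp: M simp flip: deval_add)
  next
    fix r a assume "r \<in> ?R" "a \<in> M"
    then show "r * a \<in> M" using dideal_mult[OF iN] by (auto simp: M simp flip: deval_mult)
  next
    fix a assume "a \<in> M"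
    then show "\<delta> a \<in> M" using dideal_D[OF iN] by (auto simp: M simp flip: deval_dderiv[OF der])
  qed
  moreover have "1 \<notin> M" using iff[OF subring_1[OF dpolys_ring]] prime_dideal_1[OF N] ev1 by simp
  moreover have "a \<in> M \<or> b \<in> M" if ab: "a \<in> ?R" "b \<in> ?R" "a * b \<in> M" for a b
  proof -
    from ab obtain f g where fg: "f \<in> dpolys F vs" "g \<in> dpolys F vs" "a = deval \<delta> s f" "b = deval \<delta> s g" by blast
    then have "f * g \<in> N" using iff[OF subring_mult[OF dpolys_ring fg(1,2)]] ab(3) by (simp add: deval_mult)
    then show ?thesis using prime_dideal_mult[OF N fg(1,2)] fg by (auto simp: M)
  qed
  ultimately show ?thesis using ring by (simp add: local_pair_def prime_dideal_def)
qed

lemma prime_dideal_preimage: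
  assumes R: "diff_subring \<delta> R" "F \<subseteq> R" and M: "prime_dideal \<delta> R M" and r: "\<And>v. v \<in> vs \<Longrightarrow> r v \<in> R"
  shows "prime_dideal (dderiv \<delta>) (dpolys F vs) {h \<in> dpolys F vs. deval \<delta> r h \<in> M}"
proof -
  note iM = prime_dideal_dideal[OF M]
  have evR: "deval \<delta> r h \<in> R" if "h \<in> dpolys F vs" for h
  proof -
    have "h \<in> dpolys R vs" using that R(2) by (auto simp: dpolys_def)
    then show ?thesis using r by (rule deval_in[OF R(1)])
  qed
  have ev1: "deval \<delta> r 1 = 1" and ev0: "deval \<delta> r 0 = 0"
    using deval_dconst[of \<delta> r 1] deval_dconst[of \<delta> r 0] by (simp_all add: dconst_def)
  have dR: "dderiv \<delta> g \<in> dpolys F vs" if "g \<in> dpolys F vs" for g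
    using dpolys_dring[of vs] that by (simp add: diff_subring_def)
  show ?thesis
    unfolding prime_dideal_def dideal_def
    using prime_dideal_mult[OF M evR evR] prime_dideal_1[OF M]
    by (auto simp: deval_add deval_mult deval_dderiv[OF der] ev0 ev1 dR dideal_0[OF iM]
        subring_0[OF dpolys_ring] subring_add[OF dpolys_ring] subring_mult[OF dpolys_ring]
        intro: dideal_add[OF iM] dideal_mult[OF iM evR] dideal_D[OF iM])
qed

text \<open>
  A point \<open>b\<close> in the closure of the projection is a specialization over \<open>F\<close> of a point \<open>b'\<close> of the projection.
  Consider the differential ideals generated by \<open>S\<close>, \<open>x\<^sub>i - 1\<close> and \<open>y\<^sub>k - 1\<close>.  If one of them contains no
  polynomial \<open>g\<close> in \<open>y\<close> with \<open>g b \<noteq> 0\<close>, a generic point of a prime ideal above it is as required.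
  Otherwise choose such a \<open>g\<^sub>i\<close> in each of them.  The product of the \<open>g\<^sub>i\<close>, homogenized, vanishes on the
  whole projection, because every point has a coordinate \<open>x\<^sub>i \<noteq> 0\<close>; but it does not vanish at \<open>b\<close>.
\<close>

lemma specialization_exists:
  assumes S: "S \<subseteq> proj_proj_equations \<delta> F n l" and b: "b \<in> hom_coords l" and k: "k \<le> l" "b k = 1"
    and cl: "\<And>p. p \<in> proj_equations \<delta> F l \<Longrightarrow>
      (\<And>a' b'. a' \<in> hom_coords n \<Longrightarrow> b' \<in> hom_coords l \<Longrightarrow> \<forall>q\<in>S. deval \<delta> (case_coord a' b') q = 0 \<Longrightarrow>
        deval \<delta> (case_coord b' (\<lambda>_. 0)) p = 0) \<Longrightarrow> deval \<delta> (case_coord b (\<lambda>_. 0)) p = 0"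
  shows "\<exists>a' b'. a' \<in> hom_coords n \<and> b' \<in> hom_coords l \<and> (\<forall>q\<in>S. deval \<delta> (case_coord a' b') q = 0) \<and>
    (\<forall>g\<in>dpolys F (YV ` {0..l}). deval \<delta> (case_coord a' b') g = 0 \<longrightarrow> deval \<delta> (case_coord a' b) g = 0)"
proof -
  let ?vs = "XV ` {0..n} \<union> YV ` {0..l}" and ?ys = "YV ` {0..l}"
  let ?R = "dpolys F ?vs"
  define Si where "Si i = S \<union> {dvar (XV i) 0 - 1, dvar (YV k) 0 - 1}" for i
  have ev1: "deval \<delta> a 1 = 1" for a :: "coord \<Rightarrow> 'u"
    using deval_dconst[of \<delta> a 1] by (simp add: dconst_def)
  have YR: "p \<in> ?R" if "p \<in> dpolys F ?ys" for p
    using that dpolys_mono[of ?ys ?vs F] by blast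
  have SR: "p \<in> ?R" if "p \<in> S" for p using that S by (auto simp: proj_proj_equations_def)
  have SiR: "Si i \<subseteq> ?R" if "i \<le> n" for i
    using that k(1) SR unfolding Si_def
    by (auto intro!: subring_diff[OF dpolys_ring] dpolys_dvar[OF F_ring] subring_1[OF dpolys_ring])
  define M where "M = {g \<in> dpolys F ?ys. deval \<delta> (case_coord (\<lambda>_. 0) b) g \<noteq> 0}"
  have Ycong: "deval \<delta> (case_coord a b') g = deval \<delta> (case_coord a' b') g" if "g \<in> dpolys F ?ys" for a a' b' g
    by (rule deval_cong[OF that]) auto
  have M_mult: "f * g \<in> M" if "f \<in> M" "g \<in> M" for f g
    using that subring_mult[OF dpolys_ring] by (auto simp: M_def deval_mult)
  have M1: "1 \<in> M" using subring_1[OF dpolys_ring] by (simp add: M_def ev1)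
  have MR: "M \<subseteq> ?R" using YR by (auto simp: M_def)
  show ?thesis
  proof (cases "\<exists>i\<le>n. diff_ideal \<delta> ?R (Si i) \<inter> M = {}")
    case True
    then obtain i where i: "i \<le> n" "diff_ideal \<delta> ?R (Si i) \<inter> M = {}" by blast
    note J = dideal_diff_ideal[OF der dpolys_dring SiR[OF i(1)]]
    obtain I where I: "prime_dideal (dderiv \<delta>) ?R I" "diff_ideal \<delta> ?R (Si i) \<subseteq> I" "I \<inter> M = {}"
      by (rule prime_dideal_exists[OF derivation_dderiv[OF der] dpolys_dring dpolys_rationals J(1) MR M1 M_mult i(2)])
    obtain s where s: "generic_for I ?vs s" using generic_point[OF _ I(1)] by auto
    define a' b' where "a' j = (if j \<le> n then s (XV j) else 0)" and "b' j = (if j \<le> l then s (YV j) else 0)" for j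
    have ev: "deval \<delta> (case_coord a' b') p = deval \<delta> s p" if "p \<in> ?R" for p
      by (rule deval_cong[OF that]) (auto simp: a'_def b'_def)
    have z: "deval \<delta> (case_coord a' b') p = 0" if "p \<in> Si i" for p
    proof -
      have "p \<in> ?R" using that SiR[OF i(1)] by blast
      moreover have "p \<in> I" using that J(2) I(2) by blast
      ultimately show ?thesis using s ev by (simp add: generic_for_def)
    qed
    have "a' i = 1" "b' k = 1"
      using z[of "dvar (XV i) 0 - 1"] z[of "dvar (YV k) 0 - 1"] by (simp_all add: Si_def deval_diff deval_dvar ev1)
    then have "\<exists>j\<le>n. a' j \<noteq> 0" "\<exists>j\<le>l. b' j \<noteq> 0"
      using i(1) k(1) by (metis zero_neq_one)+
    then have "a' \<in> hom_coords n" "b' \<in> hom_coords l"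
      by (simp_all add: hom_coords_def a'_def b'_def)
    moreover have "\<forall>q\<in>S. deval \<delta> (case_coord a' b') q = 0" using z by (simp add: Si_def)
    moreover have "deval \<delta> (case_coord a' b) g = 0"
      if g: "g \<in> dpolys F ?ys" "deval \<delta> (case_coord a' b') g = 0" for g
    proof -
      have "g \<in> I" using s g YR[OF g(1)] ev by (simp add: generic_for_def)
      then have "g \<notin> M" using I(3) by blast
      then show ?thesis using g(1) Ycong[OF g(1), of a' b "\<lambda>_. 0"] by (simp add: M_def)
    qed
    ultimately show ?thesis by blast
  next
    case False
    then have "\<forall>i\<in>{..n}. \<exists>g. g \<in> diff_ideal \<delta> ?R (Si i) \<and> g \<in> M" by blast
    from bchoice[OF this] obtain g where g: "\<forall>i\<in>{..n}. g i \<in> diff_ideal \<delta> ?R (Si i) \<and> g i \<in> M" ..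
    define G where "G = prod g {..n}"
    have "prod g A \<in> M" if "finite A" "A \<subseteq> {..n}" for A
      using that by (induction A rule: finite_induct) (use g M1 M_mult in auto)
    then have G: "G \<in> M" by (simp add: G_def)
    have GY: "G \<in> dpolys F ?ys" using G by (simp add: M_def)
    obtain h N where h: "h \<in> dpolys F ?ys" "hom_deg \<delta> ?ys h N"
      "\<And>a. a (YV k) = 0 \<Longrightarrow> deval \<delta> a h = 0"
      "\<And>a. a (YV k) \<noteq> 0 \<Longrightarrow> deval \<delta> a h = a (YV k) ^ N * deval \<delta> (\<lambda>v. if v \<in> ?ys then a v / a (YV k) else a v) G"
      by (rule homogenization[OF GY, of "YV k" ?ys], use k(1) in simp, use k(1) in simp, rule that)
    \<comment> \<open>Equations of closed sets in \<open>\<P>\<^sup>l\<close> are written in the variables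
        \<open>XV i\<close>.\<close>
    define h' where "h' = dcomp \<delta> (case_coord (\<lambda>_. 0) (\<lambda>i. dvar (XV i) 0)) h"
    have h': "deval \<delta> (case_coord a c) h' = deval \<delta> (case_coord c' a) h" for a c c'
    proof -
      have "deval \<delta> (case_coord a c) h' =
          deval \<delta> (\<lambda>v. deval \<delta> (case_coord a c) (case_coord (\<lambda>_. 0) (\<lambda>i. dvar (XV i) 0) v)) h"
        unfolding h'_def by (rule deval_dcomp[OF der])
      also have "\<dots> = deval \<delta> (case_coord c' a) h"
        by (rule deval_cong[OF h(1)]) (auto simp: deval_dvar)
      finally show ?thesis .
    qed
    have h'F: "h' \<in> dpolys F (XV ` {0..l})"
      unfolding h'_def by (rule dcomp_dpolys[OF der F_dring h(1)]) (auto intro!: dpolys_dvar[OF F_ring])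
    have hs: "deval \<delta> (case_coord c (\<lambda>i. e * a i)) h = e ^ N * deval \<delta> (case_coord c a) h" if "e \<noteq> 0" for c e a
      using deval_scale_y[of h F "{}" l \<delta> N e c a] h(1,2) that by simp
    have "hom_deg \<delta> (XV ` {0..l}) h' N"
      unfolding hom_deg_def
    proof (intro allI impI)
      fix e :: 'u and a :: "coord \<Rightarrow> 'u" assume e: "e \<noteq> 0"
      have "deval \<delta> (\<lambda>v. if v \<in> XV ` {0..l} then e * a v else a v) h' =
          deval \<delta> (case_coord (\<lambda>i. e * a (XV i)) (\<lambda>_. 0)) h'"
        by (rule deval_cong[OF h'F]) auto
      also have "\<dots> = deval \<delta> (case_coord (\<lambda>_. 0) (\<lambda>i. e * a (XV i))) h" by (rule h')
      also have "\<dots> = e ^ N * deval \<delta> (case_coord (\<lambda>_. 0) (\<lambda>i. a (XV i))) h" by (rule hs[OF e])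
      also have "deval \<delta> (case_coord (\<lambda>_. 0) (\<lambda>i. a (XV i))) h = deval \<delta> (case_coord (\<lambda>i. a (XV i)) (\<lambda>_. 0)) h'"
        by (rule h'[symmetric])
      also have "deval \<delta> (case_coord (\<lambda>i. a (XV i)) (\<lambda>_. 0)) h' = deval \<delta> a h'"
        by (rule deval_cong[OF h'F]) auto
      finally show "deval \<delta> (\<lambda>v. if v \<in> XV ` {0..l} then e * a v else a v) h' = e ^ N * deval \<delta> a h'" .
    qed
    then have "h' \<in> proj_equations \<delta> F l"
      using h'F delta_homogeneous_iff[of "XV ` {0..l}" h' "XV ` {0..l}"] by (auto simp: proj_equations_def)
    then have "deval \<delta> (case_coord b (\<lambda>_. 0)) h' = 0"
    proof (rule cl)
      fix a' b' assume ab: "a' \<in> hom_coords n" "b' \<in> hom_coords l" "\<forall>q\<in>S. deval \<delta> (case_coord a' b') q = 0"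
      show "deval \<delta> (case_coord b' (\<lambda>_. 0)) h' = 0"
        unfolding h'[of _ _ a']
      proof (cases "b' k = 0")
        case False
        obtain i where i: "i \<le> n" "a' i \<noteq> 0" using ab(1) by (auto simp: hom_coords_def)
        let ?a = "\<lambda>j. inverse (a' i) * a' j" and ?b = "\<lambda>j. inverse (b' k) * b' j"
        have "deval \<delta> (case_coord ?a ?b) q = 0" if "q \<in> Si i" for q
        proof (cases "q \<in> S")
          case True
          then show ?thesis
            using proj_proj_equations_scale[of q n l "inverse (a' i)" "inverse (b' k)" a' b'] S ab(3) i False by auto
        next
          case False
          then have "q = dvar (XV i) 0 - 1 \<or> q = dvar (YV k) 0 - 1" using that by (auto simp: Si_def)
          then show ?thesis using i \<open>b' k \<noteq> 0\<close> by (auto simp: deval_diff deval_dvar ev1)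
        qed
        then have "deval \<delta> (case_coord ?a ?b) (g i) = 0"
          using diff_ideal_vanishes[OF SiR[OF i(1)]] g i(1) by blast
        then have G0: "deval \<delta> (case_coord ?a ?b) G = 0"
          unfolding G_def deval_prod using i(1) by (intro prod_zero) auto
        have "deval \<delta> (\<lambda>v. if v \<in> ?ys then case_coord a' b' v / case_coord a' b' (YV k) else case_coord a' b' v) G
            = deval \<delta> (case_coord ?a ?b) G"
          by (rule deval_cong[OF GY]) (auto simp: field_simps)
        then show "deval \<delta> (case_coord a' b') h = 0"
          using h(4)[of "case_coord a' b'"] False G0 by simp
      qed (simp add: h(3))
    qed
    then have "deval \<delta> (case_coord (\<lambda>_. 0) b) h = 0" using h'[of b "\<lambda>_. 0" "\<lambda>_. 0"] by simp
    moreover have "deval \<delta> (\<lambda>v. if v \<in> ?ys then case_coord (\<lambda>_. 0) b v / case_coord (\<lambda>_. 0) b (YV k) else case_coord (\<lambda>_. 0) b v) G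
        = deval \<delta> (case_coord (\<lambda>_. 0) b) G"
      by (rule deval_cong[OF GY]) (auto simp: k(2))
    ultimately have "deval \<delta> (case_coord (\<lambda>_. 0) b) G = 0"
      using h(4)[of "case_coord (\<lambda>_. 0) b"] k(2) by simp
    then show ?thesis using G by (simp add: M_def)
  qed
qed

text \<open>
  If no affine chart contains the point with all its coordinates in \<open>R\<close>, every \<open>i\<close> with \<open>a\<^sub>i \<noteq> 0\<close> has some \<open>j\<close> with
  \<open>a\<^sub>j / a\<^sub>i \<notin> R\<close>, and hence a relation expressing \<open>1\<close> by monomials in \<open>a\<^sub>j / a\<^sub>i\<close> with coefficients in \<open>M\<close>.
  These coefficients are the \<open>y\<close>-coordinates of a point of a member of \<open>\<W>\<close> over \<open>a\<close>.  A polynomial \<open>g\<close> in the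
  elimination ideal vanishes at them; as they specialize to \<open>0\<close>, the constant term of \<open>g\<close> lies in \<open>M\<close>.
\<close>

lemma bounded_chart_exists:
  assumes loc: "local_pair \<delta> (R, M)" and FR: "F \<subseteq> R"
    and max: "\<And>Y. local_pair \<delta> Y \<Longrightarrow> dominates (R, M) Y \<Longrightarrow> Y = (R, M)"
    and P: "P \<subseteq> proj_equations \<delta> F n"
    and a: "a \<in> hom_coords n" "\<And>p. p \<in> P \<Longrightarrow> deval \<delta> (case_coord a (\<lambda>_. 0)) p = 0"
    and elim: "\<And>m W D. (m, W, D) \<in> W_collection \<delta> n P \<Longrightarrow>
      \<exists>g\<in>elim_ideal F n m (diff_ideal \<delta> (dpolys F (XV ` {0..n} \<union> YV ` {1..m})) D). constant_term g \<noteq> 0"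
  shows "\<exists>i\<le>n. a i \<noteq> 0 \<and> (\<forall>j\<le>n. a j / a i \<in> R)"
proof (rule ccontr)
  assume neg: "\<not> (\<exists>i\<le>n. a i \<noteq> 0 \<and> (\<forall>j\<le>n. a j / a i \<in> R))"
  have R: "diff_subring \<delta> R" "is_subring R" and M: "prime_dideal \<delta> R M" "dideal \<delta> R M"
    using loc prime_dideal_dideal[of \<delta> R M] by (auto simp: local_pair_def diff_subring_def)
  have rat: "has_rationals R"
    unfolding has_rationals_def using FR F_rationals[unfolded has_rationals_def] by blast
  define E where "E = {i. i \<le> n \<and> a i \<noteq> 0}"
  have E: "E \<noteq> {}" "E \<subseteq> {0..n}" using a(1) by (auto simp: E_def hom_coords_def)
  have "\<forall>i\<in>E. \<exists>j. j \<le> n \<and> a j / a i \<notin> R" using neg by (auto simp: E_def)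
  from bchoice[OF this] obtain j where j: "\<forall>i\<in>E. j i \<le> n \<and> a (j i) / a i \<notin> R" ..
  have ji: "j i \<noteq> i" if "i \<in> E" for i
    using j that subring_1[OF R(2)] by (force simp: E_def)
  let ?eval = "\<lambda>i t. \<Prod>k\<in>Poly_Mapping.keys t. (\<delta> ^^ k) (a (j i) / a i) ^ Poly_Mapping.lookup t k"
  have "\<forall>i\<in>E. \<exists>Tc. finite (fst Tc) \<and> (\<forall>t\<in>fst Tc. snd Tc t \<in> M) \<and> (\<Sum>t\<in>fst Tc. snd Tc t * ?eval i t) = 1"
  proof
    fix i assume "i \<in> E"
    then have "a (j i) / a i \<notin> R" using j by blast
    from not_mem_maximal_relation[OF der loc rat max this]
    show "\<exists>Tc. finite (fst Tc) \<and> (\<forall>t\<in>fst Tc. snd Tc t \<in> M) \<and> (\<Sum>t\<in>fst Tc. snd Tc t * ?eval i t) = 1"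
      by simp
  qed
  from bchoice[OF this] obtain Tc where
    Tc: "\<forall>i\<in>E. finite (fst (Tc i)) \<and> (\<forall>t\<in>fst (Tc i). snd (Tc i) t \<in> M) \<and>
      (\<Sum>t\<in>fst (Tc i). snd (Tc i) t * ?eval i t) = 1" ..
  define T where "T i = fst (Tc i)" for i
  have fin: "finite (SIGMA i:E. T i)"
    using Tc E(2) finite_subset[OF E(2)] by (auto simp: T_def)
  define m where "m = card (SIGMA i:E. T i)"
  obtain nu where nu: "bij_betw nu {1..m} (SIGMA i:E. T i)"
    using ex_bij_betw_nat_finite_1[OF fin] by (auto simp: m_def)
  define lab where "lab = inv_into {1..m} nu"
  have lab: "bij_betw lab (SIGMA i:E. T i) {1..m}"
    unfolding lab_def by (rule bij_betw_inv_into[OF nu])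
  \<comment> \<open>The variable numbered by \<open>(i, t)\<close> receives the coefficient of the monomial
      \<open>t\<close> in the relation for \<open>i\<close>.\<close>
  define y where "y r = (if r \<in> {1..m} then snd (Tc (fst (nu r))) (snd (nu r)) else 0)" for r
  have y_lab: "y (lab (i, t)) = snd (Tc i) t" if "i \<in> E" "t \<in> T i" for i t
  proof -
    have it: "(i, t) \<in> (SIGMA i:E. T i)" using that by simp
    then have "nu (lab (i, t)) = (i, t)"
      unfolding lab_def by (rule bij_betw_inv_into_right[OF nu])
    then show ?thesis using bij_betwE[OF lab] it by (auto simp: y_def)
  qed
  have yM: "y r \<in> M" if "r \<in> {1..m}" for r
  proof -
    have "nu r \<in> (SIGMA i:E. T i)" using bij_betwE[OF nu] that by blast
    then show ?thesis using Tc that by (auto simp: y_def T_def)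
  qed
  let ?S = "dpolys F (XV ` {0..n} \<union> YV ` {1..m})"
  define D where "D = {dvar (XV i) 0 | i. i \<in> {0..n} - E} \<union>
      {cleared \<delta> i (j i) (T i) (\<lambda>t. lab (i, t)) | i. i \<in> E} \<union> P"
  have "\<forall>i\<in>E. finite (T i)" using Tc by (simp add: T_def)
  moreover have "\<forall>i\<in>E. j i \<le> n \<and> j i \<noteq> i" using j ji by blast
  ultimately have "(m, proj_aff_zeros \<delta> n m D, D) \<in> W_collection \<delta> n P"
    unfolding W_collection_def mem_Collect_eq using E lab D_def
    by (intro exI[of _ m] exI[of _ "proj_aff_zeros \<delta> n m D"] exI[of _ D]
      exI[of _ E] exI[of _ j] exI[of _ T] exI[of _ lab] conjI refl)
  from elim[OF this] obtain g where
    g: "g \<in> elim_ideal F n m (diff_ideal \<delta> ?S D)" "constant_term g \<noteq> 0" by blast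
  have D_zero: "deval \<delta> (case_coord a y) p = 0" if pD: "p \<in> D" for p
  proof -
    consider (x) i where "i \<in> {0..n} - E" "p = dvar (XV i) 0"
      | (c) i where "i \<in> E" "p = cleared \<delta> i (j i) (T i) (\<lambda>t. lab (i, t))" | (P) "p \<in> P"
      using pD unfolding D_def by blast
    then show ?thesis
    proof cases
      case x
      then show ?thesis by (auto simp: E_def deval_dvar)
    next
      case c
      have nz: "case_coord a y (XV i) \<noteq> 0" using c(1) by (simp add: E_def)
      have "(\<Sum>t\<in>T i. y (lab (i, t)) * ?eval i t) = (\<Sum>t\<in>T i. snd (Tc i) t * ?eval i t)"
        using y_lab[OF c(1)] by (intro sum.cong) auto
      also have "\<dots> = 1" using Tc c(1) by (simp add: T_def)
      finally show ?thesis
        using deval_cleared[where a = "case_coord a y" and i = i, OF der nz, of "T i" "j i" "\<lambda>t. lab (i, t)"] Tc c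
        by (simp add: T_def)
    next
      case P
      then show ?thesis using proj_equations_deval[OF subsetD[OF assms(4) P], of a y] a(2) by simp
    qed
  qed
  have DS: "D \<subseteq> ?S"
    unfolding D_def
  proof (intro Un_least subsetI)
    fix p :: "(coord, 'u) dpoly" assume "p \<in> {dvar (XV i) 0 | i. i \<in> {0..n} - E}"
    then show "p \<in> ?S"
      by (auto intro!: dpolys_dvar[OF F_ring])
  next
    fix p :: "(coord, 'u) dpoly" assume "p \<in> {cleared \<delta> i (j i) (T i) (\<lambda>t. lab (i, t)) | i. i \<in> E}"
    then obtain i where i: "i \<in> E" "p = cleared \<delta> i (j i) (T i) (\<lambda>t. lab (i, t))" by blast
    then have "\<forall>t\<in>T i. lab (i, t) \<in> {1..m}" using bij_betwE[OF lab] by auto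
    then show "p \<in> ?S"
      unfolding i(2) using i(1) j E by (intro cleared_dpolys) auto
  next
    fix p assume "p \<in> P"
    then show "p \<in> ?S"
      using proj_equationsD(1) P dpolys_XV_subset by blast
  qed
  obtain i where i: "i \<in> E" using E(1) by blast
  then obtain e where e: "dvar (XV i) 0 ^ e * g \<in> diff_ideal \<delta> ?S D"
    using g(1) E(2) by (auto simp: elim_ideal_def)
  from diff_ideal_vanishes[OF DS D_zero e] have "deval \<delta> (case_coord a y) g = 0"
    using i by (simp add: deval_mult deval_power deval_dvar E_def)
  moreover have "deval \<delta> (case_coord a y) g - constant_term g \<in> M"
    using g(1) yM by (intro deval_infinitesimal_argument[OF R(1) FR M(2), of "YV ` {1..m}"]) (auto simp: elim_ideal_def)
  ultimately have cM: "- constant_term g \<in> M" by simp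
  have "constant_term g \<in> F"
    using g(1) apolys_lookup[OF F_ring] by (auto simp: elim_ideal_def constant_term_def dpolys_eq_apolys)
  then have "- inverse (constant_term g) \<in> R"
    using F_field FR subring_uminus[OF F_ring] by (auto simp: delta_subfield_def)
  from dideal_mult[OF M(2) this cM] have "1 \<in> M" using g(2) by simp
  then show False using prime_dideal_1[OF M(1)] by simp
qed

text \<open>
  With the coordinates \<open>a'\<^sub>j / a'\<^sub>i\<close> and \<open>b'\<close> in \<open>R\<close>, the specialization can be applied to them.  The polynomials
  with values in \<open>M\<close> form a prime differential ideal, and \<open>b\<close> is a generic point of its part in \<open>y\<close>, so
  it extends to a generic point \<open>(a, b)\<close> of the whole ideal.
\<close>

lemma specialize_bounded_point:
  assumes loc: "local_pair \<delta> (R, M)" and FR: "F \<subseteq> R" and S: "S \<subseteq> proj_proj_equations \<delta> F n l"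
    and ab: "\<forall>q\<in>S. deval \<delta> (case_coord a' b') q = 0"
    and i: "i \<le> n" "a' i \<noteq> 0" "\<And>j. j \<le> n \<Longrightarrow> a' j / a' i \<in> R" and b': "\<And>j. j \<le> l \<Longrightarrow> b' j \<in> R"
    and spec: "\<And>g. g \<in> dpolys F (YV ` {0..l}) \<Longrightarrow> deval \<delta> (case_coord a' b') g \<in> M \<longleftrightarrow> deval \<delta> (case_coord a' b) g = 0"
  shows "\<exists>a\<in>hom_coords n. \<forall>q\<in>S. deval \<delta> (case_coord a b) q = 0"
proof -
  let ?ys = "YV ` {0..l}" and ?vs = "XV ` {0..n} \<union> YV ` {0..l}"
  let ?r = "case_coord (\<lambda>j. inverse (a' i) * a' j) b'"
  have R: "diff_subring \<delta> R" and M: "prime_dideal \<delta> R M" "dideal \<delta> R M"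
    using loc prime_dideal_dideal[of \<delta> R M] by (auto simp: local_pair_def)
  have rR: "?r v \<in> R" if "v \<in> ?vs" for v
    using that i(3) b' by (auto simp: field_simps)
  define Q where "Q = {h \<in> dpolys F ?vs. deval \<delta> ?r h \<in> M}"
  have Q: "prime_dideal (dderiv \<delta>) (dpolys F ?vs) Q" unfolding Q_def
    by (rule prime_dideal_preimage[OF R FR M(1) rR])
  have "generic_for Q ?ys (case_coord a' b)"
    unfolding generic_for_def
  proof
    fix g assume g: "g \<in> dpolys F ?ys"
    have "g \<in> dpolys F ?vs" using g dpolys_mono[of ?ys ?vs F] by blast
    then have "g \<in> Q \<longleftrightarrow> deval \<delta> ?r g \<in> M" by (simp add: Q_def)
    also have "deval \<delta> ?r g = deval \<delta> (case_coord a' b') g" by (rule deval_cong[OF g]) auto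
    also have "\<dots> \<in> M \<longleftrightarrow> deval \<delta> (case_coord a' b) g = 0" by (rule spec[OF g])
    finally show "g \<in> Q \<longleftrightarrow> deval \<delta> (case_coord a' b) g = 0" .
  qed
  then obtain s where s: "\<forall>v\<in>?ys. s v = case_coord a' b v" "generic_for Q ?vs s"
    using generic_extension[of "XV ` {0..n}" ?ys Q "case_coord a' b"] Q by (auto simp: Un_commute)
  define a where "a j = (if j \<le> n then s (XV j) else 0)" for j
  have ev: "deval \<delta> (case_coord a b) p = deval \<delta> s p" if "p \<in> dpolys F ?vs" for p
    by (rule deval_cong[OF that]) (use s(1) in \<open>auto simp: a_def\<close>)
  have ev1: "deval \<delta> a 1 = 1" for a :: "coord \<Rightarrow> 'u"
    using deval_dconst[of \<delta> a 1] by (simp add: dconst_def)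
  have xi: "dvar (XV i) 0 - 1 \<in> dpolys F ?vs"
    using i(1) by (intro subring_diff[OF dpolys_ring] dpolys_dvar[OF F_ring] subring_1[OF dpolys_ring]) auto
  moreover have "deval \<delta> ?r (dvar (XV i) 0 - 1) = 0" using i(2) by (simp add: deval_diff deval_dvar ev1)
  ultimately have "deval \<delta> s (dvar (XV i) 0 - 1) = 0"
    using s(2)[unfolded generic_for_def, rule_format, OF xi] dideal_0[OF M(2)] by (simp add: Q_def)
  then have "s (XV i) = 1" by (simp add: deval_diff deval_dvar ev1)
  then have a: "a \<in> hom_coords n" using i(1) by (auto simp: hom_coords_def a_def intro!: exI[of _ i])
  have "deval \<delta> (case_coord a b) q = 0" if q: "q \<in> S" for q
  proof -
    have qR: "q \<in> dpolys F ?vs" using q S by (auto simp: proj_proj_equations_def)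
    have "deval \<delta> ?r q = 0"
      using proj_proj_equations_scale[OF subsetD[OF S q], of "inverse (a' i)" 1 a' b'] ab q i(2) by simp
    then have "q \<in> Q" using qR dideal_0[OF M(2)] by (simp add: Q_def)
    then show ?thesis using s(2) qR ev[OF qR] by (simp add: generic_for_def)
  qed
  with a show ?thesis by blast
qed

text \<open>
  Let \<open>b\<close> be in the closure of the projection, and let \<open>(a', b')\<close> be a point of \<open>Z\<close> such that \<open>b'\<close> specializes to \<open>b\<close>.
  A maximal extension of this specialization is defined on the coordinates of \<open>a'\<close> in a suitable affine chart, and
  yields a point \<open>(a, b)\<close> of \<open>Z\<close>.
\<close>

theorem elimination_imp_complete:
  assumes P: "P \<subseteq> proj_equations \<delta> F n" and V: "V = proj_zeros \<delta> n P"
    and elim: "\<And>m W D. (m, W, D) \<in> W_collection \<delta> n P \<Longrightarrow>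
      \<exists>g\<in>elim_ideal F n m (diff_ideal \<delta> (dpolys F (XV ` {0..n} \<union> YV ` {1..m})) D). constant_term g \<noteq> 0"
  shows "delta_complete \<delta> F n V"
  unfolding delta_complete_def
proof (intro conjI allI impI)
  show "proj_closed \<delta> F n V" using P V by (auto simp: proj_closed_def)
  fix l W Z assume "proj_closed \<delta> F l W \<and> proj_proj_closed \<delta> F n l Z \<and> Z \<subseteq> V \<times> W"
  then obtain S where S: "S \<subseteq> proj_proj_equations \<delta> F n l" and Z: "Z = proj_proj_zeros \<delta> n l S" and ZV: "Z \<subseteq> V \<times> W"
    by (auto simp: proj_proj_closed_def)
  define S' where "S' = {p \<in> proj_equations \<delta> F l. \<forall>a\<in>hom_coords n. \<forall>b\<in>hom_coords l.
    (\<forall>q\<in>S. deval \<delta> (case_coord a b) q = 0) \<longrightarrow> deval \<delta> (case_coord b (\<lambda>_. 0)) p = 0}"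
  have S': "S' \<subseteq> proj_equations \<delta> F l" by (auto simp: S'_def)
  have "snd ` Z \<subseteq> proj_zeros \<delta> l S'"
  proof clarsimp
    fix A B assume AB: "(A, B) \<in> Z"
    then obtain a b where ab: "a \<in> hom_coords n" "A = pclass n a" "b \<in> hom_coords l" "B = pclass l b"
      by (auto simp: Z proj_proj_zeros_def elim!: proj_spaceE)
    then have "\<forall>q\<in>S. deval \<delta> (case_coord a b) q = 0"
      using AB mem_proj_proj_zeros_iff[OF S ab(1,3)] by (simp add: Z)
    then have "\<forall>p\<in>S'. deval \<delta> (case_coord b (\<lambda>_. 0)) p = 0" using ab by (auto simp: S'_def)
    then show "B \<in> proj_zeros \<delta> l S'" using mem_proj_zeros_iff[OF S' ab(3)] ab(4) by simp
  qed
  moreover have "B \<in> snd ` Z" if B: "B \<in> proj_zeros \<delta> l S'" for B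
  proof -
    obtain b0 where b0: "b0 \<in> hom_coords l" "B = pclass l b0"
      using B by (auto simp: proj_zeros_def elim!: proj_spaceE)
    obtain k where k: "k \<le> l" "b0 k \<noteq> 0" using b0(1) by (auto simp: hom_coords_def)
    define b where "b = (\<lambda>j. inverse (b0 k) * b0 j)"
    have b: "b \<in> hom_coords l" "B = pclass l b" "b k = 1"
      using pclass_scale[OF b0(1), of "inverse (b0 k)"] k(2) b0(2) by (auto simp: b_def)
    have "deval \<delta> (case_coord b (\<lambda>_. 0)) p = 0" if "p \<in> S'" for p
      using B that mem_proj_zeros_iff[OF S' b(1)] b(2) by simp
    then obtain a' b' where a': "a' \<in> hom_coords n" and b': "b' \<in> hom_coords l"
      and ab': "\<forall>q\<in>S. deval \<delta> (case_coord a' b') q = 0"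
      and spec: "\<forall>g\<in>dpolys F (YV ` {0..l}). deval \<delta> (case_coord a' b') g = 0 \<longrightarrow> deval \<delta> (case_coord a' b) g = 0"
      using specialization_exists[OF S b(1) k(1) b(3)] unfolding S'_def by blast
    have Pa': "deval \<delta> (case_coord a' (\<lambda>_. 0)) p = 0" if "p \<in> P" for p
    proof -
      have "(pclass n a', pclass l b') \<in> Z"
        using mem_proj_proj_zeros_iff[OF S a' b'] ab' by (simp add: Z)
      then have "pclass n a' \<in> V" using ZV by blast
      then show ?thesis using mem_proj_zeros_iff[OF P a'] that V by simp
    qed
    let ?ys = "YV ` {0..l}" and ?s' = "case_coord a' b'" and ?s = "case_coord a' b"
    \<comment> \<open>The specialization \<open>F{b'} \<rightarrow> F{b}\<close>; its kernel is
        \<open>M0\<close>.\<close>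
    define R0 M0 where "R0 = deval \<delta> ?s' ` dpolys F ?ys"
      and "M0 = deval \<delta> ?s' ` {g \<in> dpolys F ?ys. deval \<delta> ?s g = 0}"
    have M0_iff: "deval \<delta> ?s' g \<in> M0 \<longleftrightarrow> deval \<delta> ?s g = 0" if g: "g \<in> dpolys F ?ys" for g
    proof
      assume "deval \<delta> ?s' g \<in> M0"
      then obtain g' where g': "g' \<in> dpolys F ?ys" "deval \<delta> ?s g' = 0" "deval \<delta> ?s' g = deval \<delta> ?s' g'"
        by (auto simp: M0_def)
      then have "deval \<delta> ?s (g - g') = 0"
        using bspec[OF spec subring_diff[OF dpolys_ring g g'(1)]] by (simp add: deval_diff)
      then show "deval \<delta> ?s g = 0" using g'(2) by (simp add: deval_diff)
    qed (use g in \<open>auto simp: M0_def\<close>)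
    have pair0: "local_pair \<delta> (R0, M0)" unfolding R0_def
      by (rule local_pair_image[where N = "{g \<in> dpolys F ?ys. deval \<delta> ?s g = 0}"])
        (use prime_dideal_vanishing M0_iff in \<open>auto simp: M0_def\<close>)
    obtain X where X: "local_pair \<delta> X" "dominates (R0, M0) X"
      and max: "\<And>Y. local_pair \<delta> Y \<Longrightarrow> dominates X Y \<Longrightarrow> Y = X"
      by (rule maximal_pair_exists[OF pair0], rule that)
    obtain R M where RM: "X = (R, M)" by (cases X)
    have loc: "local_pair \<delta> (R, M)" using X(1) RM by simp
    have R0R: "R0 \<subseteq> R" and M0: "M \<inter> R0 = M0" using X(2) by (auto simp: RM dominates_def)
    have FR: "F \<subseteq> R"
    proof
      fix c assume "c \<in> F"
      then have "deval \<delta> ?s' (dconst c) \<in> R0" unfolding R0_def by (intro imageI dpolys_dconst)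
      then show "c \<in> R" using R0R by (auto simp: deval_dconst)
    qed
    have "\<exists>i\<le>n. a' i \<noteq> 0 \<and> (\<forall>j\<le>n. a' j / a' i \<in> R)"
      by (rule bounded_chart_exists[OF loc FR _ P a']) (erule (1) max[unfolded RM] | erule Pa' | erule elim)+
    then obtain i where i: "i \<le> n" "a' i \<noteq> 0" "\<And>j. j \<le> n \<Longrightarrow> a' j / a' i \<in> R" by blast
    have b'R: "b' j \<in> R" if "j \<le> l" for j
    proof -
      have "dvar (YV j) 0 \<in> dpolys F ?ys" using that by (auto intro!: dpolys_dvar[OF F_ring])
      then have "deval \<delta> ?s' (dvar (YV j) 0) \<in> R0" unfolding R0_def by (rule imageI)
      then show ?thesis using R0R by (auto simp: deval_dvar)
    qed
    have "deval \<delta> ?s' g \<in> M \<longleftrightarrow> deval \<delta> ?s g = 0" if g: "g \<in> dpolys F ?ys" for g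
      using M0_iff[OF g] M0 g by (auto simp: R0_def)
    from specialize_bounded_point[OF loc FR S ab' i b'R this]
    obtain a where a: "a \<in> hom_coords n" "\<forall>q\<in>S. deval \<delta> (case_coord a b) q = 0" by blast
    then have "(pclass n a, pclass l b) \<in> Z" using mem_proj_proj_zeros_iff[OF S a(1) b(1)] by (simp add: Z)
    then show ?thesis using b(2) by force
  qed
  ultimately have "snd ` Z = proj_zeros \<delta> l S'" by blast
  then show "proj_closed \<delta> F l (snd ` Z)" using S' by (auto simp: proj_closed_def)
qed

end

theorem theorem3p4:
  fixes \<delta> :: "'u::field_char_0 \<Rightarrow> 'u"
    and F :: "'u set"
    and n :: nat
    and P :: "(coord, 'u) dpoly set"
    and V :: "(nat \<Rightarrow> 'u) set set"
  assumes "derivation \<delta>"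
    and "model_DCF0 \<delta> UNIV" and "saturated \<delta>"
    and "model_DCF0 \<delta> F" and "F \<prec> (UNIV :: 'u set)"
    and "P \<subseteq> proj_equations \<delta> F n" and "V = proj_zeros \<delta> n P"
  shows "delta_complete \<delta> F n V \<longleftrightarrow>
    (\<forall>(m, W, D)\<in>W_collection \<delta> n P.
       \<exists>g\<in>elim_ideal F n m (diff_ideal \<delta> (dpolys F (XV ` {0..n} \<union> YV ` {1..m})) D).
         constant_term g \<noteq> 0)"
proof -
  interpret dcf_universe \<delta> F
    using assms by unfold_locales
  show ?thesis
    using complete_imp_elimination[OF _ assms(6,7)] elimination_imp_complete[OF assms(6,7)] by fast
qed

end
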